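(* For every positive integer $\ell$ there exists $q_0=q_0(\ell)$ such that for every even integer $q\geq q_0$ the following holds. Let $G$ be a graph on $q^2+q+1$ vertices with $\frac12 q(q+1)^2+1$ edges. Then either $G$ contains at least $(\ell+1)q-(\ell+1)^2$ copies of $C_4$, or there exist some $s\in\{1,2,\dots,\ell\}$ and an orthogonal polarity graph $H$ of order $q$ on $V(G)$ such that $G$ can be obtained from $H$ by deleting or adding $2s-1$ edges in total. In the latter case, the number of copies of $C_4$ in $G$ is between $sq-s^2$ and $sq+s^2$.
   Context: Copies of $C_4$ are distinct subgraphs isomorphic to the $4$-cycle. A finite projective plane of order $q$ is a pair $(P,\mathcal L)$ with $|P|=q^2+q+1$ and $\mathcal L$ a family of $(q+1)$-subsets of $P$ such that every point lies on exactly $q+1$ lines and two distinct lines meet in exactly one point. A polarity is a bijection $\pi:P\cup\mathcal L\to P\cup\mathcal L$ with $\pi^2=\mathrm{id}$, exchanging $P$ and $\mathcal L$, with $x\in L\Rightarrow \pi(L)\in\pi(x)$. A point $x$ is absolute if $x\in\pi(x)$; $\pi$ is orthogonal if it has exactly $q+1$ absolute points. The polarity graph of $\pi$ is the simple graph on $P$ with distinct $x,y$ adjacent iff $x\in\pi(y)$; an orthogonal polarity graph of order $q$ is the polarity graph of an orthogonal polarity of a projective plane of order $q$. *)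

theory Defs
  imports Complex_Main
begin

section \<open>Simple graphs\<close>

type_synonym 'a ugraph = "'a set \<times> 'a set set"

abbreviation verts :: "'a ugraph \<Rightarrow> 'a set" where
  "verts G \<equiv> fst G"

abbreviation edges :: "'a ugraph \<Rightarrow> 'a set set" where
  "edges G \<equiv> snd G"

definition simple_graph :: "'a ugraph \<Rightarrow> bool" where
  "simple_graph G \<longleftrightarrow> finite (verts G) \<and> (\<forall>e\<in>edges G. e \<subseteq> verts G \<and> card e = 2)"

definition subgraph :: "'a ugraph \<Rightarrow> 'a ugraph \<Rightarrow> bool" where
  "subgraph S G \<longleftrightarrow> simple_graph S \<and> verts S \<subseteq> verts G \<and> edges S \<subseteq> edges G"

definition graph_isomorphic :: "'a ugraph \<Rightarrow> 'b ugraph \<Rightarrow> bool" where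
  "graph_isomorphic G H \<longleftrightarrow>
     (\<exists>f. bij_betw f (verts G) (verts H) \<and> edges H = (\<lambda>e. f ` e) ` edges G)"

definition C4 :: "nat ugraph" where
  "C4 = ({0, 1, 2, 3}, {{0, 1}, {1, 2}, {2, 3}, {3, 0}})"

definition C4_copies :: "'a ugraph \<Rightarrow> 'a ugraph set" where
  "C4_copies G = {S. subgraph S G \<and> graph_isomorphic C4 S}"

text \<open>\<open>D\<close> is the set of deleted edges of \<open>H\<close>, and \<open>A\<close> the set of added edges, which are
  non-edges of \<open>H\<close>.\<close>

definition obtained_by_edge_changes :: "'a ugraph \<Rightarrow> nat \<Rightarrow> 'a ugraph \<Rightarrow> bool" where
  "obtained_by_edge_changes H k G \<longleftrightarrow>
     (\<exists>D A. finite D \<and> D \<subseteq> edges H \<and>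
            finite A \<and> A \<subseteq> {e. e \<subseteq> verts H \<and> card e = 2} - edges H \<and>
            card D + card A = k \<and>
            G = (verts H, (edges H - D) \<union> A))"

section \<open>Projective planes and polarities\<close>

definition projective_plane :: "nat \<Rightarrow> 'a set \<Rightarrow> 'a set set \<Rightarrow> bool" where
  "projective_plane q P \<L> \<longleftrightarrow>
     finite P \<and> card P = q\<^sup>2 + q + 1 \<and>
     (\<forall>L\<in>\<L>. L \<subseteq> P \<and> card L = q + 1) \<and>
     (\<forall>x\<in>P. card {L\<in>\<L>. x \<in> L} = q + 1) \<and>
     (\<forall>L\<in>\<L>. \<forall>M\<in>\<L>. L \<noteq> M \<longrightarrow> (\<exists>!x. x \<in> L \<inter> M))"

text \<open>The disjoint union of points and lines is encoded in the sum type: a point \<open>x\<close> is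
  \<open>Inl x\<close> and a line \<open>L\<close> is \<open>Inr L\<close>. Only the values of \<open>\<pi>\<close> on \<open>P <+> \<L>\<close> matter.\<close>

definition polar_line :: "('a + 'a set \<Rightarrow> 'a + 'a set) \<Rightarrow> 'a \<Rightarrow> 'a set" where
  "polar_line \<pi> x = projr (\<pi> (Inl x))"

definition pole :: "('a + 'a set \<Rightarrow> 'a + 'a set) \<Rightarrow> 'a set \<Rightarrow> 'a" where
  "pole \<pi> L = projl (\<pi> (Inr L))"

definition polarity :: "'a set \<Rightarrow> 'a set set \<Rightarrow> ('a + 'a set \<Rightarrow> 'a + 'a set) \<Rightarrow> bool" where
  "polarity P \<L> \<pi> \<longleftrightarrow>
     bij_betw \<pi> (P <+> \<L>) (P <+> \<L>) \<and>
     (\<forall>z \<in> P <+> \<L>. \<pi> (\<pi> z) = z) \<and>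
     \<pi> ` (Inl ` P) = Inr ` \<L> \<and> \<pi> ` (Inr ` \<L>) = Inl ` P \<and>
     (\<forall>x\<in>P. \<forall>L\<in>\<L>. x \<in> L \<longrightarrow> pole \<pi> L \<in> polar_line \<pi> x)"

definition absolute_points :: "'a set \<Rightarrow> ('a + 'a set \<Rightarrow> 'a + 'a set) \<Rightarrow> 'a set" where
  "absolute_points P \<pi> = {x\<in>P. x \<in> polar_line \<pi> x}"

definition orthogonal_polarity ::
    "nat \<Rightarrow> 'a set \<Rightarrow> 'a set set \<Rightarrow> ('a + 'a set \<Rightarrow> 'a + 'a set) \<Rightarrow> bool" where
  "orthogonal_polarity q P \<L> \<pi> \<longleftrightarrow> polarity P \<L> \<pi> \<and> card (absolute_points P \<pi>) = q + 1"

definition polarity_graph :: "'a set \<Rightarrow> ('a + 'a set \<Rightarrow> 'a + 'a set) \<Rightarrow> 'a ugraph" where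
  "polarity_graph P \<pi> = (P, {{x, y} | x y. x \<in> P \<and> y \<in> P \<and> x \<noteq> y \<and> x \<in> polar_line \<pi> y})"

definition orthogonal_polarity_graph :: "nat \<Rightarrow> 'a ugraph \<Rightarrow> bool" where
  "orthogonal_polarity_graph q H \<longleftrightarrow>
     (\<exists>P \<L> \<pi>. projective_plane q P \<L> \<and> orthogonal_polarity q P \<L> \<pi> \<and> H = polarity_graph P \<pi>)"

end

theory Submission
  imports Defs
begin

text \<open>Write \<open>x v = q + 1 - deg v\<close>; the edge count says \<open>\<Sum>x = q - 1\<close>, and having \<open>O(q)\<close> 4-cycles
  means that all but \<open>O(q)\<close> pairs of vertices have at most one common neighbour.
  Since \<open>q\<close> is even, a vertex of degree \<open>q + 1\<close> that lies on no 4-cycle cannot have its neighbourhood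
  perfectly matched, so it is joined by an edge to a vertex with which it has no common neighbour. Counting
  codegrees turns this into a lower bound for the sum of \<open>x\<close> over the neighbourhood of such a vertex,
  and double counting shows that all but \<open>O(q)\<close> vertices are \<open>good\<close>: they have degree \<open>q + 1\<close>, lie
  on no 4-cycle, and have exactly one such partner. All good neighbours of a partner \<open>w\<close> turn out to
  have the same partner \<open>w\<close>, so the partners behave like the absolute points of a polarity, and there
  are \<open>q + O(1)\<close> of them.

  Add loops at these points to the adjacency matrix to get \<open>M\<close>. Then \<open>E = M\<^sup>2 - qI - J\<close> has only
  \<open>O(q)\<close> nonzero entries. As \<open>E\<close> almost commutes with \<open>M\<close>, a nonzero entry propagates to about \<open>q\<close>
  nonzero entries of its column, unless its row index is one of boundedly many vertices; hence boundedly
  many vertices cover all errors. The neighbourhoods of the others are lines of an almost complete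
  projective plane, which can be completed, and the polarity extends. Thus \<open>G\<close> differs from a polarity
  graph \<open>H\<close> in boundedly many edges. The absolute points of \<open>H\<close> form a small blocking set, which forces
  \<open>H\<close> to be orthogonal.

  Finally, each edge added to \<open>H\<close> closes \<open>q - 1\<close>, \<open>q\<close> or \<open>q + 1\<close> paths of length 3, a deleted edge destroys
  at most one of them for each added edge, and two added edges create at most two further 4-cycles.\<close>

text \<open>Everything rests on the identity \<open>f v = q * x v + s v + c v\<close> between missed
  vertices, degree deficiencies and excess codegrees. Where \<open>x v = c v = 0\<close> it reads
  \<open>s v = f v\<close>, and parity makes this at least 1, while the sum of \<open>s\<close> over
  all vertices is below the number of vertices; there is almost no slack. The obstacle is vertices
  of degree above \<open>q + 1\<close>: their negative \<open>x\<close> could distort these sums.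
  They are controlled in stages, each using the previous one: every single surplus is bounded, the
  total surplus is \<open>O(q)\<close>, and finally the total is bounded. Nothing is known about
  where the 4-cycles lie, so local arguments exclude vertices at which about \<open>q / 4\<close>
  disturbances gather; averaging and second-moment counts leave boundedly many of these. The number
  of edge changes is at first only bounded. That it is at most \<open>2 * l - 1\<close> comes from
  the lower bound \<open>a * q - a^2\<close> for the number of 4-cycles with \<open>a\<close> added
  edges, which for \<open>a\<close> between \<open>l + 1\<close> and \<open>q - (l + 1)\<close> is
  at least its value at \<open>l + 1\<close>.\<close>

section \<open>Parity of finite sets that are paired off\<close>

lemma even_card_symmetric_irreflexive:
  assumes "finite R" "sym R" "irrefl R"
  shows "even (card R)"
  using assms
proof (induction "card R" arbitrary: R rule: less_induct)
  case less
  show ?case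
  proof (cases "R = {}")
    case False
    then obtain a b where ab: "(a, b) \<in> R" by auto
    then have ba: "(b, a) \<in> R" and ne: "a \<noteq> b"
      using less.prems by (auto dest: symD irreflD)
    let ?R = "R - {(a, b), (b, a)}"
    have "card {(a, b), (b, a)} = 2" using ne by simp
    then have c: "card ?R + 2 = card R"
      using card_Diff_subset[of "{(a, b), (b, a)}" R] ab ba less.prems(1)
        card_mono[of R "{(a, b), (b, a)}"] by simp
    have "sym ?R" "irrefl ?R"
      using less.prems by (auto simp: sym_def irrefl_def)
    then have "even (card ?R)" using less.hyps[of ?R] c less.prems(1) by simp
    then show ?thesis using c by (metis even_add even_numeral)
  qed simp
qed

text \<open>Applied to neighbourhoods and to polar lines, both with \<open>q + 1\<close> elements,
  an odd number for even \<open>q\<close>.\<close>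

lemma even_card_of_unique_partners:
  assumes fin: "finite X" and sym: "\<And>u v. u \<in> X \<Longrightarrow> v \<in> X \<Longrightarrow> R u v \<Longrightarrow> R v u"
    and irr: "\<And>u. u \<in> X \<Longrightarrow> \<not> R u u"
    and one: "\<And>u. u \<in> X \<Longrightarrow> card {v \<in> X. R u v} = 1"
  shows "even (card X)"
proof -
  let ?S = "Sigma X (\<lambda>u. {v \<in> X. R u v})"
  have "card ?S = (\<Sum>u\<in>X. card {v \<in> X. R u v})"
    using fin by (intro card_SigmaI) auto
  also have "\<dots> = card X" using one by simp
  finally have "card ?S = card X" .
  moreover have "even (card ?S)"
    using fin sym irr by (intro even_card_symmetric_irreflexive) (auto simp: sym_def irrefl_def)
  ultimately show ?thesis by simp
qed

section \<open>Symmetric relations on a finite set\<close>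

text \<open>Loops are allowed, so that the locale also covers adjacency with loops at the absolute
  points and the point-to-polar-line map of a polarity. \<open>cd v w\<close> is the entry of the
  squared adjacency matrix.\<close>

locale finite_symrel =
  fixes V :: "'a set" and N :: "'a \<Rightarrow> 'a set"
  assumes fin: "finite V"
    and sub: "v \<in> V \<Longrightarrow> N v \<subseteq> V"
    and sym: "u \<in> V \<Longrightarrow> v \<in> V \<Longrightarrow> u \<in> N v \<longleftrightarrow> v \<in> N u"
begin

definition d :: "'a \<Rightarrow> int" where "d v = int (card (N v))"
definition cd :: "'a \<Rightarrow> 'a \<Rightarrow> int" where "cd v w = int (card (N v \<inter> N w))"

lemma fin_N: "v \<in> V \<Longrightarrow> finite (N v)"
  using sub fin finite_subset by metis

lemma cd_commute: "cd v w = cd w v"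
  by (simp add: cd_def Int_commute)

lemma cd_self: "cd v v = d v"
  by (simp add: cd_def d_def)

lemma cd_nonneg: "cd v w \<ge> 0"
  by (simp add: cd_def)

lemma sum_nbrs_swap:
  fixes g :: "'a \<Rightarrow> 'a \<Rightarrow> 'b::comm_monoid_add"
  assumes "X \<subseteq> V"
  shows "(\<Sum>v\<in>X. \<Sum>u\<in>N v. g v u) = (\<Sum>u\<in>V. \<Sum>v\<in>N u \<inter> X. g v u)"
proof -
  have fX: "finite X" using assms fin finite_subset by blast
  have "(\<Sum>v\<in>X. \<Sum>u\<in>N v. g v u) = (\<Sum>v\<in>X. \<Sum>u\<in>{u \<in> V. u \<in> N v}. g v u)"
    using sub assms by (intro sum.cong refl) auto
  also have "\<dots> = (\<Sum>u\<in>V. \<Sum>v\<in>{v \<in> X. u \<in> N v}. g v u)"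
    using fX fin by (rule sum.swap_restrict)
  also have "\<dots> = (\<Sum>u\<in>V. \<Sum>v\<in>N u \<inter> X. g v u)"
    using assms sym by (intro sum.cong refl) auto
  finally show ?thesis .
qed

lemma sum_over_nbrs:
  fixes g :: "'a \<Rightarrow> int"
  assumes "X \<subseteq> V"
  shows "(\<Sum>v\<in>X. \<Sum>u\<in>N v. g u) = (\<Sum>u\<in>V. int (card (N u \<inter> X)) * g u)"
  using sum_nbrs_swap[OF assms, of "\<lambda>v u. g u"] by simp

lemma sum_cd:
  assumes "v \<in> V" "X \<subseteq> V"
  shows "(\<Sum>w\<in>X. cd v w) = (\<Sum>u\<in>N v. int (card (N u \<inter> X)))"
proof -
  have "cd v w = (\<Sum>u\<in>N w. of_bool (u \<in> N v))" if "w \<in> X" for w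
    using fin_N that assms(2) by (subst sum.inter_filter[symmetric, where P = "\<lambda>u. u \<in> N v" and g = "\<lambda>_. 1", simplified]
        | auto simp: cd_def Int_def conj_commute)+
  then have "(\<Sum>w\<in>X. cd v w) = (\<Sum>w\<in>X. \<Sum>u\<in>N w. of_bool (u \<in> N v))" by simp
  also have "\<dots> = (\<Sum>u\<in>V. int (card (N u \<inter> X)) * of_bool (u \<in> N v))"
    using sum_over_nbrs[OF assms(2)] .
  also have "\<dots> = (\<Sum>u\<in>N v. int (card (N u \<inter> X)) * of_bool (u \<in> N v))"
    using fin sub[OF assms(1)] by (intro sum.mono_neutral_right) auto
  also have "\<dots> = (\<Sum>u\<in>N v. int (card (N u \<inter> X)))"
    by simp
  finally show ?thesis .
qed

lemma sum_cd_pairs: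
  assumes "X \<subseteq> V"
  shows "(\<Sum>v\<in>X. \<Sum>w\<in>X. cd v w) = (\<Sum>u\<in>V. (int (card (N u \<inter> X)))\<^sup>2)"
proof -
  have "(\<Sum>v\<in>X. \<Sum>w\<in>X. cd v w) = (\<Sum>v\<in>X. \<Sum>u\<in>N v. int (card (N u \<inter> X)))"
    by (rule sum.cong[OF refl]) (use sum_cd assms in auto)
  also have "\<dots> = (\<Sum>u\<in>V. int (card (N u \<inter> X)) * int (card (N u \<inter> X)))"
    using sum_over_nbrs[OF assms] .
  finally show ?thesis by (simp add: power2_eq_square)
qed

text \<open>Both sides count ordered pairs of distinct members of \<open>X\<close> together with a
  common neighbour.\<close>

lemma sum_cd_offdiag:
  assumes "X \<subseteq> V"
  shows "(\<Sum>v\<in>X. \<Sum>w\<in>X - {v}. cd v w)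
    = (\<Sum>u\<in>V. int (card (N u \<inter> X)) * (int (card (N u \<inter> X)) - 1))"
proof -
  have fX: "finite X" using assms fin finite_subset by blast
  have "(\<Sum>v\<in>X. \<Sum>w\<in>X - {v}. cd v w) = (\<Sum>v\<in>X. (\<Sum>w\<in>X. cd v w) - d v)"
    using fX by (intro sum.cong refl) (simp add: sum_diff1 cd_self)
  also have "\<dots> = (\<Sum>u\<in>V. (int (card (N u \<inter> X)))\<^sup>2) - (\<Sum>v\<in>X. d v)"
    by (simp add: sum_subtractf sum_cd_pairs assms)
  also have "(\<Sum>v\<in>X. d v) = (\<Sum>u\<in>V. int (card (N u \<inter> X)))"
    using sum_over_nbrs[OF assms, of "\<lambda>_. 1"] by (simp add: d_def)
  finally show ?thesis
    by (simp add: sum_subtractf[symmetric] power2_eq_square right_diff_distrib)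
qed

text \<open>Both sides count walks of length 3 between \<open>u\<close> and \<open>v\<close>, split
  at the step next to one end or to the other.\<close>

lemma walks3:
  assumes "u \<in> V" "v \<in> V"
  shows "(\<Sum>t\<in>N v. cd t u) = (\<Sum>t\<in>N u. cd v t)"
proof -
  have "(\<Sum>t\<in>N v. cd t u) = (\<Sum>t\<in>N u. int (card (N t \<inter> N v)))"
    using sum_cd[of u "N v"] sub assms by (simp add: cd_commute)
  then show ?thesis by (simp add: cd_def Int_commute)
qed

end

section \<open>Nearly extremal graphs with few 4-cycles\<close>

text \<open>\<open>excess\<close> runs over ordered pairs and each 4-cycle pays for its four ordered
  diagonals, so fewer than \<open>(l + 1) * q\<close> 4-cycles allow \<open>K = 4 * (l + 1)\<close>.
  \<open>sum_d\<close> is twice the edge count.\<close>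

locale near_extremal = finite_symrel V N for V :: "'a set" and N +
  fixes q K :: int
  assumes irrefl: "v \<in> V \<Longrightarrow> v \<notin> N v"
    and card_V: "int (card V) = q\<^sup>2 + q + 1"
    and sum_d: "(\<Sum>v\<in>V. d v) = q * (q + 1)\<^sup>2 + 2"
    and even_q: "even q"
    and K_pos: "1 \<le> K"
    and q_ge: "4 \<le> q"
    and excess: "(\<Sum>v\<in>V. \<Sum>w\<in>V - {v}. max 0 (cd v w - 1)) \<le> K * q"
begin

section \<open>Degree deficiencies and codegree counts\<close>

definition x :: "'a \<Rightarrow> int" where "x v = q + 1 - d v"
definition s :: "'a \<Rightarrow> int" where "s v = (\<Sum>u\<in>N v. x u)"
definition c :: "'a \<Rightarrow> int" where "c v = (\<Sum>w\<in>V - {v}. max 0 (cd v w - 1))"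
definition miss :: "'a \<Rightarrow> 'a set" where "miss v = {w \<in> V - {v}. cd v w = 0}"
definition f :: "'a \<Rightarrow> int" where "f v = int (card (miss v))"
definition neg :: int where "neg = (\<Sum>v\<in>V. max 0 (- x v))"

lemma c_nonneg: "c v \<ge> 0"
  unfolding c_def by (intro sum_nonneg) auto

lemma f_nonneg: "f v \<ge> 0"
  by (simp add: f_def)

lemma sum_c: "(\<Sum>v\<in>V. c v) \<le> K * q"
  using excess by (simp add: c_def)

lemma c_le: "v \<in> V \<Longrightarrow> c v \<le> K * q"
  using sum_c member_le_sum[of v V c] c_nonneg fin by force

lemma sum_x: "(\<Sum>v\<in>V. x v) = q - 1"
proof -
  have "(\<Sum>v\<in>V. x v) = int (card V) * (q + 1) - (\<Sum>v\<in>V. d v)"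
    by (simp add: x_def sum_subtractf)
  then show ?thesis
    by (simp add: card_V sum_d algebra_simps power2_eq_square)
qed

lemma card_V_minus:
  assumes "v \<in> V"
  shows "int (card (V - {v})) = q * (q + 1)"
proof -
  have "card V = Suc (card (V - {v}))"
    using fin assms by (rule card.remove)
  then have "int (card V) = int (card (V - {v})) + 1" by simp
  then show ?thesis using card_V by (simp add: power2_eq_square algebra_simps)
qed

lemma sum_cd_others:
  assumes "v \<in> V"
  shows "(\<Sum>w\<in>V - {v}. cd v w) = q * (q + 1) - q * x v - s v"
proof -
  have "(\<Sum>w\<in>V. cd v w) = (\<Sum>u\<in>N v. d u)"
  proof -
    have "N u \<inter> V = N u" if "u \<in> N v" for u
      using that sub assms by blast
    then show ?thesis using sum_cd[of v V] assms by (simp add: d_def)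
  qed
  also have "\<dots> = (\<Sum>u\<in>N v. q + 1 - x u)"
    by (simp add: x_def)
  also have "\<dots> = d v * (q + 1) - s v"
    by (simp add: sum_subtractf s_def d_def)
  finally have "(\<Sum>w\<in>V. cd v w) = (q + 1 - x v) * (q + 1) - s v"
    by (simp add: x_def)
  then show ?thesis
    using assms fin by (simp add: sum_diff1 cd_self x_def algebra_simps)
qed

lemma sum_excess_others:
  assumes "v \<in> V"
  shows "(\<Sum>w\<in>V - {v}. cd v w - 1) = c v - f v"
proof -
  have "(\<Sum>w\<in>V - {v}. cd v w - 1)
      = (\<Sum>w\<in>V - {v}. max 0 (cd v w - 1) - (if cd v w = 0 then 1 else 0))"
    using cd_nonneg[of v] by (intro sum.cong refl) (smt (verit))
  also have "\<dots> = c v - f v"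
    using fin by (simp add: sum_subtractf c_def f_def miss_def sum.If_cases Int_def)
  finally show ?thesis .
qed

text \<open>The off-diagonal row sum of codegrees is evaluated twice: from the degrees of the
  neighbours of \<open>v\<close>, and by comparing each codegree with 1. Since \<open>f v\<close> is
  nonnegative, a degree surplus at \<open>v\<close> must be paid for by \<open>s v\<close> or
  \<open>c v\<close>.\<close>

lemma f_eq: "v \<in> V \<Longrightarrow> f v = q * x v + s v + c v"
  using sum_excess_others[of v] sum_cd_others[of v] card_V_minus[of v]
  by (simp only: sum_subtractf) simp

text \<open>Counted from the other end, the sum is \<open>\<Sum>d * x\<close>. It is below the
  number of vertices, so \<open>s\<close> has little room to exceed 1 at typical vertices.\<close>

lemma sum_s: "(\<Sum>v\<in>V. s v) = q\<^sup>2 - 1 - (\<Sum>v\<in>V. (x v)\<^sup>2)"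
proof -
  have "(\<Sum>v\<in>V. s v) = (\<Sum>u\<in>V. int (card (N u \<inter> V)) * x u)"
    unfolding s_def by (rule sum_over_nbrs) simp
  also have "\<dots> = (\<Sum>u\<in>V. (q + 1 - x u) * x u)"
    using sub by (intro sum.cong refl) (simp add: x_def d_def Int_absorb2)
  also have "\<dots> = (q + 1) * (\<Sum>u\<in>V. x u) - (\<Sum>v\<in>V. (x v)\<^sup>2)"
    by (simp add: left_diff_distrib sum_subtractf sum_distrib_left power2_eq_square)
  finally show ?thesis
    by (simp add: sum_x power2_eq_square algebra_simps)
qed

text \<open>One common neighbour per ordered pair gives the main term; all further ones are counted
  by \<open>c\<close>.\<close>

lemma sum_card_nbrs_le:
  assumes X: "X \<subseteq> V"
  shows "(\<Sum>u\<in>V. int (card (N u \<inter> X)) * (int (card (N u \<inter> X)) - 1))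
    \<le> int (card X) * (int (card X) - 1) + K * q"
proof -
  have fX: "finite X" using X fin finite_subset by blast
  have "(\<Sum>a\<in>X. \<Sum>b\<in>X - {a}. cd a b) \<le> (\<Sum>a\<in>X. \<Sum>b\<in>X - {a}. 1 + max 0 (cd a b - 1))"
    by (intro sum_mono) auto
  also have "\<dots> = (\<Sum>a\<in>X. int (card (X - {a}))) + (\<Sum>a\<in>X. \<Sum>b\<in>X - {a}. max 0 (cd a b - 1))"
    by (simp add: sum.distrib)
  also have "(\<Sum>a\<in>X. int (card (X - {a}))) = int (card X) * (int (card X) - 1)"
  proof -
    have "int (card (X - {a})) = int (card X) - 1" if "a \<in> X" for a
      using card.remove[OF fX that] by simp
    then show ?thesis by simp
  qed
  also have "(\<Sum>a\<in>X. \<Sum>b\<in>X - {a}. max 0 (cd a b - 1)) \<le> (\<Sum>a\<in>X. c a)"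
    unfolding c_def using X fin by (intro sum_mono sum_mono2) auto
  also have "\<dots> \<le> (\<Sum>a\<in>V. c a)"
    using X fin c_nonneg by (intro sum_mono2) auto
  also have "\<dots> \<le> K * q" by (rule sum_c)
  finally show ?thesis by (simp add: sum_cd_offdiag[OF X])
qed

text \<open>Counting the pairs outside the neighbourhood of \<open>v\<close> by their common neighbours.\<close>

lemma outer_pairs:
  assumes v: "v \<in> V"
  defines "y \<equiv> \<lambda>w. x w - 1 + cd v w"
  shows "2 * (q - 1) * s v + (\<Sum>w\<in>V - {v}. y w * (y w - 1))
    \<le> 2 * (q - 1)\<^sup>2 + x v * (x v + 1) + K * q"
proof -
  define X where "X = V - N v"
  have X: "X \<subseteq> V" "finite X" using fin by (auto simp: X_def)
  have cX: "int (card X) = q\<^sup>2 + x v"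
    using card_V sub[OF v] fin_N[OF v] card_mono[OF fin sub[OF v]]
    by (simp add: X_def card_Diff_subset of_nat_diff x_def d_def)
  \<comment> \<open>Thus \<open>y w\<close> is the amount by which \<open>w\<close> has fewer than
    \<open>q\<close> neighbours in \<open>X\<close>.\<close>
  have nX: "int (card (N w \<inter> X)) = q - y w" if "w \<in> V" for w
  proof -
    have "N w \<inter> X = N w - (N v \<inter> N w)" using sub[OF that] by (auto simp: X_def)
    moreover have "card (N v \<inter> N w) \<le> card (N w)"
      using fin_N[OF that] by (simp add: card_mono)
    ultimately show ?thesis
      using fin_N[OF that] by (simp add: card_Diff_subset of_nat_diff y_def x_def d_def cd_def)
  qed
  have "(\<Sum>w\<in>V - {v}. (q - y w) * (q - y w - 1))
      = (\<Sum>w\<in>V - {v}. int (card (N w \<inter> X)) * (int (card (N w \<inter> X)) - 1))"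
    by (intro sum.cong refl) (simp add: nX)
  also have "\<dots> = (\<Sum>w\<in>V. int (card (N w \<inter> X)) * (int (card (N w \<inter> X)) - 1))"
    using v fin by (simp add: sum_diff1 X_def)
  also have "\<dots> \<le> int (card X) * (int (card X) - 1) + K * q"
    using X(1) by (rule sum_card_nbrs_le)
  finally have le: "(\<Sum>w\<in>V - {v}. (q - y w) * (q - y w - 1))
      \<le> (q\<^sup>2 + x v) * (q\<^sup>2 + x v - 1) + K * q"
    by (simp add: cX)
  \<comment> \<open>Expanded around \<open>q\<close>, the linear term sums to a multiple of
    \<open>s v\<close> plus known quantities, and the remainder \<open>y * (y - 1)\<close> is
    nonnegative on integers.\<close>
  have "(q - y w) * (q - y w - 1) = q * (q - 1) - 2 * (q - 1) * y w + y w * (y w - 1)" for w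
    by (simp add: algebra_simps)
  then have "(\<Sum>w\<in>V - {v}. (q - y w) * (q - y w - 1))
      = q * (q + 1) * (q * (q - 1)) - 2 * (q - 1) * (\<Sum>w\<in>V - {v}. y w)
        + (\<Sum>w\<in>V - {v}. y w * (y w - 1))"
    using card_V_minus[OF v] by (simp add: sum.distrib sum_subtractf sum_distrib_left)
  moreover have "(\<Sum>w\<in>V - {v}. y w) = q - 1 - x v - q * x v - s v"
  proof -
    have "(\<Sum>w\<in>V - {v}. y w) = (\<Sum>w\<in>V - {v}. x w) + (\<Sum>w\<in>V - {v}. cd v w) - q * (q + 1)"
      using card_V_minus[OF v] by (simp add: y_def sum.distrib sum_subtractf)
    then show ?thesis
      using sum_cd_others[OF v] v fin by (simp add: sum_diff1 sum_x)
  qed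
  ultimately show ?thesis
    using le by (simp add: algebra_simps power2_eq_square)
qed

lemma quad_nonneg: "0 \<le> (z::int) * (z - 1)"
  by (cases "z \<ge> 1") (auto intro: mult_nonpos_nonpos)

lemma d_le: 
  assumes "v \<in> V" shows "d v \<le> q\<^sup>2 + q"
proof -
  have "N v \<subseteq> V - {v}" using sub irrefl assms by blast
  then have "card (N v) \<le> card (V - {v})" using fin by (intro card_mono) auto
  then have "int (card (N v)) \<le> int (card (V - {v}))" by linarith
  then show ?thesis using card_V_minus[OF assms] by (simp add: d_def power2_eq_square algebra_simps)
qed

text \<open>With \<open>t = - x v\<close>, nonnegativity of \<open>f v\<close> forces
  \<open>s v\<close> to be at least \<open>q * t - K * q\<close>. In \<open>outer_pairs\<close> this
  gets the factor \<open>2 * (q - 1)\<close>, whereas the crude bound \<open>t <= q^2\<close> keeps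
  \<open>t * (t - 1)\<close> below about half of the resulting main term.\<close>

lemma x_lower:
  assumes v: "v \<in> V"
  shows "- (4 * K + 4) \<le> x v"
proof (rule ccontr)
  assume *: "\<not> ?thesis"
  define t where "t = - x v"
  have t: "t > 4 * K + 4" using * by (simp add: t_def)
  have tq: "t \<le> q\<^sup>2" using d_le[OF v] by (simp add: t_def x_def)
  have "s v \<ge> q * t - c v" using f_eq[OF v] f_nonneg[of v] by (simp add: t_def)
  then have "s v \<ge> q * t - K * q" using c_le[OF v] by linarith
  then have "2 * (q - 1) * (q * t - K * q) \<le> 2 * (q - 1) * s v"
    using q_ge by (intro mult_left_mono) auto
  also have "\<dots> \<le> 2 * (q - 1)\<^sup>2 + t * (t - 1) + K * q"
  proof -
    have "0 \<le> (\<Sum>w\<in>V - {v}. (x w - 1 + cd v w) * (x w - 1 + cd v w - 1))"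
      by (intro sum_nonneg quad_nonneg)
    moreover have "x v * (x v + 1) = t * (t - 1)" by (simp add: t_def algebra_simps)
    ultimately show ?thesis using outer_pairs[OF v] by linarith
  qed
  also have "t * (t - 1) \<le> t * q\<^sup>2"
    using tq t K_pos by (intro mult_left_mono) auto
  finally have "t * (q * (q - 2)) \<le> 2 * (q - 1)\<^sup>2 + 2 * (q - 1) * (K * q) + K * q"
    by (simp add: algebra_simps power2_eq_square)
  also have "\<dots> \<le> 2 * q\<^sup>2 + 2 * K * q\<^sup>2"
  proof -
    have "2 * (q - 1)\<^sup>2 + 2 * (q - 1) * (K * q) + K * q
        = 2 * q\<^sup>2 + 2 * K * q\<^sup>2 - (4 * q - 2) - K * q"
      by (simp add: algebra_simps power2_eq_square)
    moreover have "0 \<le> K * q" using K_pos q_ge by simp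
    ultimately show ?thesis using q_ge by linarith
  qed
  finally have 1: "t * (q * (q - 2)) \<le> (2 * K + 2) * q\<^sup>2" by (simp add: algebra_simps)
  have "(4 * K + 4) * (q * (q - 2)) < t * (q * (q - 2))"
    using t q_ge by (intro mult_strict_right_mono) auto
  moreover have "(4 * K + 4) * (q * (q - 2)) = (2 * K + 2) * (q * (2 * q - 4))"
    by (simp add: algebra_simps)
  moreover have "(2 * K + 2) * (q * (2 * q - 4)) \<ge> (2 * K + 2) * q\<^sup>2"
  proof (rule mult_left_mono)
    have "q * q \<le> q * (2 * q - 4)" using q_ge by (intro mult_left_mono) auto
    then show "q\<^sup>2 \<le> q * (2 * q - 4)" by (simp only: power2_eq_square)
  qed (use K_pos in simp)
  ultimately show False using 1 by linarith
qed

end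

definition deg_bd :: "int \<Rightarrow> int" where "deg_bd K = 4 * K + 4"
definition neg_bd :: "int \<Rightarrow> int" where "neg_bd K = deg_bd K * K + 1"
definition sq_bd :: "int \<Rightarrow> int" where "sq_bd K = 2 * neg_bd K + 2 * K"
definition bad_bd :: "int \<Rightarrow> int" where "bad_bd K = 1 + 2 * neg_bd K + K + sq_bd K"

context near_extremal
begin

lemma x_ge: "v \<in> V \<Longrightarrow> - deg_bd K \<le> x v"
  using x_lower by (simp add: deg_bd_def)

lemma deg_bd_pos: "8 \<le> deg_bd K"
  using K_pos by (simp add: deg_bd_def)

text \<open>If some vertex of surplus degree has \<open>c v = 0\<close>, then
  \<open>s v >= q\<close>, so \<open>outer_pairs\<close> is nearly tight and its quadratic
  remainder, of order \<open>q\<close>, dominates the surplus of all other vertices. Otherwise each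
  surplus vertex contributes to \<open>c\<close>, whose total is at most
  \<open>K * q\<close>.\<close>

lemma neg_le:
  assumes big: "deg_bd K + (deg_bd K)\<^sup>2 \<le> q"
  shows "neg \<le> neg_bd K * q"
proof (cases "\<exists>v\<in>V. x v < 0 \<and> c v = 0")
  case True
  then obtain v where v: "v \<in> V" "x v < 0" "c v = 0" by blast
  let ?y = "\<lambda>w. x w - 1 + cd v w"
  have "q * (- x v) \<le> s v" using f_eq[OF v(1)] f_nonneg[of v] v(3) by simp
  moreover have "q * 1 \<le> q * (- x v)" using v(2) q_ge by (intro mult_left_mono) auto
  ultimately have "q - 1 \<le> s v" by linarith
  then have "2 * (q - 1) * (q - 1) \<le> 2 * (q - 1) * s v"
    using q_ge by (intro mult_left_mono) auto
  then have 1: "(\<Sum>w\<in>V - {v}. ?y w * (?y w - 1)) \<le> x v * (x v + 1) + K * q"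
    using outer_pairs[OF v(1)] by (simp add: power2_eq_square algebra_simps)
  have cd1: "cd v w \<le> 1" if "w \<in> V - {v}" for w
  proof -
    have "max 0 (cd v w - 1) \<le> c v"
      unfolding c_def using that fin by (intro member_le_sum) auto
    then show ?thesis using v(3) by linarith
  qed
  have "(\<Sum>w\<in>V - {v}. max 0 (- x w)) \<le> (\<Sum>w\<in>V - {v}. ?y w * (?y w - 1))"
  proof (intro sum_mono)
    fix w assume w: "w \<in> V - {v}"
    show "max 0 (- x w) \<le> ?y w * (?y w - 1)"
    proof (cases "x w < 0")
      case True
      then have "?y w \<le> x w" using cd1[OF w] by simp
      then have "(- x w) * 1 \<le> (- ?y w) * (1 - ?y w)"
        using True by (intro mult_mono) auto
      then show ?thesis using True by (simp add: algebra_simps)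
    qed (use quad_nonneg[of "?y w"] in auto)
  qed
  moreover have "neg = max 0 (- x v) + (\<Sum>w\<in>V - {v}. max 0 (- x w))"
    unfolding neg_def using v(1) fin by (simp add: sum.remove)
  ultimately have "neg \<le> - x v + x v * (x v + 1) + K * q" using 1 v(2) by linarith
  also have "- x v + x v * (x v + 1) = (- x v)\<^sup>2" by (simp add: power2_eq_square algebra_simps)
  also have "(- x v)\<^sup>2 \<le> (deg_bd K)\<^sup>2" using x_ge[OF v(1)] v(2) by (intro power_mono) auto
  also have "(deg_bd K)\<^sup>2 \<le> q" using big deg_bd_pos by linarith
  also have "q + K * q \<le> neg_bd K * q"
  proof -
    have "K * 1 \<le> K * deg_bd K" using deg_bd_pos K_pos by (intro mult_left_mono) auto
    then have "(1 + K) * q \<le> neg_bd K * q"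
      using q_ge by (intro mult_right_mono) (auto simp: neg_bd_def algebra_simps)
    then show ?thesis by (simp add: algebra_simps)
  qed
  finally show ?thesis by simp
next
  case False
  have "neg \<le> (\<Sum>v\<in>V. deg_bd K * c v)"
    unfolding neg_def
  proof (intro sum_mono)
    fix v assume v: "v \<in> V"
    show "max 0 (- x v) \<le> deg_bd K * c v"
    proof (cases "x v < 0")
      case True
      then have "c v \<ge> 1" using False v c_nonneg[of v] by force
      then have "deg_bd K * 1 \<le> deg_bd K * c v" using deg_bd_pos by (intro mult_left_mono) auto
      then show ?thesis using x_ge[OF v] deg_bd_pos by linarith
    qed (use deg_bd_pos c_nonneg[of v] in auto)
  qed
  also have "\<dots> \<le> deg_bd K * (K * q)"
    using sum_c deg_bd_pos by (simp add: sum_distrib_left[symmetric])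
  also have "\<dots> \<le> neg_bd K * q" using q_ge by (simp add: neg_bd_def algebra_simps)
  finally show ?thesis .
qed

text \<open>Otherwise the neighbours of \<open>v\<close> would be perfectly matched among themselves, although
  there are \<open>q + 1\<close> of them.\<close>

lemma exists_missing_nbr:
  assumes v: "v \<in> V" "x v = 0" "c v = 0"
  shows "\<exists>u\<in>N v. cd v u = 0"
proof (rule ccontr)
  assume *: "\<not> ?thesis"
  have "even (card (N v))"
  proof (rule even_card_of_unique_partners[where R = "\<lambda>u w. w \<in> N u"])
    show "finite (N v)" using fin_N v by blast
    show "w \<in> N u \<Longrightarrow> u \<in> N w" if "u \<in> N v" "w \<in> N v" for u w
      using sym[of u w] sub[OF v(1)] that by auto
    show "u \<notin> N u" if "u \<in> N v" for u
      using irrefl sub[OF v(1)] that by auto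
    show "card {w \<in> N v. w \<in> N u} = 1" if "u \<in> N v" for u
    proof -
      have "u \<in> V - {v}" using that sub irrefl v(1) by auto
      then have "max 0 (cd v u - 1) \<le> c v"
        unfolding c_def using fin by (intro member_le_sum) auto
      then have "cd v u \<le> 1" using v(3) by linarith
      moreover have "cd v u \<noteq> 0" using * that by blast
      ultimately have "cd v u = 1" using cd_nonneg[of v u] by linarith
      then show ?thesis by (simp add: cd_def Int_def)
    qed
  qed
  then have "even (d v)" by (simp add: d_def)
  moreover have "d v = q + 1" using v(2) by (simp add: x_def)
  ultimately show False using even_q by simp
qed

section \<open>Good vertices by a second-order count\<close>

definition good :: "'a set" where "good = {v \<in> V. x v = 0 \<and> c v = 0 \<and> f v = 1}"

text \<open>Every vertex of \<open>Z\<close> has \<open>s v >= 1\<close> by the parity argument, and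
  at least 2 if it is not good, so the value of \<open>\<Sum>s\<close> leaves little room for
  deviations. The surplus vertices add about \<open>q * neg\<close> to \<open>\<Sum>s\<close>
  themselves and may remove about as much through their neighbours in \<open>P\<close>; this
  cancels, and an error linear in \<open>neg\<close> and \<open>K * q\<close> remains.\<close>

lemma sum_pos_sq_and_card_not_good:
  defines "Z \<equiv> {v \<in> V. x v = 0 \<and> c v = 0}"
  shows "int (card (Z - good)) + (\<Sum>v\<in>{v \<in> V. x v > 0}. (x v)\<^sup>2 - 1) \<le> 2 * neg + 2 * (K * q) - q"
proof -
  define P where "P = {v \<in> V. x v > 0}"
  define M where "M = {v \<in> V. x v < 0}"
  define O' where "O' = {v \<in> V. x v = 0 \<and> c v \<noteq> 0}"
  have fins: "finite P" "finite M" "finite O'" "finite Z"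
    using fin by (auto simp: P_def M_def O'_def Z_def)
  have part: "V = Z \<union> (O' \<union> (M \<union> P))"
    by (auto simp: P_def M_def O'_def Z_def)
  have split: "(\<Sum>v\<in>V. g v) = (\<Sum>v\<in>Z. g v) + ((\<Sum>v\<in>O'. g v) + ((\<Sum>v\<in>M. g v) + (\<Sum>v\<in>P. g v)))"
    for g :: "'a \<Rightarrow> int"
    unfolding part using fins
    by (subst sum.union_disjoint sum.union_disjoint[of M P], auto simp: P_def M_def O'_def Z_def)+
  have neg_M: "neg = (\<Sum>v\<in>M. - x v)"
  proof -
    have "(\<Sum>v\<in>Z. max 0 (- x v)) = 0" "(\<Sum>v\<in>O'. max 0 (- x v)) = 0" "(\<Sum>v\<in>P. max 0 (- x v)) = 0"
      by (auto intro!: sum.neutral simp: Z_def O'_def P_def)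
    moreover have "(\<Sum>v\<in>M. max 0 (- x v)) = (\<Sum>v\<in>M. - x v)"
      by (intro sum.cong) (auto simp: M_def)
    ultimately show ?thesis unfolding neg_def split by simp
  qed
  have sO: "(\<Sum>v\<in>O'. s v) \<ge> - (\<Sum>v\<in>O'. c v)"
    unfolding sum_negf[symmetric]
  proof (intro sum_mono)
    fix v assume "v \<in> O'"
    then show "- c v \<le> s v" using f_eq[of v] f_nonneg[of v] by (auto simp: O'_def)
  qed
  have sM: "(\<Sum>v\<in>M. s v) \<ge> q * neg - (\<Sum>v\<in>M. c v)"
    unfolding neg_M sum_distrib_left sum_subtractf[symmetric]
  proof (intro sum_mono)
    fix v assume "v \<in> M"
    then show "q * - x v - c v \<le> s v" using f_eq[of v] f_nonneg[of v] by (auto simp: M_def)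
  qed
  \<comment> \<open>Counted from the neighbours, only vertices of \<open>M\<close> contribute
    negatively, each at most over its whole degree. The squares arising here cancel against those in
    \<open>sum_s\<close>.\<close>
  have sP: "(\<Sum>v\<in>P. s v) \<ge> - ((q + 1) * neg + (\<Sum>v\<in>M. (x v)\<^sup>2))"
  proof -
    have PV: "P \<subseteq> V" by (auto simp: P_def)
    have "(\<Sum>v\<in>P. s v) = (\<Sum>u\<in>V. int (card (N u \<inter> P)) * x u)"
      unfolding s_def using sum_over_nbrs[OF PV] by simp
    also have "\<dots> \<ge> (\<Sum>u\<in>V. if u \<in> M then d u * x u else 0)"
    proof (intro sum_mono)
      fix u assume u: "u \<in> V"
      show "(if u \<in> M then d u * x u else 0) \<le> int (card (N u \<inter> P)) * x u"
      proof (cases "u \<in> M")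
        case True
        have "card (N u \<inter> P) \<le> card (N u)" using fin_N[OF u] by (intro card_mono) auto
        then have "int (card (N u \<inter> P)) \<le> d u" by (simp add: d_def)
        then show ?thesis using True by (auto simp: M_def intro!: mult_right_mono_neg)
      next
        case False
        then have "x u \<ge> 0" using u by (auto simp: M_def)
        then show ?thesis using False by simp
      qed
    qed
    also have "(\<Sum>u\<in>V. if u \<in> M then d u * x u else 0) = (\<Sum>u\<in>M. d u * x u)"
      using fin by (simp add: sum.If_cases Int_absorb1 M_def Int_def conj_commute)
    also have "\<dots> = (\<Sum>u\<in>M. - ((q + 1) * (- x u) + (x u)\<^sup>2))"
      by (intro sum.cong refl) (simp add: x_def power2_eq_square algebra_simps)
    also have "\<dots> = - ((q + 1) * neg + (\<Sum>v\<in>M. (x v)\<^sup>2))"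
      by (simp add: neg_M sum_negf sum_subtractf sum_distrib_left)
    finally show ?thesis .
  qed
  have s_Z: "s v = f v \<and> s v \<ge> 1" if "v \<in> Z" for v
  proof -
    have v: "v \<in> V" "x v = 0" "c v = 0" using that by (auto simp: Z_def)
    obtain u where "u \<in> N v" "cd v u = 0" using exists_missing_nbr[OF v] by blast
    then have "u \<in> miss v" using sub irrefl v(1) by (auto simp: miss_def)
    moreover have "finite (miss v)" using fin by (simp add: miss_def)
    ultimately have "card (miss v) > 0" using card_gt_0_iff by blast
    then show ?thesis using f_eq[OF v(1)] v by (simp add: f_def)
  qed
  have "int (card (Z - good)) \<le> (\<Sum>v\<in>Z - good. s v - 1)"
  proof -
    have "1 \<le> s v - 1" if "v \<in> Z - good" for v
    proof -
      have "f v \<noteq> 1" using that by (auto simp: good_def Z_def)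
      then show ?thesis using s_Z[of v] that by auto
    qed
    then have "(\<Sum>v\<in>Z - good. 1) \<le> (\<Sum>v\<in>Z - good. s v - 1)" by (intro sum_mono) auto
    then show ?thesis by simp
  qed
  also have "\<dots> \<le> (\<Sum>v\<in>Z. s v - 1)"
    using fins s_Z by (intro sum_mono2) force+
  also have "\<dots> = (\<Sum>v\<in>Z. s v) - int (card Z)" by (simp add: sum_subtractf)
  finally have 1: "int (card (Z - good)) \<le> (\<Sum>v\<in>Z. s v) - int (card Z)" .
  have sqs: "(\<Sum>v\<in>V. (x v)\<^sup>2) = (\<Sum>v\<in>M. (x v)\<^sup>2) + (\<Sum>v\<in>P. (x v)\<^sup>2)"
  proof -
    have "(\<Sum>v\<in>Z. (x v)\<^sup>2) = 0" "(\<Sum>v\<in>O'. (x v)\<^sup>2) = 0"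
      by (auto intro!: sum.neutral simp: Z_def O'_def)
    then show ?thesis unfolding split by simp
  qed
  have cards: "q\<^sup>2 + q + 1 = int (card Z) + (int (card O') + (int (card M) + int (card P)))"
    using split[of "\<lambda>_. 1"] card_V by simp
  have cards_le: "int (card O') \<le> (\<Sum>v\<in>O'. c v)" "int (card M) \<le> neg"
  proof -
    have "(\<Sum>v\<in>O'. 1) \<le> (\<Sum>v\<in>O'. c v)"
    proof (intro sum_mono)
      fix v assume "v \<in> O'"
      then have "c v \<noteq> 0" by (simp add: O'_def)
      then show "1 \<le> c v" using c_nonneg[of v] by linarith
    qed
    then show "int (card O') \<le> (\<Sum>v\<in>O'. c v)" by simp
    have "(\<Sum>v\<in>M. 1) \<le> (\<Sum>v\<in>M. - x v)" by (intro sum_mono) (auto simp: M_def)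
    then show "int (card M) \<le> neg" by (simp add: neg_M)
  qed
  have cs: "(\<Sum>v\<in>O'. c v) + (\<Sum>v\<in>M. c v) \<le> K * q" "(\<Sum>v\<in>O'. c v) \<le> K * q"
  proof -
    have "0 \<le> (\<Sum>v\<in>Z. c v)" "0 \<le> (\<Sum>v\<in>M. c v)" "0 \<le> (\<Sum>v\<in>P. c v)"
      by (intro sum_nonneg c_nonneg)+
    then show "(\<Sum>v\<in>O'. c v) + (\<Sum>v\<in>M. c v) \<le> K * q" "(\<Sum>v\<in>O'. c v) \<le> K * q"
      using sum_c split[of c] by linarith+
  qed
  have "(\<Sum>v\<in>P. (x v)\<^sup>2 - 1) = (\<Sum>v\<in>P. (x v)\<^sup>2) - int (card P)"
    by (simp add: sum_subtractf)
  moreover have "(q + 1) * neg = q * neg + neg" by (simp add: algebra_simps)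
  ultimately show ?thesis
    unfolding P_def[symmetric]
    using 1 sum_s split[of s] sO sM sP sqs cards cards_le cs by linarith
qed

end

text \<open>Of these constants, depending only on \<open>K\<close>, the values \<open>neg_bd\<close>, \<open>sq_bd\<close>, \<open>bad_bd\<close>,
  \<open>wt_bd\<close>, \<open>abs_bad\<close>, \<open>unclean_bd\<close> and \<open>error_bd\<close> are coefficients of \<open>q\<close>; the others bound
  quantities that stay bounded as \<open>q\<close> grows.\<close>

definition rich_bd :: "int \<Rightarrow> int \<Rightarrow> int" where "rich_bd K b = 4 * b + 2 * K + 1"
definition wt_bd :: "int \<Rightarrow> int" where "wt_bd K = 1 + 4 * neg_bd K + 2 * K"
definition ex_bd :: "int \<Rightarrow> int" where "ex_bd K = 4 * K + rich_bd K (wt_bd K)"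
definition neg_const :: "int \<Rightarrow> int" where "neg_const K = deg_bd K * ex_bd K"
definition bad_rich :: "int \<Rightarrow> int" where "bad_rich K = rich_bd K (2 * bad_bd K)"
definition abs_hi :: "int \<Rightarrow> int" where "abs_hi K = neg_const K + ex_bd K"
definition abs_lo :: "int \<Rightarrow> int" where "abs_lo K = bad_bd K + bad_rich K + 1"
definition abs_bad :: "int \<Rightarrow> int" where "abs_bad K = abs_hi K + bad_bd K + bad_rich K + 1"
definition unclean_bd :: "int \<Rightarrow> int" where "unclean_bd K = bad_bd K + 2 * bad_rich K"
definition unclean_rich :: "int \<Rightarrow> int" where "unclean_rich K = rich_bd K (2 * unclean_bd K)"
definition error_bd :: "int \<Rightarrow> int" where "error_bd K = 2 * K + 4 * abs_bad K + 3 * abs_lo K"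
definition core_bd :: "int \<Rightarrow> int" where "core_bd K = 4 * error_bd K + unclean_rich K"


text \<open>With all size requirements on \<open>q\<close> in one finite set, \<open>q0\<close> can
  be taken as a maximum.\<close>

definition thresholds :: "int \<Rightarrow> int set" where
  "thresholds K = {deg_bd K + (deg_bd K)\<^sup>2, 2 * (rich_bd K (wt_bd K))\<^sup>2 + 1, 2 * (bad_rich K)\<^sup>2 + 1,
    16 * wt_bd K + 1, neg_const K + bad_rich K * (deg_bd K + 1) + abs_hi K,
    2 * (unclean_rich K)\<^sup>2 + 1, 8 * unclean_bd K + 8 * deg_bd K + 40,
    (core_bd K)\<^sup>2 + 2 * core_bd K + 1, (abs_hi K + core_bd K)\<^sup>2 + 1}"

lemma bds_pos:
  assumes "1 \<le> K"
  shows "1 \<le> deg_bd K" "1 \<le> neg_bd K" "1 \<le> sq_bd K" "1 \<le> bad_bd K" "1 \<le> wt_bd K"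
    "1 \<le> rich_bd K (wt_bd K)" "1 \<le> ex_bd K" "1 \<le> neg_const K" "1 \<le> bad_rich K" "1 \<le> abs_hi K"
    "1 \<le> abs_lo K" "1 \<le> abs_bad K" "1 \<le> unclean_bd K" "1 \<le> unclean_rich K" "1 \<le> error_bd K"
    "1 \<le> core_bd K"
proof -
  show 1: "1 \<le> deg_bd K" using assms by (simp add: deg_bd_def)
  have "0 \<le> deg_bd K * K" using 1 assms by simp
  then show 2: "1 \<le> neg_bd K" by (simp add: neg_bd_def)
  show 3: "1 \<le> sq_bd K" using 2 assms by (simp add: sq_bd_def)
  show 4: "1 \<le> bad_bd K" using 2 3 assms by (simp add: bad_bd_def)
  show 5: "1 \<le> wt_bd K" using 2 assms by (simp add: wt_bd_def)
  show 6: "1 \<le> rich_bd K (wt_bd K)" using 5 assms by (simp add: rich_bd_def)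
  show 7: "1 \<le> ex_bd K" using 6 assms by (simp add: ex_bd_def)
  show 8: "1 \<le> neg_const K" using mult_mono[OF 1 7] 1 by (simp add: neg_const_def)
  show 9: "1 \<le> bad_rich K" using 4 assms by (simp add: bad_rich_def rich_bd_def)
  show 10: "1 \<le> abs_hi K" using 7 8 by (simp add: abs_hi_def)
  show 11: "1 \<le> abs_lo K" using 4 9 by (simp add: abs_lo_def)
  show 12: "1 \<le> abs_bad K" using 4 9 10 by (simp add: abs_bad_def)
  show 13: "1 \<le> unclean_bd K" using 4 9 by (simp add: unclean_bd_def)
  show 14: "1 \<le> unclean_rich K" using 13 assms by (simp add: unclean_rich_def rich_bd_def)
  show 15: "1 \<le> error_bd K" using 11 12 assms by (simp add: error_bd_def)
  show "1 \<le> core_bd K" using 14 15 by (simp add: core_bd_def)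
qed

context near_extremal
begin

section \<open>Partners of good vertices\<close>

definition partner :: "'a \<Rightarrow> 'a" where "partner v = (THE u. u \<in> miss v)"

lemma good_V: "v \<in> good \<Longrightarrow> v \<in> V"
  by (simp add: good_def)

lemma d_good: "v \<in> good \<Longrightarrow> d v = q + 1"
  by (simp add: good_def x_def)

lemma miss_good:
  assumes "v \<in> good" shows "miss v = {partner v}"
proof -
  have "card (miss v) = 1" using assms by (simp add: good_def f_def)
  then obtain u where "miss v = {u}" by (rule card_1_singletonE)
  then show ?thesis by (simp add: partner_def)
qed

text \<open>Parity yields a neighbour of \<open>v\<close> without a common neighbour; a good vertex
  misses only one vertex, so this is its partner.\<close>

lemma partner_nbr:
  assumes "v \<in> good" shows "partner v \<in> N v"
proof -
  obtain u where u: "u \<in> N v" "cd v u = 0"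
    using exists_missing_nbr[of v] assms by (auto simp: good_def)
  then have "u \<in> miss v" using sub irrefl good_V[OF assms] by (auto simp: miss_def)
  then show ?thesis using u miss_good[OF assms] by simp
qed

lemma cd_le_1:
  assumes "v \<in> V" "c v = 0" "w \<in> V" "w \<noteq> v" shows "cd v w \<le> 1"
proof -
  have "max 0 (cd v w - 1) \<le> c v"
    unfolding c_def using assms fin by (intro member_le_sum) auto
  then show ?thesis using assms by linarith
qed

lemma cd_good:
  assumes v: "v \<in> good" and w: "w \<in> V" "w \<noteq> v"
  shows "cd v w = (if w = partner v then 0 else 1)"
proof (cases "w = partner v")
  case True
  then show ?thesis using miss_good[OF v] by (auto simp: miss_def)
next
  case False
  then have "cd v w \<noteq> 0" using miss_good[OF v] w by (auto simp: miss_def)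
  then show ?thesis using False cd_le_1[of v w] v w cd_nonneg[of v w] by (auto simp: good_def)
qed

text \<open>The walks of length 3 from \<open>v\<close> to \<open>u\<close>, counted from either end, show that the partner of
  \<open>u\<close> is adjacent to \<open>v\<close>; unless it is the partner of \<open>v\<close>, this closes a 4-cycle through \<open>v\<close>.\<close>

lemma partner_eq:
  assumes v: "v \<in> good" and u: "u \<in> good" and adj: "u \<in> N (partner v)"
  shows "partner u = partner v"
proof (cases "u = v")
  case False
  define w where "w = partner v"
  have V: "u \<in> V" "v \<in> V" "w \<in> V" and wv: "w \<in> N v"
    using good_V u v partner_nbr[OF v] sub by (auto simp: w_def)
  have uw: "w \<in> N u" "u \<in> N w" using adj sym V by (auto simp: w_def)
  have vw: "v \<noteq> w" using irrefl wv V by metis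
  have "N v \<inter> N w = {}"
    using cd_good[OF v V(3)] vw fin_N[OF V(2)] by (simp add: w_def cd_def)
  then have unv: "u \<notin> N v" using uw by blast
  then have vnu: "v \<notin> N u" using sym V by blast
  have "(\<Sum>t\<in>N u. cd v t) = (\<Sum>t\<in>N u. 1 - (if t = w then 1 else 0))"
  proof (intro sum.cong refl)
    fix t assume t: "t \<in> N u"
    then have "t \<in> V" "t \<noteq> v" using sub[OF V(1)] vnu by auto
    then show "cd v t = 1 - (if t = w then 1 else 0)"
      using cd_good[OF v, of t] by (simp add: w_def)
  qed
  also have "\<dots> = q"
    using uw(1) fin_N[OF V(1)] d_good[OF u] by (simp add: sum_subtractf d_def)
  finally have 1: "(\<Sum>t\<in>N u. cd v t) = q" .
  have "(\<Sum>t\<in>N v. cd t u) = (\<Sum>t\<in>N v. 1 - (if t = partner u then 1 else 0))"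
  proof (intro sum.cong refl)
    fix t assume t: "t \<in> N v"
    then have "t \<in> V" "t \<noteq> u" using sub[OF V(2)] unv by auto
    then show "cd t u = 1 - (if t = partner u then 1 else 0)"
      using cd_good[OF u, of t] by (simp add: cd_commute)
  qed
  also have "\<dots> = q + 1 - (if partner u \<in> N v then 1 else 0)"
    using fin_N[OF V(2)] d_good[OF v] by (simp add: sum_subtractf d_def)
  finally have pu: "partner u \<in> N v"
    using 1 walks3[OF V(1) V(2)] by (simp split: if_splits)
  show ?thesis
  proof (rule ccontr)
    assume ne: "partner u \<noteq> partner v"
    have "{partner u, w} \<subseteq> N v \<inter> N u"
      using pu wv uw partner_nbr[OF u] by auto
    then have "card {partner u, w} \<le> card (N v \<inter> N u)"
      using fin_N[OF V(2)] by (intro card_mono) auto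
    then have "2 \<le> cd v u" using ne by (simp add: w_def cd_def)
    then show False using cd_good[OF v V(1)] False by (simp split: if_splits)
  qed
qed simp

lemma nbrs_partner:
  assumes "v \<in> good"
  shows "N (partner v) \<inter> good = {u \<in> good. partner u = partner v}"
proof -
  have "u \<in> N (partner u)" if "u \<in> good" for u
    using partner_nbr[OF that] sym sub good_V[OF that] by blast
  then show ?thesis using partner_eq[OF assms] by force
qed

section \<open>Bounding the number of vertices with disturbed neighbourhoods\<close>

text \<open>A second-moment argument. In a set \<open>J\<close> of \<open>j\<close> heavy vertices
  each \<open>u\<close> is counted with multiplicity \<open>D u\<close>, but
  \<open>\<Sum>D * (D - 1)\<close> is at most \<open>j * (j - 1) + K * q\<close>, so the
  neighbourhoods overlap little. For \<open>j = rich_bd K b\<close> the terms linear in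
  \<open>q\<close> leave exactly one \<open>q\<close> over, which would have to be at most
  \<open>2 * j^2\<close>.\<close>

lemma card_rich:
  fixes g :: "'a \<Rightarrow> int"
  assumes g0: "\<And>v. v \<in> V \<Longrightarrow> 0 \<le> g v"
    and wt: "(\<Sum>v\<in>V. g v) + (\<Sum>v\<in>V. (g v)\<^sup>2) \<le> b * q"
    and big: "2 * (rich_bd K b)\<^sup>2 < q"
    and bpos: "0 \<le> b"
  shows "int (card {v \<in> V. q \<le> 4 * (\<Sum>u\<in>N v. g u)}) < rich_bd K b"
proof (rule ccontr)
  define j where "j = rich_bd K b"
  have j: "0 < j" using K_pos bpos by (simp add: j_def rich_bd_def)
  assume "\<not> ?thesis"
  then have "nat j \<le> card {v \<in> V. q \<le> 4 * (\<Sum>u\<in>N v. g u)}" by (simp add: j_def)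
  then obtain J where J: "J \<subseteq> {v \<in> V. q \<le> 4 * (\<Sum>u\<in>N v. g u)}" "card J = nat j"
    by (meson obtain_subset_with_card_n)
  then have JV: "J \<subseteq> V" and cJ: "int (card J) = j" using j by auto
  define D where "D u = int (card (N u \<inter> J))" for u
  \<comment> \<open>Arithmetic-geometric mean for \<open>g u\<close> and \<open>D u - 1\<close>;
    this is where the square sum of the weight enters.\<close>
  have g2: "2 * (D u * g u) \<le> 2 * g u + (g u)\<^sup>2 + D u * (D u - 1)" if "u \<in> V" for u
  proof (cases "D u = 0")
    case True
    then show ?thesis using g0[OF that] by simp
  next
    case False
    then have "D u \<ge> 1" by (simp add: D_def)
    moreover have "0 \<le> (g u - (D u - 1))\<^sup>2" by simp
    then have "2 * (D u * g u) \<le> 2 * g u + (g u)\<^sup>2 + (D u - 1)\<^sup>2"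
      by (simp add: power2_eq_square algebra_simps)
    moreover have "(D u - 1)\<^sup>2 = D u * (D u - 1) - (D u - 1)"
      by (simp add: power2_eq_square algebra_simps)
    ultimately show ?thesis by linarith
  qed
  have "j * q = (\<Sum>v\<in>J. q)" using cJ by simp
  also have "\<dots> \<le> (\<Sum>v\<in>J. 4 * (\<Sum>u\<in>N v. g u))"
    using J(1) by (intro sum_mono) auto
  also have "\<dots> = 4 * (\<Sum>u\<in>V. D u * g u)"
    by (simp only: sum_distrib_left[symmetric] sum_over_nbrs[OF JV] D_def)
  also have "\<dots> = 2 * (\<Sum>u\<in>V. 2 * (D u * g u))"
    by (simp add: sum_distrib_left)
  also have "(\<Sum>u\<in>V. 2 * (D u * g u)) \<le> (\<Sum>u\<in>V. 2 * g u + (g u)\<^sup>2 + D u * (D u - 1))"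
    using g2 by (intro sum_mono) auto
  also have "\<dots> = 2 * (\<Sum>u\<in>V. g u) + (\<Sum>u\<in>V. (g u)\<^sup>2) + (\<Sum>u\<in>V. D u * (D u - 1))"
    by (simp add: sum.distrib sum_distrib_left)
  also have "(\<Sum>u\<in>V. D u * (D u - 1)) \<le> j * (j - 1) + K * q"
    using sum_card_nbrs_le[OF JV] by (simp add: D_def cJ)
  finally have "j * q \<le> 2 * (2 * (\<Sum>u\<in>V. g u) + (\<Sum>u\<in>V. (g u)\<^sup>2) + (j * (j - 1) + K * q))"
    by simp
  also have "\<dots> \<le> 2 * (2 * (b * q) + (j * (j - 1) + K * q))"
    using wt sum_nonneg[of V "\<lambda>u. (g u)\<^sup>2"] by simp
  also have "j * (j - 1) \<le> j\<^sup>2" using j by (simp add: power2_eq_square)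
  finally have "(4 * b + 2 * K + 1) * q \<le> 4 * (b * q) + 2 * j\<^sup>2 + 2 * (K * q)"
    by (simp add: j_def rich_bd_def)
  then have "q \<le> 2 * j\<^sup>2" by (simp add: algebra_simps)
  then show False using big by (simp add: j_def)
qed

lemma sum_x_pos: "(\<Sum>v\<in>V. max 0 (x v)) = q - 1 + neg"
proof -
  have "(\<Sum>v\<in>V. x v) = (\<Sum>v\<in>V. max 0 (x v) - max 0 (- x v))"
    by (intro sum.cong refl) auto
  then show ?thesis using sum_x by (simp add: neg_def sum_subtractf)
qed

lemma card_pos_le: "int (card {v \<in> V. 0 < x v}) \<le> q - 1 + neg"
proof -
  have "int (card {v \<in> V. 0 < x v}) = (\<Sum>v\<in>{v \<in> V. 0 < x v}. 1)" by simp
  also have "\<dots> \<le> (\<Sum>v\<in>{v \<in> V. 0 < x v}. max 0 (x v))" by (intro sum_mono) auto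
  also have "\<dots> \<le> (\<Sum>v\<in>V. max 0 (x v))" using fin by (intro sum_mono2) auto
  finally show ?thesis by (simp add: sum_x_pos)
qed

lemma card_neg_le: "int (card {v \<in> V. x v < 0}) \<le> neg"
proof -
  have "int (card {v \<in> V. x v < 0}) = (\<Sum>v\<in>{v \<in> V. x v < 0}. 1)" by simp
  also have "\<dots> \<le> (\<Sum>v\<in>{v \<in> V. x v < 0}. max 0 (- x v))" by (intro sum_mono) auto
  also have "\<dots> \<le> neg" unfolding neg_def using fin by (intro sum_mono2) auto
  finally show ?thesis .
qed

lemma sum_pos_sq_nonneg: "0 \<le> (\<Sum>v\<in>{v \<in> V. x v > 0}. (x v)\<^sup>2 - 1)"
proof (intro sum_nonneg)
  fix v assume "v \<in> {v \<in> V. x v > 0}"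
  then have "1 * 1 \<le> x v * x v" by (intro mult_mono) auto
  then show "0 \<le> (x v)\<^sup>2 - 1" by (simp add: power2_eq_square)
qed

lemma card_many_c:
  assumes "X \<subseteq> V" "\<And>v. v \<in> X \<Longrightarrow> q \<le> 4 * c v"
  shows "int (card X) \<le> 4 * K"
proof -
  have "int (card X) * q = (\<Sum>v\<in>X. q)" by simp
  also have "\<dots> \<le> (\<Sum>v\<in>X. 4 * c v)" using assms(2) by (intro sum_mono) auto
  also have "\<dots> \<le> (\<Sum>v\<in>V. 4 * c v)" using assms(1) fin c_nonneg by (intro sum_mono2) auto
  also have "\<dots> \<le> 4 * K * q" using sum_c by (simp add: sum_distrib_left[symmetric])
  finally show ?thesis using q_ge by simp
qed

end

locale large_near_extremal = near_extremal +
  assumes q_large: "m \<in> thresholds K \<Longrightarrow> m \<le> q"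
begin

lemmas bds = bds_pos[OF K_pos]

lemma q_bds:
  shows "deg_bd K + (deg_bd K)\<^sup>2 \<le> q"
    and "2 * (rich_bd K (wt_bd K))\<^sup>2 + 1 \<le> q"
    and "2 * (bad_rich K)\<^sup>2 + 1 \<le> q"
    and "16 * wt_bd K + 1 \<le> q"
    and "neg_const K + bad_rich K * (deg_bd K + 1) + abs_hi K \<le> q"
    and "2 * (unclean_rich K)\<^sup>2 + 1 \<le> q"
    and "8 * unclean_bd K + 8 * deg_bd K + 40 \<le> q"
    and "(core_bd K)\<^sup>2 + 2 * core_bd K + 1 \<le> q"
    and "(abs_hi K + core_bd K)\<^sup>2 + 1 \<le> q"
  by (rule q_large, unfold thresholds_def, blast)+

lemma neg_bound: "neg \<le> neg_bd K * q"
  using neg_le q_bds(1) by blast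

lemma card_bad: "int (card (V - good)) \<le> bad_bd K * q"
proof -
  define Z where "Z = {v \<in> V. x v = 0 \<and> c v = 0}"
  define C where "C = {v \<in> V. c v \<noteq> 0}"
  have "int (card C) = (\<Sum>v\<in>C. 1)" by simp
  also have "\<dots> \<le> (\<Sum>v\<in>C. c v)"
  proof (intro sum_mono)
    fix v assume "v \<in> C"
    then show "1 \<le> c v" using c_nonneg[of v] by (auto simp: C_def)
  qed
  also have "\<dots> \<le> (\<Sum>v\<in>V. c v)" using fin c_nonneg by (intro sum_mono2) (auto simp: C_def)
  finally have C: "int (card C) \<le> K * q" using sum_c by linarith
  have "V - good \<subseteq> ({v \<in> V. 0 < x v} \<union> {v \<in> V. x v < 0}) \<union> (C \<union> (Z - good))"
    by (auto simp: C_def Z_def)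
  then have "card (V - good) \<le> card (({v \<in> V. 0 < x v} \<union> {v \<in> V. x v < 0}) \<union> (C \<union> (Z - good)))"
    using fin by (intro card_mono) (auto simp: C_def Z_def)
  also have "\<dots> \<le> (card {v \<in> V. 0 < x v} + card {v \<in> V. x v < 0}) + (card C + card (Z - good))"
    by (intro order.trans[OF card_Un_le] add_mono card_Un_le order.refl)
  finally have "int (card (V - good)) \<le> (q - 1 + neg) + neg + (K * q + (2 * neg + 2 * (K * q) - q))"
    using card_pos_le card_neg_le C sum_pos_sq_and_card_not_good sum_pos_sq_nonneg
    unfolding Z_def by linarith
  also have "\<dots> \<le> bad_bd K * q"
    using neg_bound q_ge by (simp add: bad_bd_def sq_bd_def algebra_simps)
  finally show ?thesis .
qed

lemma weight_x: "(\<Sum>v\<in>V. max 0 (x v)) + (\<Sum>v\<in>V. (max 0 (x v))\<^sup>2) \<le> wt_bd K * q"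
proof -
  have "(\<Sum>v\<in>{v \<in> V. 0 < x v}. (x v)\<^sup>2) = (\<Sum>v\<in>V. if 0 < x v then (x v)\<^sup>2 else 0)"
    using fin by (rule sum.inter_filter)
  also have "\<dots> = (\<Sum>v\<in>V. (max 0 (x v))\<^sup>2)"
    by (intro sum.cong refl) (simp add: max_def)
  finally have "(\<Sum>v\<in>V. (max 0 (x v))\<^sup>2) = (\<Sum>v\<in>{v \<in> V. 0 < x v}. (x v)\<^sup>2)" ..
  also have "\<dots> = (\<Sum>v\<in>{v \<in> V. 0 < x v}. (x v)\<^sup>2 - 1) + int (card {v \<in> V. 0 < x v})"
    by (simp add: sum_subtractf)
  also have "\<dots> \<le> (2 * neg + 2 * (K * q) - q) + (q - 1 + neg)"
    using card_pos_le sum_pos_sq_and_card_not_good by linarith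
  finally have "(\<Sum>v\<in>V. (max 0 (x v))\<^sup>2) \<le> 3 * neg + 2 * (K * q)" by linarith
  then show ?thesis
    using sum_x_pos neg_bound q_ge unfolding wt_bd_def by (simp add: algebra_simps)
qed

text \<open>If both quantities are below \<open>q / 4\<close>, then
  \<open>s v + c v < q / 2\<close>. This is too little to balance a single unit of
  \<open>q * x v\<close> in \<open>f_eq\<close>, and less than the number of good neighbours of a
  vertex in \<open>Abs\<close>.\<close>

definition exceptional :: "'a set" where
  "exceptional = {v \<in> V. q \<le> 4 * c v \<or> q \<le> 4 * (\<Sum>u\<in>N v. max 0 (x u))}"

lemma card_exceptional: "int (card exceptional) \<le> ex_bd K"
proof -
  have "exceptional = {v \<in> V. q \<le> 4 * c v} \<union> {v \<in> V. q \<le> 4 * (\<Sum>u\<in>N v. max 0 (x u))}"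
    by (auto simp: exceptional_def)
  then have "card exceptional \<le> card {v \<in> V. q \<le> 4 * c v} + card {v \<in> V. q \<le> 4 * (\<Sum>u\<in>N v. max 0 (x u))}"
    by (simp only: card_Un_le)
  moreover have "int (card {v \<in> V. q \<le> 4 * c v}) \<le> 4 * K" by (intro card_many_c) auto
  moreover have "int (card {v \<in> V. q \<le> 4 * (\<Sum>u\<in>N v. max 0 (x u))}) < rich_bd K (wt_bd K)"
    using weight_x q_bds(2) bds(5) by (intro card_rich) auto
  ultimately show ?thesis by (simp add: ex_bd_def)
qed

lemma s_le: "s v \<le> (\<Sum>u\<in>N v. max 0 (x u))"
  unfolding s_def by (intro sum_mono) auto

lemma x_nonneg: "v \<in> V - exceptional \<Longrightarrow> 0 \<le> x v"
proof (rule ccontr)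
  assume v: "v \<in> V - exceptional" and neg: "\<not> 0 \<le> x v"
  have "q * 1 \<le> q * (- x v)" using neg q_ge by (intro mult_left_mono) auto
  then have "q \<le> s v + c v" using f_eq[of v] f_nonneg[of v] v by auto
  then show False using v s_le[of v] q_ge by (auto simp: exceptional_def)
qed

text \<open>Bootstrapping: the bound of order \<open>q\<close> on \<open>neg\<close> made the
  exceptional vertices few, and these carry all of the surplus.\<close>

lemma neg_le_const: "neg \<le> neg_const K"
proof -
  have "neg = (\<Sum>v\<in>exceptional. max 0 (- x v))"
    unfolding neg_def using fin x_nonneg
    by (intro sum.mono_neutral_right) (auto simp: exceptional_def)
  also have "\<dots> \<le> (\<Sum>v\<in>exceptional. deg_bd K)"
  proof (intro sum_mono)
    fix v assume "v \<in> exceptional"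
    then show "max 0 (- x v) \<le> deg_bd K"
      using x_ge[of v] deg_bd_pos by (auto simp: exceptional_def)
  qed
  also have "\<dots> = int (card exceptional) * deg_bd K" by simp
  also have "\<dots> \<le> ex_bd K * deg_bd K"
    using card_exceptional deg_bd_pos by (intro mult_right_mono) auto
  finally show ?thesis by (simp add: neg_const_def mult.commute)
qed

text \<open>The square sum of the positive deficiencies is \<open>O(q)\<close>, so each of them is
  at most of the order of the square root of \<open>q\<close>.\<close>

lemma x_le:
  assumes v: "v \<in> V" shows "4 * x v \<le> q"
proof (rule ccontr)
  assume *: "\<not> ?thesis"
  have "(max 0 (x v))\<^sup>2 \<le> (\<Sum>v\<in>V. (max 0 (x v))\<^sup>2)"
    using v fin by (intro member_le_sum) auto
  also have "\<dots> \<le> wt_bd K * q"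
    using weight_x sum_nonneg[of V "\<lambda>v. max 0 (x v)"] by simp
  finally have "16 * (x v)\<^sup>2 \<le> 16 * wt_bd K * q" using * q_ge by simp
  also have "\<dots> \<le> q * q" using q_bds(4) q_ge by (intro mult_right_mono) auto
  finally have "(4 * x v)\<^sup>2 \<le> q\<^sup>2" by (simp add: power2_eq_square)
  then show False using * q_ge power2_le_imp_le[of "4 * x v" q] by simp
qed

end

section \<open>Absolute points\<close>

context large_near_extremal
begin

text \<open>An indicator equals its square, whence the factor 2 in
  \<open>rich_bd K (2 * b)\<close>.\<close>

lemma card_rich_set:
  assumes B: "B \<subseteq> V" and le: "int (card B) \<le> b * q"
    and big: "2 * (rich_bd K (2 * b))\<^sup>2 + 1 \<le> q" and "0 \<le> b"
  shows "int (card {w \<in> V. q \<le> 4 * int (card (N w \<inter> B))}) < rich_bd K (2 * b)"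
proof -
  define g :: "'a \<Rightarrow> int" where "g u = of_bool (u \<in> B)" for u
  have g: "(\<Sum>u\<in>X. g u) = int (card (X \<inter> B))" if "finite X" for X
    using that by (simp add: g_def of_bool_def sum.If_cases Int_def)
  have g2: "(g u)\<^sup>2 = g u" for u by (simp add: g_def)
  have "V \<inter> B = B" using B by blast
  then have "(\<Sum>v\<in>V. g v) + (\<Sum>v\<in>V. (g v)\<^sup>2) \<le> 2 * b * q"
    using le fin by (simp add: g2 g)
  then have "int (card {v \<in> V. q \<le> 4 * (\<Sum>u\<in>N v. g u)}) < rich_bd K (2 * b)"
    using big assms(4) by (intro card_rich) (auto simp: g_def)
  moreover have "{v \<in> V. q \<le> 4 * (\<Sum>u\<in>N v. g u)} = {w \<in> V. q \<le> 4 * int (card (N w \<inter> B))}"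
    using g[OF fin_N] by auto
  ultimately show ?thesis by simp
qed

definition rich :: "'a set" where
  "rich = {w \<in> V. q \<le> 4 * int (card (N w \<inter> (V - good)))}"

text \<open>Removing \<open>rich\<close> costs boundedly many partners and leaves each of the others
  more than \<open>q / 2\<close> good neighbours. This forces a positive deficiency on all but
  boundedly many of them, which bounds their number.\<close>

definition Abs :: "'a set" where "Abs = partner ` good - rich"

definition clean :: "'a set" where "clean = {v \<in> good. partner v \<in> Abs}"

lemma card_rich_le: "int (card rich) < bad_rich K"
  unfolding rich_def bad_rich_def
  using card_bad q_bds(3) bds(4) by (intro card_rich_set) (auto simp: bad_rich_def)

lemma finite_rich: "finite rich"
  using fin by (simp add: rich_def)

lemma partner_V: "v \<in> good \<Longrightarrow> partner v \<in> V"
  using partner_nbr sub good_V by blast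

lemma Abs_V: "Abs \<subseteq> V"
  using partner_V by (auto simp: Abs_def)

lemma finite_Abs: "finite Abs"
  using Abs_V fin finite_subset by blast

lemma nbrs_Abs: "w \<in> Abs \<Longrightarrow> N w \<inter> good = {u \<in> good. partner u = w}"
  using nbrs_partner by (auto simp: Abs_def)

lemma d_split:
  assumes "w \<in> V"
  shows "d w = int (card (N w \<inter> good)) + int (card (N w \<inter> (V - good)))"
proof -
  have "N w = (N w \<inter> good) \<union> (N w \<inter> (V - good))" using sub assms by blast
  then have "card (N w) = card (N w \<inter> good) + card (N w \<inter> (V - good))"
    using fin_N[OF assms] card_Un_disjoint[of "N w \<inter> good" "N w \<inter> (V - good)"]
    by (metis (no_types, lifting) Diff_disjoint Int_assoc Int_commute Int_empty_left finite_Int inf.left_commute)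
  then show ?thesis by (simp add: d_def)
qed

lemma many_good_nbrs:
  assumes w: "w \<in> Abs"
  shows "2 * q < 4 * int (card (N w \<inter> good))"
proof -
  have V: "w \<in> V" using w Abs_V by blast
  have "4 * int (card (N w \<inter> (V - good))) < q" using w V by (simp add: Abs_def rich_def)
  moreover have "d w = q + 1 - x w" by (simp add: x_def)
  ultimately show ?thesis using d_split[OF V] x_le[OF V] by linarith
qed

lemma f_Abs:
  assumes w: "w \<in> Abs"
  shows "int (card (N w \<inter> good)) \<le> f w"
proof -
  have "N w \<inter> good \<subseteq> miss w"
  proof
    fix u assume u: "u \<in> N w \<inter> good"
    then have "u \<in> good" "w = partner u" using nbrs_Abs[OF w] by auto
    then have "w \<in> miss u" using miss_good by blast
    then show "u \<in> miss w" using good_V u by (auto simp: miss_def cd_commute)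
  qed
  then show ?thesis using fin by (simp add: f_def card_mono miss_def)
qed

lemma Abs_not_good: "w \<in> Abs \<Longrightarrow> w \<notin> good"
  using f_Abs[of w] many_good_nbrs[of w] q_ge by (auto simp: good_def)

text \<open>All good neighbours of \<open>w\<close> are missed by \<open>w\<close>, so
  \<open>f w > q / 2\<close>. Outside \<open>exceptional\<close> this is impossible with
  \<open>x w <= 0\<close>, and the positive deficiencies sum to \<open>q - 1 + neg\<close>.\<close>

lemma card_Abs_le: "int (card Abs) \<le> q + abs_hi K"
proof -
  have "Abs \<subseteq> {v \<in> V. 0 < x v} \<union> exceptional"
  proof
    fix w assume w: "w \<in> Abs"
    show "w \<in> {v \<in> V. 0 < x v} \<union> exceptional"
    proof (rule ccontr)
      assume *: "\<not> ?thesis"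
      have V: "w \<in> V" using w Abs_V by blast
      have "q * x w \<le> 0" using * V q_ge by (simp add: mult_nonneg_nonpos)
      then have "4 * f w \<le> 4 * s w + 4 * c w" using f_eq[OF V] by simp
      also have "\<dots> < 2 * q" using * V s_le[of w] by (auto simp: exceptional_def)
      finally show False using f_Abs[OF w] many_good_nbrs[OF w] by linarith
    qed
  qed
  then have "card Abs \<le> card ({v \<in> V. 0 < x v} \<union> exceptional)"
    using fin by (intro card_mono) (auto simp: exceptional_def)
  also have "\<dots> \<le> card {v \<in> V. 0 < x v} + card exceptional" by (rule card_Un_le)
  finally show ?thesis
    using card_pos_le card_exceptional neg_le_const by (simp add: abs_hi_def)
qed

lemma card_clean: "int (card clean) = (\<Sum>w\<in>Abs. int (card (N w \<inter> good)))"
proof -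
  have fc: "finite clean" using fin good_V by (auto simp: clean_def intro: finite_subset[of _ V])
  have "card clean = (\<Sum>w\<in>Abs. card {u \<in> clean. partner u = w})"
  proof -
    have "partner ` clean \<subseteq> Abs" by (auto simp: clean_def)
    from sum.group[OF fc finite_Abs this, of "\<lambda>_. 1::nat"] show ?thesis by simp
  qed
  also have "\<dots> = (\<Sum>w\<in>Abs. card (N w \<inter> good))"
  proof (intro sum.cong refl)
    fix w assume w: "w \<in> Abs"
    have "{u \<in> clean. partner u = w} = N w \<inter> good"
      using nbrs_Abs[OF w] w by (auto simp: clean_def)
    then show "card {u \<in> clean. partner u = w} = card (N w \<inter> good)" by simp
  qed
  finally show ?thesis by simp
qed

lemma card_good_not_clean: "int (card (good - clean)) \<le> bad_rich K * (q + 1 + deg_bd K)"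
proof -
  have rV: "rich \<subseteq> V" by (auto simp: rich_def)
  have "good - clean \<subseteq> (\<Union>w\<in>rich. N w)"
  proof
    fix v assume v: "v \<in> good - clean"
    then have "partner v \<in> rich" by (auto simp: clean_def Abs_def)
    moreover have "v \<in> N (partner v)"
      using partner_nbr[of v] sym v good_V partner_V by blast
    ultimately show "v \<in> (\<Union>w\<in>rich. N w)" by blast
  qed
  then have "card (good - clean) \<le> card (\<Union>w\<in>rich. N w)"
    using finite_rich fin_N rV by (intro card_mono) auto
  also have "\<dots> \<le> (\<Sum>w\<in>rich. card (N w))" by (rule card_UN_le[OF finite_rich])
  finally have "int (card (good - clean)) \<le> (\<Sum>w\<in>rich. d w)" by (simp add: d_def flip: of_nat_sum)
  also have "\<dots> \<le> (\<Sum>w\<in>rich. q + 1 + deg_bd K)"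
  proof (intro sum_mono)
    fix w assume "w \<in> rich"
    then show "d w \<le> q + 1 + deg_bd K" using x_ge[of w] rV by (auto simp: x_def)
  qed
  also have "\<dots> = int (card rich) * (q + 1 + deg_bd K)" by simp
  also have "\<dots> \<le> bad_rich K * (q + 1 + deg_bd K)"
    using card_rich_le bds(1) q_ge by (intro mult_right_mono) auto
  finally show ?thesis .
qed

lemma card_unclean: "int (card (V - clean)) \<le> bad_bd K * q + bad_rich K * (q + 1 + deg_bd K)"
proof -
  have "V - clean \<subseteq> (V - good) \<union> (good - clean)" by auto
  moreover have "finite good" using fin by (simp add: good_def)
  ultimately have "card (V - clean) \<le> card ((V - good) \<union> (good - clean))"
    using fin by (intro card_mono) auto
  also have "\<dots> \<le> card (V - good) + card (good - clean)" by (rule card_Un_le)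
  finally show ?thesis using card_bad card_good_not_clean by linarith
qed

lemma clean_V: "clean \<subseteq> V"
  using good_V by (auto simp: clean_def)

lemma card_clean_ge:
  "q\<^sup>2 + q + 1 - (bad_bd K * q + bad_rich K * (q + 1 + deg_bd K)) \<le> int (card clean)"
proof -
  have "card V = card clean + card (V - clean)"
    using clean_V fin by (metis card_Diff_subset card_mono finite_subset le_add_diff_inverse)
  then show ?thesis using card_unclean card_V by linarith
qed

lemma sum_d_Abs_le: "(\<Sum>w\<in>Abs. d w) \<le> int (card Abs) * (q + 1) + neg_const K"
proof -
  have "(\<Sum>w\<in>Abs. d w) \<le> (\<Sum>w\<in>Abs. (q + 1) + max 0 (- x w))"
    by (intro sum_mono) (simp add: x_def)
  also have "\<dots> = int (card Abs) * (q + 1) + (\<Sum>w\<in>Abs. max 0 (- x w))"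
    by (simp add: sum.distrib)
  also have "(\<Sum>w\<in>Abs. max 0 (- x w)) \<le> neg"
    unfolding neg_def using fin Abs_V by (intro sum_mono2) auto
  finally show ?thesis using neg_le_const by linarith
qed

lemma sum_bad_nbrs_Abs: "(\<Sum>w\<in>Abs. int (card (N w \<inter> (V - good)))) = (\<Sum>w\<in>Abs. d w) - int (card clean)"
proof -
  have "(\<Sum>w\<in>Abs. d w) = (\<Sum>w\<in>Abs. int (card (N w \<inter> good)) + int (card (N w \<inter> (V - good))))"
    using d_split Abs_V by (intro sum.cong refl) auto
  then show ?thesis by (simp add: card_clean sum.distrib)
qed

text \<open>The clean vertices, at least \<open>q^2 - O(q)\<close> many, are distributed over the
  neighbourhoods of \<open>Abs\<close>, each of which holds at most \<open>q + O(1)\<close> of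
  them.\<close>

lemma card_Abs_ge: "q - abs_lo K \<le> int (card Abs)"
proof (rule ccontr)
  assume "\<not> ?thesis"
  then have "int (card Abs) \<le> q - (bad_bd K + bad_rich K + 2)" by (simp add: abs_lo_def)
  then have "int (card Abs) * (q + 1) \<le> (q - (bad_bd K + bad_rich K + 2)) * (q + 1)"
    using q_ge by (intro mult_right_mono) auto
  moreover have "0 \<le> (\<Sum>w\<in>Abs. int (card (N w \<inter> (V - good))))" by (intro sum_nonneg) auto
  ultimately have "q\<^sup>2 + q + 1 - (bad_bd K * q + bad_rich K * (q + 1 + deg_bd K))
      \<le> (q - (bad_bd K + bad_rich K + 2)) * (q + 1) + neg_const K"
    using sum_bad_nbrs_Abs sum_d_Abs_le card_clean_ge by linarith
  then have "2 * q + bad_bd K + bad_rich K + 3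
      \<le> neg_const K + bad_rich K * (deg_bd K + 1)"
    by (simp add: algebra_simps power2_eq_square)
  then show False using q_bds(5) bds(4,9,10) q_ge by linarith
qed

text \<open>\<open>Abs\<close> has at most \<open>q^2 + O(q)\<close> incident edge ends, and at
  least \<open>q^2 - O(q)\<close> of them lead to clean vertices.\<close>

lemma sum_bad_nbrs_Abs_le: "(\<Sum>w\<in>Abs. int (card (N w \<inter> (V - good)))) \<le> abs_bad K * q"
proof -
  have "int (card Abs) * (q + 1) \<le> (q + abs_hi K) * (q + 1)"
    using card_Abs_le q_ge by (intro mult_right_mono) auto
  then have "(\<Sum>w\<in>Abs. int (card (N w \<inter> (V - good)))) \<le> (q + abs_hi K) * (q + 1) + neg_const K
      - (q\<^sup>2 + q + 1 - (bad_bd K * q + bad_rich K * (q + 1 + deg_bd K)))"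
    using sum_bad_nbrs_Abs sum_d_Abs_le card_clean_ge by linarith
  also have "\<dots> = (abs_hi K + bad_bd K + bad_rich K) * q
      + (neg_const K + bad_rich K * (deg_bd K + 1) + abs_hi K) - 1"
    by (simp add: algebra_simps power2_eq_square)
  also have "\<dots> \<le> (abs_hi K + bad_bd K + bad_rich K) * q + q" using q_bds(5) by linarith
  also have "\<dots> = abs_bad K * q" by (simp add: abs_bad_def algebra_simps)
  finally show ?thesis .
qed

lemma card_unclean_le: "int (card (V - clean)) \<le> unclean_bd K * q"
proof -
  have "1 + deg_bd K \<le> q" using q_bds(7) bds(1,13) by linarith
  then have "bad_rich K * (q + 1 + deg_bd K) \<le> bad_rich K * (q + q)"
    using bds by (intro mult_left_mono) auto
  then show ?thesis using card_unclean by (simp add: unclean_bd_def algebra_simps)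
qed

end

section \<open>The perturbed incidence matrix\<close>

context large_near_extremal
begin

definition M :: "'a \<Rightarrow> 'a set" where "M v = (if v \<in> Abs then insert v (N v) else N v)"

sublocale M: finite_symrel V M
proof
  show "finite V" by (rule fin)
  show "M v \<subseteq> V" if "v \<in> V" for v using sub[OF that] that by (auto simp: M_def)
  show "u \<in> M v \<longleftrightarrow> v \<in> M u" if "u \<in> V" "v \<in> V" for u v
    using sym[OF that] by (auto simp: M_def)
qed

definition E :: "'a \<Rightarrow> 'a \<Rightarrow> int" where
  "E v w = M.cd v w - 1 - (if v = w then q else 0)"

lemma E_commute: "E v w = E w v"
  by (simp add: E_def M.cd_commute)

lemma dM: "v \<in> V \<Longrightarrow> M.d v = d v + of_bool (v \<in> Abs)"
  using irrefl fin_N by (simp add: M.d_def d_def M_def)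

lemma E_self: "v \<in> V \<Longrightarrow> E v v = M.d v - (q + 1)"
  by (simp add: E_def M.cd_self)

text \<open>A loop at \<open>v\<close> makes \<open>v\<close> a new common neighbour of
  \<open>v\<close> and \<open>w\<close> exactly if they are adjacent; likewise for
  \<open>w\<close>.\<close>

lemma cdM:
  assumes "v \<in> V" "w \<in> V" "v \<noteq> w"
  shows "M.cd v w = cd v w + of_bool (w \<in> N v) * (of_bool (v \<in> Abs) + of_bool (w \<in> Abs))"
proof -
  have f: "finite (N v \<inter> N w)" "finite (N w \<inter> N v)" using fin_N[OF assms(1)] by auto
  have n: "v \<notin> N v" "w \<notin> N w" "v \<in> N w \<longleftrightarrow> w \<in> N v" using irrefl sym assms by auto
  show ?thesis
    using f n assms(3) by (auto simp: M.cd_def cd_def M_def Int_insert_left Int_insert_right)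
qed

text \<open>The commutator of \<open>M\<close> with \<open>E = M\<^sup>2 - qI - J\<close> only sees the row sums of \<open>M\<close>.\<close>

lemma E_commutator:
  assumes "z \<in> V" "w \<in> V"
  shows "(\<Sum>t\<in>M w. E t z) - (\<Sum>t\<in>M z. E w t) = M.d z - M.d w"
proof -
  have 1: "(\<Sum>t\<in>M w. E t z) = (\<Sum>t\<in>M w. M.cd t z) - M.d w - (if z \<in> M w then q else 0)"
    using M.fin_N[OF assms(2)] by (simp add: E_def sum_subtractf M.d_def)
  have 2: "(\<Sum>t\<in>M z. E w t) = (\<Sum>t\<in>M z. M.cd w t) - M.d z - (if w \<in> M z then q else 0)"
    using M.fin_N[OF assms(1)] by (simp add: E_def sum_subtractf M.d_def)
  show ?thesis
    unfolding 1 2 using M.walks3[OF assms] M.sym[OF assms] by simp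
qed

text \<open>The only zero codegree in the row of \<open>v\<close> is at its partner, and there the
  loop supplies the missing common neighbour. No other neighbour of \<open>v\<close> is in
  \<open>Abs\<close>, so no other entry changes.\<close>

lemma E_clean:
  assumes v: "v \<in> clean" and w: "w \<in> V"
  shows "E v w = 0"
proof (cases "w = v")
  case True
  have "v \<in> V" "v \<notin> Abs" "d v = q + 1"
    using v clean_V Abs_not_good d_good by (auto simp: clean_def)
  then show ?thesis using True by (simp add: E_self dM)
next
  case False
  have vg: "v \<in> good" "v \<in> V" "v \<notin> Abs" "partner v \<in> Abs"
    using v clean_V Abs_not_good by (auto simp: clean_def)
  have "w \<in> N v \<and> w \<in> Abs \<longleftrightarrow> w = partner v"
  proof
    assume *: "w \<in> N v \<and> w \<in> Abs"
    then have "v \<in> N w \<inter> good" using sym w vg by auto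
    then show "w = partner v" using nbrs_Abs * by auto
  qed (use partner_nbr vg in auto)
  then show ?thesis
    using cdM[of v w] cd_good[OF vg(1) w False] False vg w by (auto simp: E_def)
qed

definition Err :: "'a \<Rightarrow> 'a set" where "Err z = {t \<in> V - {z}. E z t \<noteq> 0}"

lemma finite_Err: "finite (Err z)"
  using fin by (simp add: Err_def)

text \<open>A loop creates an excess only along an edge at a vertex of \<open>Abs\<close>. If the
  other end is good, it is clean and its row of \<open>E\<close> vanishes, so only edges to vertices
  outside \<open>good\<close> are charged.\<close>

lemma max_E_le:
  assumes "v \<in> V" "w \<in> V - {v}"
  shows "max 0 (E v w) \<le> max 0 (cd v w - 1)
    + of_bool (v \<in> Abs \<and> w \<in> N v \<inter> (V - good)) + of_bool (w \<in> Abs \<and> v \<in> N w \<inter> (V - good))"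
proof (cases "w \<in> N v \<and> (v \<in> Abs \<and> w \<in> good \<or> w \<in> Abs \<and> v \<in> good)")
  case True
  have "E v w = 0"
  proof (cases "v \<in> Abs \<and> w \<in> good")
    case True
    then have "partner w = v" using nbrs_Abs[of v] \<open>w \<in> N v \<and> _\<close> by blast
    then have "w \<in> clean" using True by (auto simp: clean_def)
    then show ?thesis using E_clean[of w v] assms(1) E_commute[of v w] by simp
  next
    case False
    then have wv: "w \<in> Abs" "v \<in> good" "v \<in> N w" using True sym assms by auto
    then have "partner v = w" using nbrs_Abs[of w] by blast
    then have "v \<in> clean" using wv by (auto simp: clean_def)
    then show ?thesis using E_clean assms(2) by simp
  qed
  then show ?thesis by simp
next
  case False
  have s: "v \<in> N w \<longleftrightarrow> w \<in> N v" using sym assms by auto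
  then show ?thesis
    using False assms Abs_not_good by (auto simp: E_def cdM)
qed

lemma sum_offdiag_swap:
  fixes g :: "'a \<Rightarrow> 'a \<Rightarrow> int"
  shows "(\<Sum>v\<in>V. \<Sum>w\<in>V - {v}. g w v) = (\<Sum>v\<in>V. \<Sum>w\<in>V - {v}. g v w)"
proof -
  have "V - {v} = {w \<in> V. w \<noteq> v}" "V - {v} = {w \<in> V. v \<noteq> w}" for v by auto
  then show ?thesis
    using sum.swap_restrict[OF fin fin, of "\<lambda>v w. g w v" "\<lambda>v w. w \<noteq> v"] by simp
qed

lemma sum_E_pos_le: "(\<Sum>v\<in>V. \<Sum>w\<in>V - {v}. max 0 (E v w)) \<le> K * q + 2 * (abs_bad K * q)"
proof -
  define h :: "'a \<Rightarrow> 'a \<Rightarrow> int" where "h v w = of_bool (v \<in> Abs \<and> w \<in> N v \<inter> (V - good))" for v w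
  have "(\<Sum>v\<in>V. \<Sum>w\<in>V - {v}. h v w) \<le> (\<Sum>v\<in>V. \<Sum>w\<in>V. h v w)"
    using fin by (intro sum_mono sum_mono2) (auto simp: h_def)
  also have "\<dots> = (\<Sum>v\<in>V. if v \<in> Abs then int (card (N v \<inter> (V - good))) else 0)"
  proof (intro sum.cong refl)
    fix v assume v: "v \<in> V"
    have "{w \<in> V. w \<in> N v \<inter> (V - good)} = N v \<inter> (V - good)" by auto
    then show "(\<Sum>w\<in>V. h v w) = (if v \<in> Abs then int (card (N v \<inter> (V - good))) else 0)"
      using fin sum.inter_filter[OF fin, of "\<lambda>_. 1::int" "\<lambda>w. w \<in> N v \<inter> (V - good)"]
      by (simp add: h_def of_bool_def)
  qed
  also have "\<dots> = (\<Sum>v\<in>Abs. int (card (N v \<inter> (V - good))))"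
    using fin Abs_V by (simp add: sum.If_cases Int_absorb1)
  also have "\<dots> \<le> abs_bad K * q" by (rule sum_bad_nbrs_Abs_le)
  finally have h: "(\<Sum>v\<in>V. \<Sum>w\<in>V - {v}. h v w) \<le> abs_bad K * q" .
  have "(\<Sum>v\<in>V. \<Sum>w\<in>V - {v}. max 0 (E v w))
      \<le> (\<Sum>v\<in>V. \<Sum>w\<in>V - {v}. max 0 (cd v w - 1) + h v w + h w v)"
    unfolding h_def using max_E_le by (intro sum_mono) auto
  also have "\<dots> = (\<Sum>v\<in>V. \<Sum>w\<in>V - {v}. max 0 (cd v w - 1))
      + (\<Sum>v\<in>V. \<Sum>w\<in>V - {v}. h v w) + (\<Sum>v\<in>V. \<Sum>w\<in>V - {v}. h w v)"
    by (simp add: sum.distrib)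
  finally show ?thesis using excess h sum_offdiag_swap[of h] by linarith
qed

text \<open>The total depends only on the degrees in \<open>M\<close>: with deficiencies
  \<open>y\<close> it is \<open>\<Sum>y^2 - (2 * q + 1) * \<Sum>y\<close>, and
  \<open>\<Sum>y = q - 1 - card Abs\<close> is bounded above because \<open>Abs\<close> is large
  enough.\<close>

lemma sum_E_ge: "- (3 * (abs_lo K * q)) \<le> (\<Sum>v\<in>V. \<Sum>w\<in>V - {v}. E v w)"
proof -
  define y where "y v = q + 1 - M.d v" for v
  have "(\<Sum>v\<in>V. y v) = (\<Sum>v\<in>V. x v - of_bool (v \<in> Abs))"
    by (intro sum.cong refl) (simp add: y_def x_def dM)
  also have "\<dots> = q - 1 - int (card Abs)"
    using fin Abs_V by (simp add: sum_subtractf sum_x of_bool_def sum.If_cases Int_absorb1)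
  finally have y: "(\<Sum>v\<in>V. y v) \<le> abs_lo K" using card_Abs_ge by linarith
  have "(\<Sum>v\<in>V. \<Sum>w\<in>V - {v}. E v w) = (\<Sum>v\<in>V. \<Sum>w\<in>V - {v}. M.cd v w - 1)"
    by (intro sum.cong refl) (auto simp: E_def)
  also have "\<dots> = (\<Sum>v\<in>V. (\<Sum>w\<in>V - {v}. M.cd v w) - q * (q + 1))"
    using card_V_minus by (intro sum.cong refl) (simp add: sum_subtractf)
  also have "\<dots> = (\<Sum>v\<in>V. M.d v * (M.d v - 1)) - (\<Sum>v\<in>V. q * (q + 1))"
  proof -
    have "int (card (M v \<inter> V)) = M.d v" if "v \<in> V" for v
      using M.sub[OF that] by (simp add: M.d_def Int_absorb2)
    then show ?thesis by (simp add: sum_subtractf M.sum_cd_offdiag)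
  qed
  also have "\<dots> = (\<Sum>v\<in>V. (y v)\<^sup>2 - (2 * q + 1) * y v)"
    unfolding sum_subtractf[symmetric]
    by (intro sum.cong refl) (simp add: y_def power2_eq_square algebra_simps)
  also have "\<dots> = (\<Sum>v\<in>V. (y v)\<^sup>2) - (2 * q + 1) * (\<Sum>v\<in>V. y v)"
    by (simp add: sum_subtractf sum_distrib_left)
  finally have "(\<Sum>v\<in>V. \<Sum>w\<in>V - {v}. E v w) \<ge> - ((2 * q + 1) * (\<Sum>v\<in>V. y v))"
    using sum_nonneg[of V "\<lambda>v. (y v)\<^sup>2"] by simp
  moreover have "(2 * q + 1) * (\<Sum>v\<in>V. y v) \<le> (2 * q + 1) * abs_lo K"
    using y q_ge by (intro mult_left_mono) auto
  moreover have "(2 * q + 1) * abs_lo K \<le> 3 * q * abs_lo K"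
    using q_ge bds(11) by (intro mult_right_mono) auto
  ultimately show ?thesis by (simp add: algebra_simps)
qed

text \<open>For an integer \<open>e\<close>, \<open>2 * max 0 e - e\<close> is at least 1 if
  \<open>e\<close> is nonzero. So an upper bound for the positive entries and a lower bound for the
  total suffice.\<close>

lemma sum_card_Err: "(\<Sum>z\<in>V. int (card (Err z))) \<le> error_bd K * q"
proof -
  have "(\<Sum>z\<in>V. int (card (Err z))) = (\<Sum>z\<in>V. \<Sum>w\<in>V - {z}. if E z w \<noteq> 0 then 1 else 0)"
    using fin by (intro sum.cong refl) (simp add: Err_def sum.If_cases Int_def)
  also have "\<dots> \<le> (\<Sum>z\<in>V. \<Sum>w\<in>V - {z}. 2 * max 0 (E z w) - E z w)"
    by (intro sum_mono) auto
  also have "\<dots> = 2 * (\<Sum>z\<in>V. \<Sum>w\<in>V - {z}. max 0 (E z w)) - (\<Sum>z\<in>V. \<Sum>w\<in>V - {z}. E z w)"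
    by (simp add: sum_subtractf sum_distrib_left)
  also have "\<dots> \<le> 2 * (K * q) + 4 * (abs_bad K * q) + 3 * (abs_lo K * q)"
    using sum_E_pos_le sum_E_ge by linarith
  also have "\<dots> = error_bd K * q" by (simp add: error_bd_def algebra_simps)
  finally show ?thesis .
qed

section \<open>The bounded set of vertices that covers all errors\<close>

text \<open>Propagation of an error needs fewer errors in the column than clean neighbours through
  which it spreads; the two sets collect the vertices where either side of this comparison may
  fail.\<close>

definition core :: "'a set" where
  "core = {z \<in> V. q \<le> 4 * int (card (Err z))} \<union> {w \<in> V. q \<le> 4 * int (card (N w \<inter> (V - clean)))}"

lemma core_V: "core \<subseteq> V"
  by (auto simp: core_def)

lemma card_core: "int (card core) \<le> core_bd K"
proof -
  let ?X = "{z \<in> V. q \<le> 4 * int (card (Err z))}"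
  have "int (card ?X) * q = (\<Sum>z\<in>?X. q)" by simp
  also have "\<dots> \<le> (\<Sum>z\<in>?X. 4 * int (card (Err z)))" by (intro sum_mono) auto
  also have "\<dots> \<le> (\<Sum>z\<in>V. 4 * int (card (Err z)))" using fin by (intro sum_mono2) auto
  also have "\<dots> \<le> 4 * error_bd K * q" using sum_card_Err by (simp add: sum_distrib_left[symmetric])
  finally have "int (card ?X) \<le> 4 * error_bd K" using q_ge by simp
  moreover have "int (card {w \<in> V. q \<le> 4 * int (card (N w \<inter> (V - clean)))}) < unclean_rich K"
    unfolding unclean_rich_def
    using card_unclean_le q_bds(6) bds(13) by (intro card_rich_set) (auto simp: unclean_rich_def)
  moreover have "card core \<le> card ?X + card {w \<in> V. q \<le> 4 * int (card (N w \<inter> (V - clean)))}"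
    unfolding core_def by (rule card_Un_le)
  ultimately show ?thesis by (simp add: core_bd_def)
qed

text \<open>In the commutator identity the row of a clean \<open>w\<close> contributes nothing and
  its degree is \<open>q + 1\<close>, so the difference of degrees is the diagonal entry at
  \<open>z\<close>.\<close>

lemma sum_E_clean:
  assumes "w \<in> clean" "z \<in> V"
  shows "(\<Sum>t\<in>M w. E t z) = E z z"
proof -
  have w: "w \<in> V" using assms clean_V by blast
  have "(\<Sum>t\<in>M z. E w t) = 0"
    using E_clean[OF assms(1)] M.sub[OF assms(2)] by (intro sum.neutral) auto
  moreover have "M.d w = q + 1" using E_clean[OF assms(1) w] E_self[OF w] by simp
  ultimately show ?thesis using E_commutator[OF assms(2) w] E_self[OF assms(2)] by simp
qed

text \<open>A nonzero diagonal entry at \<open>z\<close> would make every clean vertex adjacent, in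
  \<open>M\<close>, to \<open>z\<close> or to an error of its column. These at most about
  \<open>q / 4\<close> vertices cover only about \<open>q^2 / 4\<close> vertices, too few for the
  clean ones.\<close>

lemma E_self_core:
  assumes z: "z \<in> V - core"
  shows "E z z = 0"
proof (rule ccontr)
  assume ne: "E z z \<noteq> 0"
  let ?T = "insert z (Err z)"
  have TV: "?T \<subseteq> V" using z by (auto simp: Err_def)
  have "clean \<subseteq> (\<Union>t\<in>?T. M t)"
  proof
    fix w assume w: "w \<in> clean"
    then have wV: "w \<in> V" using clean_V by blast
    have "(\<Sum>t\<in>M w. E t z) \<noteq> 0" using sum_E_clean[OF w] z ne by simp
    then obtain t where t: "t \<in> M w" "E t z \<noteq> 0" by (rule sum.not_neutral_contains_not_neutral)
    then have "t \<in> V" using M.sub[OF wV] by blast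
    then have "t \<in> ?T" "w \<in> M t" using t M.sym wV by (auto simp: Err_def E_commute)
    then show "w \<in> (\<Union>t\<in>?T. M t)" by blast
  qed
  then have "card clean \<le> card (\<Union>t\<in>?T. M t)"
    using finite_Err M.fin_N TV by (intro card_mono) auto
  also have "\<dots> \<le> (\<Sum>t\<in>?T. card (M t))" using finite_Err by (intro card_UN_le) simp
  finally have "int (card clean) \<le> (\<Sum>t\<in>?T. M.d t)" by (simp only: M.d_def flip: of_nat_sum)
  also have "\<dots> \<le> (\<Sum>t\<in>?T. q + 2 + deg_bd K)"
  proof (intro sum_mono)
    fix t assume "t \<in> ?T"
    then have "t \<in> V" using TV by blast
    then show "M.d t \<le> q + 2 + deg_bd K" using x_ge[of t] by (simp add: dM x_def)
  qed
  also have "\<dots> = int (card (Err z) + 1) * (q + 2 + deg_bd K)"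
    using finite_Err[of z] by (simp add: Err_def algebra_simps)
  finally have "4 * int (card clean) \<le> (4 * int (card (Err z)) + 4) * (q + 2 + deg_bd K)"
    by (simp add: algebra_simps)
  also have "\<dots> \<le> (q + 3) * (q + 2 + deg_bd K)"
    using z q_ge bds(1) by (intro mult_right_mono) (auto simp: core_def)
  finally have "4 * int (card clean) \<le> (q + 3) * (q + 2 + deg_bd K)" .
  moreover have "int (card clean) = q\<^sup>2 + q + 1 - int (card (V - clean))"
  proof -
    have "card V = card clean + card (V - clean)"
      using clean_V fin by (metis card_Diff_subset card_mono finite_subset le_add_diff_inverse)
    then show ?thesis using card_V by linarith
  qed
  ultimately have *: "4 * q\<^sup>2 + 4 * q + 4 - 4 * (unclean_bd K * q) \<le> (q + 3) * (q + 2 + deg_bd K)"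
    using card_unclean_le by linarith
  \<comment> \<open>The threshold \<open>8 * unclean_bd K + 8 * deg_bd K + 40\<close> is
    \<open>a + b\<close>: \<open>a\<close> absorbs the terms linear in \<open>q\<close>,
    \<open>b\<close> the constant ones.\<close>
  define a where "a = 4 * unclean_bd K + deg_bd K + 1"
  define b where "b = 4 * unclean_bd K + 7 * deg_bd K + 39"
  have "3 * (q * q) \<le> a * q + 3 * deg_bd K + 2"
    using * by (simp add: a_def algebra_simps power2_eq_square)
  moreover have "(a + b) * q \<le> q * q"
    using q_bds(7) q_ge unfolding a_def b_def by (intro mult_right_mono) auto
  then have "a * q + b * q \<le> q * q" by (simp add: distrib_right)
  moreover have "b * 1 \<le> b * q"
    using q_ge bds(1,13) unfolding b_def by (intro mult_left_mono) auto
  moreover have "3 * deg_bd K + 2 < b" using bds(1,13) by (simp add: b_def)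
  moreover have "0 \<le> q * q" by simp
  ultimately show False by linarith
qed

text \<open>For each clean neighbour \<open>v\<close> of \<open>w\<close>, the vanishing sum over
  \<open>M v\<close> requires a second error of column \<open>z\<close> in \<open>M v\<close>.
  Distinct \<open>v\<close> yield distinct errors, so column \<open>z\<close> would have at least
  about \<open>q / 2\<close> of them.\<close>

lemma E_core:
  assumes z: "z \<in> V - core" and w: "w \<in> V - core" and "w \<noteq> z"
  shows "E w z = 0"
proof (rule ccontr)
  assume ne: "E w z \<noteq> 0"
  have wV: "w \<in> V" using w by blast
  have "\<exists>t\<in>Err z. t \<in> M v \<and> t \<noteq> w" if v: "v \<in> N w \<inter> clean" for v
  proof -
    have vV: "v \<in> V" using v clean_V by blast
    have wv: "w \<in> M v" using v sym vV wV by (auto simp: M_def)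
    have "(\<Sum>t\<in>M v. E t z) = 0" using sum_E_clean[of v z] v z E_self_core[OF z] by simp
    then have "E w z + (\<Sum>t\<in>M v - {w}. E t z) = 0"
      using sum.remove[OF M.fin_N[OF vV] wv, of "\<lambda>t. E t z"] by simp
    then have "(\<Sum>t\<in>M v - {w}. E t z) \<noteq> 0" using ne by linarith
    then obtain t where t: "t \<in> M v - {w}" "E t z \<noteq> 0" by (rule sum.not_neutral_contains_not_neutral)
    then have "t \<in> V" "t \<noteq> z" using M.sub[OF vV] E_self_core[OF z] by auto
    then show ?thesis using t by (auto simp: Err_def E_commute)
  qed
  then obtain \<tau> where \<tau>: "\<And>v. v \<in> N w \<inter> clean \<Longrightarrow> \<tau> v \<in> Err z \<and> \<tau> v \<in> M v \<and> \<tau> v \<noteq> w"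
    by metis
  \<comment> \<open>Two clean vertices have exactly one common neighbour in \<open>M\<close>, and
    for \<open>a\<close> and \<open>b\<close> this is \<open>w\<close>.\<close>
  have "inj_on \<tau> (N w \<inter> clean)"
  proof (rule inj_onI, rule ccontr)
    fix a b assume ab: "a \<in> N w \<inter> clean" "b \<in> N w \<inter> clean" "\<tau> a = \<tau> b" "a \<noteq> b"
    then have V: "a \<in> V" "b \<in> V" using clean_V by auto
    have "w \<in> M a" "w \<in> M b" using ab sym V wV by (auto simp: M_def)
    then have "{w, \<tau> a} \<subseteq> M a \<inter> M b" using \<tau>[OF ab(1)] \<tau>[OF ab(2)] ab(3) by auto
    then have "card {w, \<tau> a} \<le> card (M a \<inter> M b)" using M.fin_N[OF V(1)] by (intro card_mono) auto
    moreover have "card {w, \<tau> a} = 2" using \<tau>[OF ab(1)] by auto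
    ultimately have "2 \<le> M.cd a b" by (simp add: M.cd_def)
    moreover have "E a b = 0" using E_clean ab V by blast
    ultimately show False using ab(4) by (simp add: E_def)
  qed
  moreover have "\<tau> ` (N w \<inter> clean) \<subseteq> Err z" using \<tau> by blast
  ultimately have 1: "card (N w \<inter> clean) \<le> card (Err z)"
    using finite_Err by (rule card_inj_on_le)
  have "N w \<subseteq> (N w \<inter> clean) \<union> (N w \<inter> (V - clean))" using sub[OF wV] by blast
  then have "card (N w) \<le> card ((N w \<inter> clean) \<union> (N w \<inter> (V - clean)))"
    using fin_N[OF wV] by (intro card_mono) auto
  also have "\<dots> \<le> card (N w \<inter> clean) + card (N w \<inter> (V - clean))" by (rule card_Un_le)
  finally have "d w \<le> int (card (N w \<inter> clean)) + int (card (N w \<inter> (V - clean)))"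
    by (simp add: d_def)
  moreover have "4 * int (card (N w \<inter> (V - clean))) < q" "4 * int (card (Err z)) < q"
    using w z by (auto simp: core_def)
  moreover have "4 * d w \<ge> 4 * q + 4 - q" using x_le[OF wV] by (simp add: x_def)
  ultimately show False using 1 q_ge by linarith
qed

lemma card_M_core:
  assumes "w \<in> V - core" shows "int (card (M w)) = q + 1"
proof -
  have "M.d w = q + 1" using E_self_core[OF assms] E_self[of w] assms by simp
  then show ?thesis by (simp add: M.d_def)
qed

lemma card_M_Int_core:
  assumes "w \<in> V - core" "z \<in> V - core" "w \<noteq> z" shows "card (M w \<inter> M z) = 1"
proof -
  have "M.cd w z = 1" using E_core[OF assms(2,1,3)] assms(3) by (simp add: E_def)
  then show ?thesis by (simp add: M.cd_def)
qed

end

section \<open>Completing almost complete projective planes\<close>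

lemma card_le_of_inj_choice:
  assumes "finite B" "\<And>a. a \<in> A \<Longrightarrow> \<exists>b\<in>B. R a b"
    and "\<And>a a' b. a \<in> A \<Longrightarrow> a' \<in> A \<Longrightarrow> b \<in> B \<Longrightarrow> R a b \<Longrightarrow> R a' b \<Longrightarrow> a = a'"
  shows "card A \<le> card B"
proof -
  obtain h where h: "\<And>a. a \<in> A \<Longrightarrow> h a \<in> B \<and> R a (h a)" using assms(2) by metis
  have "inj_on h A" using h assms(3) by (intro inj_onI) metis
  then show ?thesis using h assms(1) by (intro card_inj_on_le) auto
qed

locale line_family =
  fixes V :: "'a set" and q :: nat and F :: "'a set set"
  assumes fin: "finite V" and card_V: "card V = q\<^sup>2 + q + 1" and q_pos: "1 \<le> q"
    and line_sub: "L \<in> F \<Longrightarrow> L \<subseteq> V" and card_line: "L \<in> F \<Longrightarrow> card L = q + 1"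
    and lines_meet: "L \<in> F \<Longrightarrow> L' \<in> F \<Longrightarrow> L \<noteq> L' \<Longrightarrow> card (L \<inter> L') = 1"
begin

definition through :: "'a \<Rightarrow> 'a set set" where "through p = {L \<in> F. p \<in> L}"
definition joined :: "'a \<Rightarrow> 'a set" where "joined p = (\<Union>L\<in>through p. L - {p})"

lemma finite_F: "finite F"
  using line_sub fin by (auto intro: finite_subset[of F "Pow V"])

lemma finite_line: "L \<in> F \<Longrightarrow> finite L"
  using line_sub fin finite_subset by blast

lemma same_line:
  assumes "L \<in> F" "L' \<in> F" "a \<in> L \<inter> L'" "b \<in> L \<inter> L'" "a \<noteq> b" shows "L = L'"
proof (rule ccontr)
  assume "L \<noteq> L'"
  then obtain c where "L \<inter> L' = {c}" using lines_meet assms card_1_singletonE by metis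
  then show False using assms by auto
qed

lemma finite_through: "finite (through p)"
  using finite_F by (simp add: through_def)

lemma card_joined: "card (joined p) = card (through p) * q"
proof -
  have "card (joined p) = (\<Sum>L\<in>through p. card (L - {p}))"
    unfolding joined_def
  proof (rule card_UN_disjoint)
    show "\<forall>L\<in>through p. \<forall>L'\<in>through p. L \<noteq> L' \<longrightarrow> (L - {p}) \<inter> (L' - {p}) = {}"
      using same_line[of _ _ p] by (auto simp: through_def)
  qed (use finite_through finite_line in \<open>auto simp: through_def\<close>)
  also have "\<dots> = (\<Sum>L\<in>through p. q)"
    using card_line finite_line by (intro sum.cong refl) (auto simp: through_def)
  finally show ?thesis by simp
qed

lemma joined_sub: "joined p \<subseteq> V - {p}"
  using line_sub by (auto simp: joined_def through_def)

lemma card_V_minus: "p \<in> V \<Longrightarrow> card (V - {p}) = (q + 1) * q"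
  using card_V by (simp add: power2_eq_square)

lemma card_through_le:
  assumes "p \<in> V" shows "card (through p) \<le> q + 1"
proof -
  have "card (through p) * q \<le> (q + 1) * q"
    using card_mono[OF _ joined_sub[of p]] fin card_joined card_V_minus[OF assms] by simp
  then show ?thesis using q_pos by (auto simp only: mult_le_cancel2)
qed

lemma sum_through: "(\<Sum>p\<in>V. card (through p)) = card F * (q + 1)"
proof -
  have "(\<Sum>p\<in>V. card (through p)) = (\<Sum>p\<in>V. \<Sum>L\<in>{L \<in> F. p \<in> L}. 1)"
    by (simp add: through_def)
  also have "\<dots> = (\<Sum>L\<in>F. \<Sum>p\<in>{p \<in> V. p \<in> L}. 1)"
    using fin finite_F by (rule sum.swap_restrict)
  also have "\<dots> = (\<Sum>L\<in>F. q + 1)"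
  proof (intro sum.cong refl)
    fix L assume L: "L \<in> F"
    have "{p \<in> V. p \<in> L} = L" using line_sub[OF L] by auto
    then show "(\<Sum>p\<in>{p \<in> V. p \<in> L}. 1) = q + 1" using card_line[OF L] by simp
  qed
  finally show ?thesis by simp
qed

lemma sum_through_sq: "(\<Sum>p\<in>V. (card (through p))\<^sup>2) + card F = card F * (q + 1 + card F)"
proof -
  have "(\<Sum>p\<in>V. (card (through p))\<^sup>2) = (\<Sum>p\<in>V. \<Sum>L\<in>{L \<in> F. p \<in> L}. card (through p))"
    by (simp add: through_def power2_eq_square)
  also have "\<dots> = (\<Sum>L\<in>F. \<Sum>p\<in>{p \<in> V. p \<in> L}. card (through p))"
    using fin finite_F by (rule sum.swap_restrict)
  also have "\<dots> = (\<Sum>L\<in>F. \<Sum>p\<in>L. card (through p))"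
  proof (intro sum.cong)
    fix L assume L: "L \<in> F"
    show "{p \<in> V. p \<in> L} = L" using line_sub[OF L] by auto
  qed simp_all
  finally have 1: "(\<Sum>p\<in>V. (card (through p))\<^sup>2) = (\<Sum>L\<in>F. \<Sum>p\<in>L. card (through p))" .
  have 2: "(\<Sum>p\<in>L. card (through p)) + 1 = q + 1 + card F" if L: "L \<in> F" for L
  proof -
    have "(\<Sum>p\<in>L. card (through p)) = (\<Sum>p\<in>L. \<Sum>L'\<in>{L' \<in> F. p \<in> L'}. 1)"
      by (simp add: through_def)
    also have "\<dots> = (\<Sum>L'\<in>F. \<Sum>p\<in>{p \<in> L. p \<in> L'}. 1)"
      using finite_line[OF L] finite_F by (rule sum.swap_restrict)
    also have "\<dots> = (\<Sum>L'\<in>F. card (L \<inter> L'))" by (simp add: Int_def)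
    also have "\<dots> = card (L \<inter> L) + (\<Sum>L'\<in>F - {L}. card (L \<inter> L'))"
      using finite_F L by (simp add: sum.remove)
    also have "(\<Sum>L'\<in>F - {L}. card (L \<inter> L')) = (\<Sum>L'\<in>F - {L}. 1)"
      using lines_meet[OF L] by (intro sum.cong refl) auto
    also have "\<dots> = card (F - {L})" by simp
    finally show ?thesis using card_line[OF L] card.remove[OF finite_F L] by simp
  qed
  have "(\<Sum>L\<in>F. (\<Sum>p\<in>L. card (through p)) + 1) = (\<Sum>L\<in>F. q + 1 + card F)"
    using 2 by (intro sum.cong refl) auto
  then show ?thesis unfolding 1 by (simp only: sum.distrib sum_constant) (simp add: algebra_simps)
qed

text \<open>With \<open>\<delta>\<close> the number of lines missing at a point,
  \<open>\<Sum>\<delta> = s * (q + 1)\<close> and \<open>\<Sum>\<delta>^2 = s^2 + s * q\<close>. If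
  1 were never a value, \<open>\<delta>^2 >= 2 * \<delta>\<close> everywhere would give
  \<open>s >= q + 2\<close>.\<close>

lemma exists_deficiency_one:
  assumes s: "card F + s = q\<^sup>2 + q + 1" "1 \<le> s" "s \<le> q + 1"
  shows "\<exists>p\<in>V. card (through p) = q"
proof (rule ccontr)
  assume no: "\<not> ?thesis"
  define \<delta> where "\<delta> p = int q + 1 - int (card (through p))" for p
  define n where "n = int q * int q + int q + 1"
  have nV: "int (card V) = n" using card_V by (simp add: n_def power2_eq_square)
  have nF: "int (card F) = n - int s"
    using arg_cong[OF s(1), of int] by (simp add: n_def power2_eq_square)
  have 1: "(\<Sum>p\<in>V. int (card (through p))) = (n - int s) * (int q + 1)"
    using arg_cong[OF sum_through, of int] nF by (simp add: algebra_simps)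
  have 2: "(\<Sum>p\<in>V. (int (card (through p)))\<^sup>2) = (n - int s) * (int q + n - int s)"
    using arg_cong[OF sum_through_sq, of int] nF by (simp add: algebra_simps)
  have "(\<Sum>p\<in>V. \<delta> p) = n * (int q + 1) - (n - int s) * (int q + 1)"
    by (simp add: \<delta>_def sum_subtractf 1 nV)
  then have S1: "(\<Sum>p\<in>V. \<delta> p) = int s * (int q + 1)" by (simp add: algebra_simps)
  have "(\<Sum>p\<in>V. (\<delta> p)\<^sup>2) = (\<Sum>p\<in>V. (int q + 1)\<^sup>2 - 2 * (int q + 1) * int (card (through p))
      + (int (card (through p)))\<^sup>2)"
    by (intro sum.cong refl) (simp add: \<delta>_def power2_eq_square algebra_simps)
  also have "\<dots> = n * (int q + 1)\<^sup>2 - 2 * (int q + 1) * ((n - int s) * (int q + 1))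
      + (n - int s) * (int q + n - int s)"
    by (simp only: sum.distrib sum_subtractf sum_distrib_left[symmetric] 1 2 sum_constant nV)
  also have "\<dots> = int s * int s + int s * int q"
    by (simp add: n_def algebra_simps power2_eq_square)
  finally have S2: "(\<Sum>p\<in>V. (\<delta> p)\<^sup>2) = int s * int s + int s * int q" .
  have "(\<Sum>p\<in>V. \<delta> p) \<le> (\<Sum>p\<in>V. (\<delta> p)\<^sup>2 - \<delta> p)"
  proof (intro sum_mono)
    fix p assume p: "p \<in> V"
    have "\<delta> p \<ge> 0" "\<delta> p \<noteq> 1" using card_through_le[OF p] no p by (auto simp: \<delta>_def)
    then consider "\<delta> p = 0" | "\<delta> p \<ge> 2" by linarith
    then show "\<delta> p \<le> (\<delta> p)\<^sup>2 - \<delta> p"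
    proof cases
      case 2
      then have "2 * \<delta> p \<le> \<delta> p * \<delta> p" by (intro mult_right_mono) auto
      then show ?thesis by (simp add: power2_eq_square)
    qed simp
  qed
  then have "int s * (int q + 1) \<le> int s * int s + int s * int q - int s * (int q + 1)"
    by (simp add: sum_subtractf S1 S2)
  then have "int s * (int q + 2) \<le> int s * int s" by (simp add: algebra_simps)
  then show False using s by (simp add: mult_le_cancel_left)
qed

text \<open>A point with one line missing is joined to \<open>q^2\<close> others; the
  \<open>q\<close> unjoined points together with \<open>p\<close> have to form the missing
  line.\<close>

lemma extend:
  assumes p: "p \<in> V" "card (through p) = q"
  defines "K \<equiv> V - joined p"
  shows "line_family V q (insert K F)" "K \<notin> F"
proof -
  have pK: "p \<in> K" using p joined_sub by (auto simp: K_def)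
  have "card (joined p) = q * q" using card_joined p(2) by simp
  moreover have fj: "finite (joined p)" "joined p \<subseteq> V" using joined_sub[of p] fin finite_subset by auto
  ultimately have cK: "card K = q + 1"
    using card_V by (simp add: K_def card_Diff_subset power2_eq_square)
  have notF: "K \<noteq> L" if L: "L \<in> F" for L
  proof
    assume KL: "K = L"
    then have "L - {p} \<subseteq> joined p" using pK L by (auto simp: joined_def through_def)
    then have "K - {p} = {}" using KL by (auto simp: K_def)
    then show False using cK q_pos pK by (metis Suc_eq_plus1 card_1_singleton_iff card.empty card_Suc_eq insert_Diff_single insert_absorb nat.inject not_one_le_zero)
  qed
  then show "K \<notin> F" by blast
  have meet: "card (K \<inter> L) = 1" if L: "L \<in> F" for L
  proof (cases "p \<in> L")
    case True
    then have "L - {p} \<subseteq> joined p" using L by (auto simp: joined_def through_def)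
    then have "K \<inter> L = {p}" using True pK unfolding K_def by blast
    then show ?thesis by simp
  next
    case False
    \<comment> \<open>The \<open>q\<close> lines through \<open>p\<close> meet \<open>L\<close> in
      distinct points, so exactly one point of \<open>L\<close> remains for
      \<open>K\<close>.\<close>
    have "L \<inter> joined p = (\<Union>L'\<in>through p. L \<inter> L')" using False by (auto simp: joined_def)
    moreover have "card (\<Union>L'\<in>through p. L \<inter> L') = (\<Sum>L'\<in>through p. card (L \<inter> L'))"
    proof (rule card_UN_disjoint)
      show "\<forall>A\<in>through p. \<forall>B\<in>through p. A \<noteq> B \<longrightarrow> L \<inter> A \<inter> (L \<inter> B) = {}"
        using same_line[of _ _ p] False by (auto simp: through_def)
    qed (use finite_through finite_line L in auto)
    moreover have "(\<Sum>L'\<in>through p. card (L \<inter> L')) = (\<Sum>L'\<in>through p. 1)"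
      using lines_meet[OF L] False by (intro sum.cong refl) (auto simp: through_def)
    ultimately have "card (L \<inter> joined p) = q" using p(2) by simp
    moreover have "K \<inter> L = L - (L \<inter> joined p)" using line_sub[OF L] by (auto simp: K_def)
    ultimately show ?thesis
      using finite_line[OF L] card_line[OF L] by (simp add: card_Diff_subset)
  qed
  show "line_family V q (insert K F)"
  proof
    fix L assume "L \<in> insert K F"
    then show "L \<subseteq> V" "card L = q + 1" using cK line_sub card_line by (auto simp: K_def)
  next
    fix L L' assume LL': "L \<in> insert K F" "L' \<in> insert K F" "L \<noteq> L'"
    have meet': "card (L \<inter> K) = 1" if "L \<in> F" for L
      using meet[OF that] by (simp only: Int_commute)
    show "card (L \<inter> L') = 1"
    proof (cases "L = K")
      case True
      then show ?thesis using meet LL' by blast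
    next
      case False
      then show ?thesis using meet'[of L] lines_meet[of L L'] LL' by blast
    qed
  qed (use fin card_V q_pos in auto)
qed

end

lemma line_family_completion:
  assumes "line_family V q F" "card F + s = q\<^sup>2 + q + 1" "s \<le> q + 1"
  shows "\<exists>F'. F \<subseteq> F' \<and> line_family V q F' \<and> card F' = q\<^sup>2 + q + 1"
  using assms
proof (induction s arbitrary: F)
  case (Suc s)
  interpret line_family V q F by fact
  obtain p where p: "p \<in> V" "card (through p) = q"
    using exists_deficiency_one[OF Suc.prems(2)] Suc.prems(3) by auto
  let ?F = "insert (V - joined p) F"
  have "card ?F + s = q\<^sup>2 + q + 1" using extend(2)[OF p] finite_F Suc.prems(2) by simp
  then obtain F' where "?F \<subseteq> F'" "line_family V q F'" "card F' = q\<^sup>2 + q + 1"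
    using Suc.IH[OF extend(1)[OF p]] Suc.prems(3) by auto
  then show ?case by blast
qed auto

locale full_plane = line_family +
  assumes card_F: "card F = q\<^sup>2 + q + 1"
begin

text \<open>The maximum \<open>q + 1\<close> is also the average, by the incidence count.\<close>

lemma card_through:
  assumes p: "p \<in> V" shows "card (through p) = q + 1"
proof (rule ccontr)
  assume "card (through p) \<noteq> q + 1"
  then have "card (through p) < q + 1" using card_through_le[OF p] by simp
  then have "(\<Sum>p\<in>V. card (through p)) < (\<Sum>p\<in>V. q + 1)"
    using fin p card_through_le by (intro sum_strict_mono_ex1) auto
  then show False using sum_through card_F card_V by simp
qed

lemma join:
  assumes "a \<in> V" "b \<in> V" "a \<noteq> b" shows "\<exists>L\<in>F. a \<in> L \<and> b \<in> L"
proof -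
  have "card (joined a) = card (V - {a})"
    using card_joined card_through card_V_minus assms(1) by simp
  then have "joined a = V - {a}"
    using card_subset_eq[OF _ joined_sub[of a]] fin by simp
  then have "b \<in> joined a" using assms by blast
  then show ?thesis by (auto simp: joined_def through_def)
qed

end

section \<open>Polarities\<close>

text \<open>A polarity is recorded by its map from points to polar lines alone; the lines are the
  values of \<open>pl\<close>, and \<open>sym\<close> is the reversal of incidence.\<close>

locale polar_incidence =
  fixes V :: "'a set" and q :: nat and pl :: "'a \<Rightarrow> 'a set"
  assumes fin: "finite V" and card_V: "card V = q\<^sup>2 + q + 1"
    and line_sub: "x \<in> V \<Longrightarrow> pl x \<subseteq> V" and card_line: "x \<in> V \<Longrightarrow> card (pl x) = q + 1"
    and meet: "x \<in> V \<Longrightarrow> y \<in> V \<Longrightarrow> x \<noteq> y \<Longrightarrow> card (pl x \<inter> pl y) = 1"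
    and sym: "x \<in> V \<Longrightarrow> y \<in> V \<Longrightarrow> x \<in> pl y \<Longrightarrow> y \<in> pl x"

text \<open>For \<open>z \<in> S\<close> the poles \<open>T z\<close> of the known lines through \<open>z\<close> turn out to be collinear,
  and the line through them, one of the new lines, becomes the polar line of \<open>z\<close>.\<close>

theorem polar_extension:
  fixes M :: "'a \<Rightarrow> 'a set"
  assumes fin: "finite V" and card_V: "card V = q\<^sup>2 + q + 1" and SV: "S \<subseteq> V"
    and small: "(card S)\<^sup>2 + 2 * card S < q"
    and M_sub: "\<And>w. w \<in> V - S \<Longrightarrow> M w \<subseteq> V" and card_M: "\<And>w. w \<in> V - S \<Longrightarrow> card (M w) = q + 1"
    and M_meet: "\<And>w z. w \<in> V - S \<Longrightarrow> z \<in> V - S \<Longrightarrow> w \<noteq> z \<Longrightarrow> card (M w \<inter> M z) = 1"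
    and M_sym: "\<And>w z. w \<in> V - S \<Longrightarrow> z \<in> V - S \<Longrightarrow> w \<in> M z \<Longrightarrow> z \<in> M w"
  obtains pl where "polar_incidence V q pl" "\<And>w. w \<in> V - S \<Longrightarrow> pl w = M w"
proof -
  define s where "s = card S"
  have finS: "finite S" using SV fin finite_subset by blast
  have q1: "1 \<le> q" and s_q: "2 * s < q" "s * s + 2 * s < q"
    using small by (auto simp: s_def power2_eq_square)
  define F where "F = M ` (V - S)"
  have injM: "inj_on M (V - S)"
  proof (rule inj_onI, rule ccontr)
    fix w z assume wz: "w \<in> V - S" "z \<in> V - S" "M w = M z" "w \<noteq> z"
    then show False using M_meet[OF wz(1,2,4)] card_M[OF wz(1)] q1 by simp
  qed
  have lf: "line_family V q F"
  proof
    fix L L' assume LL': "L \<in> F" "L' \<in> F" "L \<noteq> L'"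
    then obtain w z where "w \<in> V - S" "z \<in> V - S" "L = M w" "L' = M z" by (auto simp: F_def)
    then show "card (L \<inter> L') = 1" using M_meet LL'(3) by blast
  qed (use fin card_V q1 M_sub card_M in \<open>auto simp: F_def\<close>)
  have cF: "card F + s = q\<^sup>2 + q + 1"
    using card_image[OF injM] SV finS card_mono[OF fin SV] card_V
    by (simp add: F_def s_def card_Diff_subset)
  have "s \<le> q + 1" using s_q by simp
  then obtain F' where F': "F \<subseteq> F'" "line_family V q F'" "card F' = q\<^sup>2 + q + 1"
    using line_family_completion[OF lf cF] by blast
  interpret full_plane V q F'
    by (intro full_plane.intro full_plane_axioms.intro F')
  define New where "New = F' - F"
  have cNew: "card New = s"
    using cF F'(1,3) finite_F finite_subset[OF F'(1)] by (simp add: New_def card_Diff_subset)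
  have finNew: "finite New" using finite_F by (simp add: New_def)
  have M_F: "M w \<in> F'" "M w \<notin> New" if "w \<in> V - S" for w
    using that F'(1) by (auto simp: F_def New_def)
  have old: "\<exists>u\<in>V - S. L = M u" if "L \<in> F'" "L \<notin> New" for L
    using that by (auto simp: F_def New_def)
  define T where "T z = {w \<in> V - S. z \<in> M w}" for z
  have finT: "finite (T z)" for z using fin by (simp add: T_def)
  \<comment> \<open>At most \<open>s\<close> of the \<open>q + 1\<close> lines through
    \<open>z\<close> are new; all others have a pole in \<open>T z\<close>.\<close>
  have cT: "q + 1 \<le> card (T z) + s" if z: "z \<in> S" for z
  proof -
    have "through z \<subseteq> M ` (T z) \<union> New"
      using old by (auto simp: through_def T_def)
    then have "card (through z) \<le> card (M ` (T z) \<union> New)"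
      using finT finNew by (intro card_mono) auto
    also have "\<dots> \<le> card (M ` (T z)) + card New" by (rule card_Un_le)
    also have "\<dots> \<le> card (T z) + s" using card_image_le[OF finT] cNew by simp
    finally show ?thesis using card_through z SV by auto
  qed
  have T_meet: "u = z" if "w \<in> V - S" "w' \<in> V - S" "w \<noteq> w'" "u \<in> M w \<inter> M w'" "z \<in> M w \<inter> M w'" for u z w w'
    using same_line[OF M_F(1)[OF that(1)] M_F(1)[OF that(2)] that(4,5)] that injM
    by (auto dest: inj_onD)
  \<comment> \<open>An old line through two poles has its own pole on both of their polar lines,
    hence at \<open>z\<close>; but poles of old lines lie outside \<open>S\<close>.\<close>
  have T_new: "L \<in> New" if T: "z \<in> S" "w \<in> T z" "w' \<in> T z" "w \<noteq> w'" "L \<in> F'" "w \<in> L" "w' \<in> L" for z w w' L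
  proof (rule ccontr)
    assume "L \<notin> New"
    then obtain u where u: "u \<in> V - S" "L = M u" using old T(5) by blast
    then have "u \<in> M w" "u \<in> M w'" using M_sym T by (auto simp: T_def)
    then have "u = z" using T_meet[of w w' u z] T by (auto simp: T_def)
    then show False using u T by blast
  qed
  \<comment> \<open>Otherwise each new line contains at most \<open>s\<close> points of
    \<open>T z\<close>, by joining them to a point \<open>w''\<close> of \<open>T z\<close> off the
    line. The new lines through one pole \<open>w\<close> cover \<open>T z\<close>, so it would have
    at most \<open>s^2 + 1\<close> points.\<close>
  have "\<exists>L\<in>New. T z \<subseteq> L" if z: "z \<in> S" for z
  proof (rule ccontr)
    assume no: "\<not> ?thesis"
    have few: "card (L \<inter> T z) \<le> s" if L: "L \<in> New" for L
    proof -
      obtain w'' where w'': "w'' \<in> T z" "w'' \<notin> L" using no L by blast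
      have "card (L \<inter> T z) \<le> card New"
      proof (rule card_le_of_inj_choice[OF finNew, where R = "\<lambda>t K. t \<in> K \<and> w'' \<in> K"])
        fix t assume t: "t \<in> L \<inter> T z"
        then have "t \<noteq> w''" "t \<in> V" "w'' \<in> V" using w'' by (auto simp: T_def)
        then obtain K where K: "K \<in> F'" "t \<in> K" "w'' \<in> K" using join by blast
        then show "\<exists>K\<in>New. t \<in> K \<and> w'' \<in> K" using T_new[OF z _ w''(1) \<open>t \<noteq> w''\<close>] t by blast
      next
        fix t t' K assume "t \<in> L \<inter> T z" "t' \<in> L \<inter> T z" "K \<in> New" "t \<in> K \<and> w'' \<in> K" "t' \<in> K \<and> w'' \<in> K"
        then show "t = t'" using same_line[of K L t t'] w''(2) L by (auto simp: New_def)
      qed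
      then show ?thesis by (simp add: cNew)
    qed
    have "T z \<noteq> {}" using cT[OF z] s_q by auto
    then obtain w where w: "w \<in> T z" by blast
    have "T z - {w} \<subseteq> (\<Union>L\<in>New. L \<inter> T z)"
    proof
      fix t assume t: "t \<in> T z - {w}"
      then have "t \<noteq> w" "t \<in> V" "w \<in> V" using w by (auto simp: T_def)
      then obtain K where K: "K \<in> F'" "t \<in> K" "w \<in> K" using join by blast
      then have "K \<in> New" using T_new[OF z _ w \<open>t \<noteq> w\<close>] t by blast
      then show "t \<in> (\<Union>L\<in>New. L \<inter> T z)" using K t by blast
    qed
    then have "card (T z - {w}) \<le> card (\<Union>L\<in>New. L \<inter> T z)"
      using finNew finT by (intro card_mono) auto
    also have "\<dots> \<le> (\<Sum>L\<in>New. card (L \<inter> T z))" by (rule card_UN_le[OF finNew])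
    also have "\<dots> \<le> (\<Sum>L\<in>New. s)" using few by (intro sum_mono) auto
    also have "\<dots> = s * s" by (simp add: cNew)
    finally show False using cT[OF z] w finT[of z] s_q by (simp add: card_Diff_singleton)
  qed
  then obtain h where h: "\<And>z. z \<in> S \<Longrightarrow> h z \<in> New \<and> T z \<subseteq> h z" by metis
  have hF: "h z \<in> F'" if "z \<in> S" for z using h[OF that] by (simp add: New_def)
  \<comment> \<open>Two sets \<open>T z\<close> and \<open>T z'\<close> share at most one pole, so
    their union is too large for one line.\<close>
  have injh: "inj_on h S"
  proof (rule inj_onI, rule ccontr)
    fix z z' assume zz: "z \<in> S" "z' \<in> S" "h z = h z'" "z \<noteq> z'"
    have "card (T z \<inter> T z') \<le> 1"
    proof (rule ccontr)
      assume "\<not> ?thesis"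
      then obtain w w' where "w \<in> T z \<inter> T z'" "w' \<in> T z \<inter> T z'" "w \<noteq> w'"
        using card_le_Suc0_iff_eq[of "T z \<inter> T z'"] finT by auto
      then show False using T_meet[of w w' z z'] zz(4) by (auto simp: T_def)
    qed
    moreover have "card (T z \<union> T z') \<le> card (h z)"
      using h[OF zz(1)] h[OF zz(2)] zz(3) finite_line[OF hF[OF zz(1)]] by (intro card_mono) auto
    moreover have "card (T z) + card (T z') = card (T z \<union> T z') + card (T z \<inter> T z')"
      using finT by (intro card_Un_Int)
    ultimately show False
      using cT[OF zz(1)] cT[OF zz(2)] card_line[OF hF[OF zz(1)]] s_q by simp
  qed
  define pl where "pl w = (if w \<in> S then h w else M w)" for w
  have pl_F: "pl w \<in> F'" if "w \<in> V" for w using that hF M_F by (auto simp: pl_def)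
  have inj: "inj_on pl V"
  proof (rule inj_onI)
    fix w z assume "w \<in> V" "z \<in> V" "pl w = pl z"
    then show "w = z"
      using h M_F(2) inj_onD[OF injM, of w z] inj_onD[OF injh, of w z]
      by (cases "w \<in> S"; cases "z \<in> S") (auto simp: pl_def, (metis DiffI)+)
  qed
  have sym1: "w \<in> h z" if "w \<in> V - S" "z \<in> S" "z \<in> M w" for w z
    using that h by (auto simp: T_def)
  \<comment> \<open>If incidence failed, \<open>M w\<close> would meet each \<open>M t\<close>, for
    \<open>t\<close> in \<open>T z\<close>, in a point of \<open>S\<close>: the polar line of a
    point outside \<open>S\<close> would be old and yet equal \<open>h z\<close>. Distinct
    \<open>t\<close> give distinct points, so \<open>T z\<close> would have at most \<open>s\<close>
    elements.\<close>
  have sym2: "z \<in> M w" if w: "w \<in> V - S" and z: "z \<in> S" and wz: "w \<in> h z" for w z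
  proof (rule ccontr)
    assume no: "z \<notin> M w"
    have "card (T z) \<le> card S"
    proof (rule card_le_of_inj_choice[OF finS, where R = "\<lambda>t p. p \<in> M t \<inter> M w"])
      fix t assume t: "t \<in> T z"
      then have tw: "t \<noteq> w" "t \<in> V - S" using no by (auto simp: T_def)
      obtain p where p: "M t \<inter> M w = {p}" using M_meet[OF tw(2) w tw(1)] card_1_singletonE by blast
      have "p \<in> S"
      proof (rule ccontr)
        assume "p \<notin> S"
        then have pV: "p \<in> V - S" using p M_sub[OF w] by blast
        then have "t \<in> M p" "w \<in> M p" using M_sym p tw w by auto
        moreover have "t \<in> h z" using h[OF z] t by blast
        ultimately have "M p = h z" using same_line[OF M_F(1)[OF pV] hF[OF z], of t w] wz tw by blast
        then show False using M_F(2)[OF pV] h[OF z] by simp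
      qed
      then show "\<exists>p\<in>S. p \<in> M t \<inter> M w" using p by blast
    next
      fix t t' p assume *: "t \<in> T z" "t' \<in> T z" "p \<in> S" "p \<in> M t \<inter> M w" "p \<in> M t' \<inter> M w"
      then show "t = t'" using T_meet[of t t' p z] no by (auto simp: T_def)
    qed
    then show False using cT[OF z] s_q by (simp add: s_def)
  qed
  \<comment> \<open>If incidence failed, the joins of \<open>z'\<close> with the points
    \<open>w\<close> of \<open>T z\<close> would be distinct new lines, since an old join would make
    \<open>M w\<close> equal to \<open>h z'\<close>.\<close>
  have sym3: "z' \<in> h z" if z: "z \<in> S" "z' \<in> S" and zz': "z \<in> h z'" for z z'
  proof (rule ccontr)
    assume no: "z' \<notin> h z"
    have "card (T z) \<le> card New"
    proof (rule card_le_of_inj_choice[OF finNew, where R = "\<lambda>w L. z' \<in> L \<and> w \<in> L"])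
      fix w assume w: "w \<in> T z"
      then have wV: "w \<in> V - S" "z \<in> M w" by (auto simp: T_def)
      then have "w \<noteq> z'" "w \<in> V" "z' \<in> V" using z SV by auto
      then obtain L where L: "L \<in> F'" "w \<in> L" "z' \<in> L" using join by blast
      have "L \<in> New"
      proof (rule ccontr)
        assume "L \<notin> New"
        then obtain u where u: "u \<in> V - S" "L = M u" using old L by blast
        then have "u \<in> h z'" "u \<in> M w" using sym1[OF _ z(2)] M_sym[OF wV(1)] L by auto
        then have "M w = h z'"
          using same_line[OF M_F(1)[OF wV(1)] hF[OF z(2)], of u z] wV zz' u z by blast
        then show False using M_F(2)[OF wV(1)] h[OF z(2)] by simp
      qed
      then show "\<exists>L\<in>New. z' \<in> L \<and> w \<in> L" using L by blast
    next
      fix w w' L assume *: "w \<in> T z" "w' \<in> T z" "L \<in> New" "z' \<in> L \<and> w \<in> L" "z' \<in> L \<and> w' \<in> L"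
      then have "L \<in> F'" "w \<in> h z" "w' \<in> h z" using h[OF z(1)] by (auto simp: New_def)
      then show "w = w'" using same_line[of L "h z" w w'] hF[OF z(1)] * no by blast
    qed
    then show False using cT[OF z(1)] s_q cNew by simp
  qed
  have "polar_incidence V q pl"
  proof
    show "pl x \<subseteq> V" "card (pl x) = q + 1" if "x \<in> V" for x
      using pl_F[OF that] line_sub card_line by auto
    show "card (pl x \<inter> pl y) = 1" if "x \<in> V" "y \<in> V" "x \<noteq> y" for x y
      using lines_meet[OF pl_F[OF that(1)] pl_F[OF that(2)]] inj_onD[OF inj _ that(1,2)] that(3) by blast
    show "y \<in> pl x" if "x \<in> V" "y \<in> V" "x \<in> pl y" for x y
      using that M_sym[of x y] sym1[of y x] sym2[of x y] sym3[of x y]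
      by (auto simp: pl_def split: if_splits)
  qed (use fin card_V in auto)
  then show thesis using that by (auto simp: pl_def)
qed

section \<open>Absolute points as a blocking set\<close>

context polar_incidence
begin

sublocale symrel: finite_symrel V pl
  using fin line_sub sym by unfold_locales blast+

definition absolute :: "'a set" where "absolute = {x \<in> V. x \<in> pl x}"

lemma finite_line: "x \<in> V \<Longrightarrow> finite (pl x)"
  using line_sub fin finite_subset by blast

lemma same_pole:
  assumes "x \<in> V" "y \<in> V" "a \<in> pl x \<inter> pl y" "b \<in> pl x \<inter> pl y" "a \<noteq> b" shows "x = y"
proof (rule ccontr)
  assume "x \<noteq> y"
  then obtain c where "pl x \<inter> pl y = {c}" using meet assms card_1_singletonE by metis
  then show False using assms by auto
qed

text \<open>Without absolute points, the polar line would be paired off by sending \<open>y\<close>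
  to the intersection of \<open>pl y\<close> with it.\<close>

lemma line_meets_absolute:
  assumes "even q" and x: "x \<in> V" shows "\<exists>a\<in>absolute. a \<in> pl x"
proof (rule ccontr)
  assume no: "\<not> ?thesis"
  have "even (card (pl x))"
  proof (rule even_card_of_unique_partners[where R = "\<lambda>y v. v \<in> pl y"])
    show "finite (pl x)" by (rule finite_line[OF x])
    show "v \<in> pl u \<Longrightarrow> u \<in> pl v" if "u \<in> pl x" "v \<in> pl x" for u v
      using that line_sub[OF x] sym by blast
    show "u \<notin> pl u" if "u \<in> pl x" for u
      using that line_sub[OF x] no by (auto simp: absolute_def)
    show "card {v \<in> pl x. v \<in> pl u} = 1" if "u \<in> pl x" for u
    proof -
      have "u \<noteq> x" "u \<in> V" using that line_sub[OF x] no by (auto simp: absolute_def)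
      then show ?thesis using meet[OF x, of u] by (simp add: Int_def)
    qed
  qed
  then show False using card_line[OF x] assms(1) by simp
qed

text \<open>Otherwise \<open>a\<close> and \<open>x\<close> both lie on both polar lines.\<close>

lemma absolute_line:
  assumes "x \<in> absolute" "a \<in> absolute" "a \<in> pl x" shows "a = x"
proof (rule ccontr)
  assume ne: "a \<noteq> x"
  have V: "x \<in> V" "a \<in> V" using assms by (auto simp: absolute_def)
  have "x \<in> pl a" using sym[OF V(2,1)] assms(3) by blast
  then have "x = a" using same_pole[OF V, of x a] assms ne by (auto simp: absolute_def)
  then show False using ne by simp
qed

text \<open>The absolute points form a blocking set; a blocking set of \<open>q + c\<close> points that contains no
  line meets every line in at most \<open>c\<close> points, which leaves too few incident pairs.\<close>

lemma card_absolute: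
  assumes even: "even q" and le: "card absolute \<le> q + c" and c: "c\<^sup>2 < q"
  shows "card absolute = q + 1"
proof (rule ccontr)
  assume ne: "card absolute \<noteq> q + 1"
  define m where "m = int (card absolute)"
  define t where "t u = int (card (pl u \<inter> absolute))" for u
  have aV: "absolute \<subseteq> V" and fa: "finite absolute" using fin by (auto simp: absolute_def)
  have t1: "t u \<ge> 1" if "u \<in> V" for u
    using line_meets_absolute[OF even that] fa card_gt_0_iff[of "pl u \<inter> absolute"]
    by (auto simp: t_def Suc_le_eq)
  have nV: "int (card V) = int q * int q + int q + 1" using card_V by (simp add: power2_eq_square)
  have sum_t: "(\<Sum>u\<in>V. t u) = m * (int q + 1)"
  proof -
    have "(\<Sum>v\<in>absolute. \<Sum>u\<in>pl v. 1::int) = (\<Sum>v\<in>absolute. int q + 1)"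
      using card_line aV by (intro sum.cong refl) auto
    then show ?thesis
      using symrel.sum_over_nbrs[OF aV, of "\<lambda>_. 1"] by (simp add: t_def m_def)
  qed
  have "(\<Sum>u\<in>V. 1) \<le> (\<Sum>u\<in>V. t u)" using t1 by (intro sum_mono) auto
  then have "int q * int q + int q + 1 \<le> m * (int q + 1)" using nV by (simp add: sum_t)
  then have "int q * (int q + 1) < m * (int q + 1)" by (simp add: algebra_simps)
  then have "int q < m" by (simp add: mult_less_cancel_right)
  then have m2: "m \<ge> int q + 2" using ne by (simp add: m_def)
  \<comment> \<open>Projection from a point \<open>p\<close> of \<open>pl u\<close> that is not
    absolute: each of the \<open>q\<close> other lines through \<open>p\<close> contains an absolute
    point off \<open>pl u\<close>.\<close>
  have t_le: "t u \<le> m - int q" if u: "u \<in> V" for u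
  proof -
    \<comment> \<open>A polar line inside \<open>absolute\<close> would meet the polar line of an
      absolute point off it in a second absolute point, against
      \<open>absolute_line\<close>.\<close>
    have "\<not> pl u \<subseteq> absolute"
    proof
      assume sub: "pl u \<subseteq> absolute"
      have "\<not> absolute \<subseteq> pl u"
        using m2 card_mono[OF finite_line[OF u], of absolute] card_line[OF u] by (auto simp: m_def)
      then obtain a where a: "a \<in> absolute" "a \<notin> pl u" by blast
      then have "a \<noteq> u" "a \<in> V" by (auto simp: absolute_def)
      then obtain b where b: "pl a \<inter> pl u = {b}" using meet u card_1_singletonE by metis
      then have "b = a" using absolute_line[OF a(1)] sub by blast
      then show False using b a(2) by blast
    qed
    then obtain p where p: "p \<in> pl u" "p \<notin> absolute" by blast
    have pV: "p \<in> V" "u \<in> pl p" using p line_sub[OF u] sym u by blast+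
    have "card (pl p - {u}) \<le> card (absolute - pl u)"
    proof (rule card_le_of_inj_choice[where R = "\<lambda>v a. a \<in> pl v"])
      fix v assume v: "v \<in> pl p - {u}"
      then have vV: "v \<in> V" "p \<in> pl v" using line_sub[OF pV(1)] sym pV(1) by blast+
      obtain a where a: "a \<in> absolute" "a \<in> pl v" using line_meets_absolute[OF even vV(1)] by blast
      have "a \<notin> pl u"
        using same_pole[OF vV(1) u, of a p] a vV p v by auto
      then show "\<exists>a\<in>absolute - pl u. a \<in> pl v" using a by blast
    next
      fix v v' a assume *: "v \<in> pl p - {u}" "v' \<in> pl p - {u}" "a \<in> absolute - pl u" "a \<in> pl v" "a \<in> pl v'"
      then have "v \<in> V" "v' \<in> V" "p \<in> pl v" "p \<in> pl v'" using line_sub[OF pV(1)] sym pV(1) by blast+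
      then show "v = v'" using same_pole[of v v' a p] * p by blast
    qed (use fa in simp)
    moreover have "card (pl p - {u}) = q" using pV card_line finite_line by simp
    moreover have "card (absolute - pl u) = card absolute - card (pl u \<inter> absolute)"
      using fa by (simp add: card_Diff_subset_Int Int_commute)
    moreover have "card (pl u \<inter> absolute) \<le> card absolute" using fa by (intro card_mono) auto
    ultimately show ?thesis by (simp add: t_def m_def)
  qed
  \<comment> \<open>Any two absolute points lie on exactly one common polar line.\<close>
  have "m * (m - 1) = (\<Sum>a\<in>absolute. \<Sum>b\<in>absolute - {a}. symrel.cd a b)"
  proof -
    have "(\<Sum>a\<in>absolute. \<Sum>b\<in>absolute - {a}. symrel.cd a b) = (\<Sum>a\<in>absolute. \<Sum>b\<in>absolute - {a}. 1)"
      using meet aV by (intro sum.cong refl) (auto simp: symrel.cd_def)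
    also have "\<dots> = (\<Sum>a\<in>absolute. m - 1)"
    proof (intro sum.cong refl)
      fix a assume "a \<in> absolute"
      then show "(\<Sum>b\<in>absolute - {a}. 1) = m - 1"
        using card.remove[OF fa, of a] by (simp add: m_def)
    qed
    finally show ?thesis by (simp add: m_def)
  qed
  also have "\<dots> = (\<Sum>u\<in>V. t u * (t u - 1))"
    using symrel.sum_cd_offdiag[OF aV] by (simp add: t_def)
  also have "\<dots> \<le> (\<Sum>u\<in>V. (m - int q) * (t u - 1))"
  proof (intro sum_mono)
    fix u assume u: "u \<in> V"
    show "t u * (t u - 1) \<le> (m - int q) * (t u - 1)"
      using t_le[OF u] t1[OF u] by (intro mult_right_mono) auto
  qed
  also have "\<dots> = (m - int q) * (m * (int q + 1) - int (card V))"
    by (simp add: sum_distrib_left[symmetric] sum_subtractf sum_t)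
  finally have fin_le: "m * (m - 1) \<le> (m - int q) * (m * (int q + 1) - int (card V))" .
  \<comment> \<open>The number of pairs is about \<open>q^2\<close> and its bound about
    \<open>k^2 * q\<close>, so \<open>k^2 < q\<close> excludes \<open>k >= 2\<close>.\<close>
  define k where "k = m - int q"
  have k: "2 \<le> k" "k \<le> int c" using m2 le by (auto simp: k_def m_def)
  have mk: "m = int q + k" by (simp add: k_def)
  have "(int q + k) * (int q + k - 1) \<le> k * (k * int q + k - 1)"
    using fin_le unfolding nV mk by (simp add: algebra_simps)
  also have "\<dots> \<le> k * (k * int q + k)" using k by (intro mult_left_mono) auto
  also have "\<dots> = (k * k) * (int q + 1)" by (simp add: algebra_simps)
  also have "\<dots> \<le> (int c * int c) * (int q + 1)"
    using k by (intro mult_right_mono mult_mono) auto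
  also have "int c * int c < int q" using c by (simp add: power2_eq_square flip: of_nat_mult)
  then have "(int c * int c) * (int q + 1) \<le> int q * (int q + 1)" by (intro mult_right_mono) auto
  finally have "(int q + k) * (int q + k - 1) \<le> int q * (int q + 1)" .
  moreover have "(int q + 1) * (int q + 1) \<le> (int q + k) * (int q + k - 1)"
    using k by (intro mult_mono) auto
  ultimately show False by (simp add: algebra_simps)
qed

end

section \<open>Copies of the 4-cycle\<close>

definition cyc :: "'a \<Rightarrow> 'a \<Rightarrow> 'a \<Rightarrow> 'a \<Rightarrow> 'a ugraph" where
  "cyc a b c d = ({a, b, c, d}, {{a, b}, {b, c}, {c, d}, {d, a}})"

lemma edges_cyc: "edges (cyc a b c d) = {{a, b}, {b, c}, {c, d}, {d, a}}"
  by (simp add: cyc_def)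

lemma cyc_rotate: "cyc b c d a = cyc a b c d"
  by (auto simp: cyc_def)

lemma cyc_reflect: "cyc b a d c = cyc a b c d"
  by (auto simp: cyc_def insert_commute)

lemma C4_copies_cyc:
  assumes G: "simple_graph G"
  shows "S \<in> C4_copies G \<longleftrightarrow> (\<exists>a b c d. S = cyc a b c d \<and> distinct [a, b, c, d] \<and> edges S \<subseteq> edges G)"
proof
  assume "S \<in> C4_copies G"
  then have S: "subgraph S G" "graph_isomorphic C4 S" by (auto simp: C4_copies_def)
  then obtain f where f: "bij_betw f (verts C4) (verts S)" "edges S = (\<lambda>e. f ` e) ` edges C4"
    by (auto simp: graph_isomorphic_def)
  have inj: "inj_on f {0, 1, 2, 3}" and img: "f ` {0, 1, 2, 3} = verts S"
    using f(1) by (auto simp: bij_betw_def C4_def)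
  have "S = cyc (f 0) (f 1) (f 2) (f 3)"
    using img f(2) by (intro prod_eqI) (auto simp: cyc_def C4_def)
  moreover have "distinct [f 0, f 1, f 2, f 3]"
    using inj by (auto simp: inj_on_def)
  ultimately show "\<exists>a b c d. S = cyc a b c d \<and> distinct [a, b, c, d] \<and> edges S \<subseteq> edges G"
    using S(1) unfolding subgraph_def by blast
next
  assume "\<exists>a b c d. S = cyc a b c d \<and> distinct [a, b, c, d] \<and> edges S \<subseteq> edges G"
  then obtain a b c d where S: "S = cyc a b c d" and dist: "distinct [a, b, c, d]"
    and E: "edges S \<subseteq> edges G" by blast
  define f :: "nat \<Rightarrow> 'a" where "f i = [a, b, c, d] ! i" for i
  have f: "f 0 = a" "f (Suc 0) = b" "f 2 = c" "f 3 = d" by (simp_all add: f_def numeral_eq_Suc)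
  have "bij_betw f {0, 1, 2, 3} {a, b, c, d}"
    using dist by (auto simp: bij_betw_def inj_on_def f)
  then have "graph_isomorphic C4 S"
    unfolding graph_isomorphic_def by (intro exI[of _ f]) (simp add: S cyc_def C4_def f)
  moreover have "\<Union>(edges S) \<subseteq> verts G"
    using E G by (auto simp only: simple_graph_def)
  then have "{a, b, c, d} \<subseteq> verts G"
    by (simp add: S edges_cyc)
  then have "subgraph S G"
    using E dist unfolding subgraph_def simple_graph_def by (auto simp: S cyc_def)
  ultimately show "S \<in> C4_copies G" by (simp add: C4_copies_def)
qed

lemma finite_C4_copies:
  assumes "simple_graph G" shows "finite (C4_copies G)"
proof (rule finite_subset)
  have "finite (edges G)"
    using assms by (auto simp: simple_graph_def intro: finite_subset[of _ "Pow (verts G)"])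
  then show "finite (Pow (verts G) \<times> Pow (edges G))" using assms by (simp add: simple_graph_def)
  show "C4_copies G \<subseteq> Pow (verts G) \<times> Pow (edges G)"
    by (auto simp: C4_copies_def subgraph_def)
qed

text \<open>Rotations and reflections of \<open>cyc\<close> bring any edge to the front, in either
  direction.\<close>

lemma C4_copy_with_edge:
  assumes "S = cyc p r t u" "distinct [p, r, t, u]" "{a, b} \<in> edges S"
  shows "\<exists>c d. S = cyc a b c d \<and> distinct [a, b, c, d]"
proof -
  have *: "\<exists>c d. S = cyc a b c d \<and> distinct [a, b, c, d]"
    if "S = cyc w x y z" "distinct [w, x, y, z]" "{a, b} = {w, x}" for w x y z
  proof -
    from that(3) consider "a = w" "b = x" | "a = x" "b = w" by (auto simp: doubleton_eq_iff)
    then show ?thesis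
    proof cases
      case 1 then show ?thesis using that by blast
    next
      case 2
      then have "S = cyc a b z y" "distinct [a, b, z, y]" using that cyc_reflect[of x w z y] by auto
      then show ?thesis by blast
    qed
  qed
  have S: "S = cyc r t u p" "S = cyc t u p r" "S = cyc u p r t"
    using assms(1) cyc_rotate by metis+
  from assms(3) consider "{a, b} = {p, r}" | "{a, b} = {r, t}" | "{a, b} = {t, u}" | "{a, b} = {u, p}"
    by (auto simp: assms(1) edges_cyc)
  then show ?thesis
    using *[OF assms(1,2)] *[OF S(1)] *[OF S(2)] *[OF S(3)] assms(2) by cases auto
qed

section \<open>Degrees and codegrees in terms of edges and 4-cycles\<close>

definition nbrs :: "'a ugraph \<Rightarrow> 'a \<Rightarrow> 'a set" where
  "nbrs G v = {u. {u, v} \<in> edges G}"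

lemma finite_edges: "simple_graph G \<Longrightarrow> finite (edges G)"
  by (auto simp: simple_graph_def intro: finite_subset[of _ "Pow (verts G)"])

lemma nbrs_in_verts: "simple_graph G \<Longrightarrow> nbrs G v \<subseteq> verts G"
  by (auto simp: nbrs_def simple_graph_def)

lemma not_nbr_self: "simple_graph G \<Longrightarrow> v \<notin> nbrs G v"
  by (auto simp: nbrs_def simple_graph_def)

lemma handshake:
  assumes G: "simple_graph G"
  shows "(\<Sum>v\<in>verts G. card (nbrs G v)) = 2 * card (edges G)"
proof -
  have fV: "finite (verts G)" using G by (simp add: simple_graph_def)
  have "card (nbrs G v) = card {e \<in> edges G. v \<in> e}" for v
  proof -
    have "{e \<in> edges G. v \<in> e} = (\<lambda>u. {u, v}) ` nbrs G v"
    proof (intro equalityI subsetI)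
      fix e assume e: "e \<in> {e \<in> edges G. v \<in> e}"
      then have "card e = 2" using G by (auto simp: simple_graph_def)
      then obtain a b where "e = {a, b}" by (auto simp: card_2_iff)
      then have "e = {a, v} \<or> e = {b, v}" using e by auto
      then show "e \<in> (\<lambda>u. {u, v}) ` nbrs G v" using e by (auto simp: nbrs_def)
    qed (auto simp: nbrs_def)
    moreover have "inj_on (\<lambda>u. {u, v}) (nbrs G v)"
      by (auto simp: inj_on_def doubleton_eq_iff)
    ultimately show ?thesis by (simp add: card_image)
  qed
  then have "(\<Sum>v\<in>verts G. card (nbrs G v)) = (\<Sum>v\<in>verts G. \<Sum>e\<in>{e \<in> edges G. v \<in> e}. 1)"
    by simp
  also have "\<dots> = (\<Sum>e\<in>edges G. \<Sum>v\<in>{v \<in> verts G. v \<in> e}. 1)"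
    using fV finite_edges[OF G] by (rule sum.swap_restrict)
  also have "\<dots> = (\<Sum>e\<in>edges G. 2)"
  proof (intro sum.cong refl)
    fix e assume e: "e \<in> edges G"
    then have "{v \<in> verts G. v \<in> e} = e" "card e = 2" using G by (auto simp: simple_graph_def)
    then show "(\<Sum>v\<in>{v \<in> verts G. v \<in> e}. 1::nat) = 2" by simp
  qed
  finally show ?thesis by simp
qed

definition diagonals :: "'a ugraph \<Rightarrow> ('a \<times> 'a) set" where
  "diagonals S = {(v, w). v \<in> verts S \<and> w \<in> verts S \<and> v \<noteq> w \<and> {v, w} \<notin> edges S}"

lemma card_diagonals_le:
  assumes "simple_graph G" "S \<in> C4_copies G"
  shows "card (diagonals S) \<le> 4"
proof -
  obtain a b c d where S: "S = cyc a b c d" using assms C4_copies_cyc by blast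
  have "diagonals S \<subseteq> {(a, c), (c, a), (b, d), (d, b)}"
    by (auto simp: diagonals_def S cyc_def insert_commute)
  then have "card (diagonals S) \<le> card {(a, c), (c, a), (b, d), (d, b)}"
    by (intro card_mono) auto
  also have "\<dots> \<le> 4" using card_length[of "[(a, c), (c, a), (b, d), (d, b)]"] by simp
  finally show ?thesis .
qed

text \<open>With one common neighbour \<open>a\<close> of \<open>v\<close> and \<open>w\<close>
  fixed, each further one closes a 4-cycle with diagonal \<open>(v, w)\<close>; a 4-cycle has at
  most four ordered diagonals.\<close>

lemma sum_codegree_excess_le:
  assumes G: "simple_graph G"
  shows "(\<Sum>v\<in>verts G. \<Sum>w\<in>verts G - {v}. max 0 (int (card (nbrs G v \<inter> nbrs G w)) - 1))
    \<le> 4 * int (card (C4_copies G))"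
proof -
  define C where "C = C4_copies G"
  define P where "P = Sigma (verts G) (\<lambda>v. verts G - {v})"
  have fV: "finite (verts G)" using G by (simp add: simple_graph_def)
  have fC: "finite C" using finite_C4_copies[OF G] by (simp add: C_def)
  have fP: "finite P" using fV by (simp add: P_def)
  have le: "max 0 (int (card (nbrs G v \<inter> nbrs G w)) - 1) \<le> int (card {S \<in> C. (v, w) \<in> diagonals S})"
    if vw: "v \<noteq> w" for v w
  proof (cases "nbrs G v \<inter> nbrs G w = {}")
    case False
    then obtain a where a: "a \<in> nbrs G v \<inter> nbrs G w" by blast
    let ?B = "nbrs G v \<inter> nbrs G w - {a}"
    have fN: "finite (nbrs G v \<inter> nbrs G w)"
      using nbrs_in_verts[OF G] fV finite_subset by blast
    have "card ?B \<le> card {S \<in> C. (v, w) \<in> diagonals S}"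
    proof (rule card_inj_on_le[where f = "\<lambda>b. cyc v a w b"])
      show "inj_on (\<lambda>b. cyc v a w b) ?B"
      proof (rule inj_onI)
        fix b b' assume b: "b \<in> ?B" "b' \<in> ?B" "cyc v a w b = cyc v a w b'"
        then have "b \<in> {v, a, w, b'}" unfolding cyc_def by auto
        moreover have "b \<noteq> v" "b \<noteq> w" "b \<noteq> a" using b(1) not_nbr_self[OF G] by auto
        ultimately show "b = b'" by blast
      qed
      show "(\<lambda>b. cyc v a w b) ` ?B \<subseteq> {S \<in> C. (v, w) \<in> diagonals S}"
      proof
        fix S assume "S \<in> (\<lambda>b. cyc v a w b) ` ?B"
        then obtain b where b: "b \<in> ?B" "S = cyc v a w b" by blast
        have ne: "a \<noteq> v" "a \<noteq> w" "b \<noteq> v" "b \<noteq> w" "b \<noteq> a"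
          using a b not_nbr_self[OF G] by auto
        have "edges S \<subseteq> edges G" using a b by (auto simp: edges_cyc nbrs_def insert_commute)
        then have "S \<in> C" unfolding C_def C4_copies_cyc[OF G] using b(2) ne vw by auto
        moreover have "(v, w) \<in> diagonals S"
          using ne vw by (auto simp: diagonals_def b(2) cyc_def doubleton_eq_iff)
        ultimately show "S \<in> {S \<in> C. (v, w) \<in> diagonals S}" by blast
      qed
    qed (use fC in simp)
    moreover have "card (nbrs G v \<inter> nbrs G w) = Suc (card ?B)" by (rule card.remove[OF fN a])
    ultimately show ?thesis by simp
  qed simp
  have "(\<Sum>v\<in>verts G. \<Sum>w\<in>verts G - {v}. max 0 (int (card (nbrs G v \<inter> nbrs G w)) - 1))
      \<le> (\<Sum>v\<in>verts G. \<Sum>w\<in>verts G - {v}. int (card {S \<in> C. (v, w) \<in> diagonals S}))"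
    using le by (intro sum_mono) auto
  also have "\<dots> = (\<Sum>p\<in>P. int (card {S \<in> C. p \<in> diagonals S}))"
    using fV by (simp add: P_def sum.Sigma case_prod_beta')
  also have "\<dots> = (\<Sum>p\<in>P. \<Sum>S\<in>{S \<in> C. p \<in> diagonals S}. 1)" by simp
  also have "\<dots> = (\<Sum>S\<in>C. \<Sum>p\<in>{p \<in> P. p \<in> diagonals S}. 1)"
    using fP fC by (rule sum.swap_restrict)
  also have "\<dots> \<le> (\<Sum>S\<in>C. 4)"
  proof (intro sum_mono)
    fix S assume S: "S \<in> C"
    have "verts S \<subseteq> verts G" using S by (auto simp: C_def C4_copies_def subgraph_def)
    then have "diagonals S \<subseteq> verts G \<times> verts G" by (auto simp: diagonals_def)
    then have "finite (diagonals S)" using fV by (meson finite_SigmaI finite_subset)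
    then have "card {p \<in> P. p \<in> diagonals S} \<le> card (diagonals S)" by (intro card_mono) auto
    then show "(\<Sum>p\<in>{p \<in> P. p \<in> diagonals S}. 1) \<le> (4::int)"
      using card_diagonals_le[OF G] S by (fastforce simp: C_def)
  qed
  finally show ?thesis by (simp add: C_def)
qed

section \<open>Paths of length 3 in a polarity graph\<close>

context polar_incidence
begin

definition EH :: "'a set set" where
  "EH = {{x, y} | x y. x \<in> V \<and> y \<in> V \<and> x \<noteq> y \<and> x \<in> pl y}"

lemma EH_iff: "{x, y} \<in> EH \<longleftrightarrow> x \<in> V \<and> y \<in> V \<and> x \<noteq> y \<and> x \<in> pl y"
  using sym by (auto simp: EH_def doubleton_eq_iff)

lemma simple_EH: "simple_graph (V, EH)"
  using fin by (auto simp: simple_graph_def EH_def)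

lemma nbrs_EH: "x \<in> V \<Longrightarrow> nbrs (V, EH) x = pl x - {x}"
  using line_sub by (auto simp: nbrs_def EH_iff)

lemma card_EH: "2 * card EH + card absolute = (q\<^sup>2 + q + 1) * (q + 1)"
proof -
  have "2 * card EH = (\<Sum>x\<in>V. card (nbrs (V, EH) x))"
    using handshake[OF simple_EH] by simp
  moreover have "card absolute = (\<Sum>x\<in>V. if x \<in> pl x then 1 else 0)"
    using fin sum.inter_filter[OF fin, of "\<lambda>_. 1::nat" "\<lambda>x. x \<in> pl x"] by (simp add: absolute_def)
  ultimately have "2 * card EH + card absolute
      = (\<Sum>x\<in>V. card (nbrs (V, EH) x) + (if x \<in> pl x then 1 else 0))"
    by (simp add: sum.distrib)
  also have "\<dots> = (\<Sum>x\<in>V. q + 1)"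
  proof (intro sum.cong refl)
    fix x assume x: "x \<in> V"
    show "card (nbrs (V, EH) x) + (if x \<in> pl x then 1 else 0) = q + 1"
      using card.remove[OF finite_line[OF x], of x] card_line[OF x] by (simp add: nbrs_EH[OF x])
  qed
  finally show ?thesis by (simp add: card_V)
qed

definition paths :: "'a \<Rightarrow> 'a \<Rightarrow> ('a \<times> 'a) set" where
  "paths x y = {(a, b). {x, a} \<in> EH \<and> {a, b} \<in> EH \<and> {b, y} \<in> EH}"

lemma pathsD:
  assumes "(a, b) \<in> paths x y"
  shows "a \<in> V" "b \<in> V" "x \<noteq> a" "a \<noteq> b" "b \<noteq> y" "x \<in> pl a" "a \<in> pl x" "a \<in> pl b" "b \<in> pl a"
    "b \<in> pl y" "y \<in> pl b"
  using assms sym by (auto simp: paths_def EH_iff)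

lemma finite_paths: "finite (paths x y)"
proof (rule finite_subset)
  show "paths x y \<subseteq> V \<times> V" using pathsD by auto
qed (use fin in simp)

lemma path_vertices:
  assumes "{x, y} \<notin> EH" "(a, b) \<in> paths x y"
  shows "a \<noteq> y" "b \<noteq> x"
  using assms by (auto simp: paths_def)

lemma path_unique:
  assumes xy: "x \<in> V" "y \<in> V" "{x, y} \<notin> EH" "(a, b) \<in> paths x y" "(a', b') \<in> paths x y"
    and "a = a' \<or> b = b'"
  shows "(a, b) = (a', b')"
proof -
  note ab = pathsD[OF xy(4)] path_vertices[OF xy(3,4)]
  note ab' = pathsD[OF xy(5)] path_vertices[OF xy(3,5)]
  show ?thesis
  proof (cases "a = a'")
    case True
    then show ?thesis using same_pole[of a y b b'] ab ab' xy by blast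
  next
    case False
    then show ?thesis using same_pole[of b x a a'] ab ab' xy assms(6) by blast
  qed
qed

text \<open>A path is determined by its first inner vertex on \<open>pl x\<close>. Conversely, every
  \<open>a\<close> on \<open>pl x\<close> other than \<open>x\<close> and the common point with
  \<open>pl y\<close> yields a path through the intersection of \<open>pl a\<close> and
  \<open>pl y\<close>.\<close>

lemma card_paths:
  assumes xy: "x \<in> V" "y \<in> V" "x \<noteq> y" "{x, y} \<notin> EH"
  shows "q \<le> card (paths x y) + 1" "card (paths x y) \<le> q + 1"
proof -
  have "card (paths x y) \<le> card (pl x)"
  proof (rule card_le_of_inj_choice[where R = "\<lambda>p a. fst p = a"])
    fix p p' a assume "p \<in> paths x y" "p' \<in> paths x y" "a \<in> pl x" "fst p = a" "fst p' = a"
    then show "p = p'" using path_unique[OF xy(1,2,4), of "fst p" "snd p" "fst p'" "snd p'"]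
      by (cases p; cases p') auto
  qed (use finite_line xy pathsD in force)+
  then show "card (paths x y) \<le> q + 1" using card_line xy by simp
  obtain z where z: "pl x \<inter> pl y = {z}" using meet[OF xy(1-3)] card_1_singletonE by blast
  have "card (pl x - {x} - {z}) \<le> card (paths x y)"
  proof (rule card_le_of_inj_choice[where R = "\<lambda>a p. fst p = a"])
    fix a assume a: "a \<in> pl x - {x} - {z}"
    then have aV: "a \<in> V" "a \<notin> pl y" using line_sub[OF xy(1)] z by blast+
    have ay: "a \<noteq> y" using a xy sym by (auto simp: EH_iff)
    obtain b where b: "pl a \<inter> pl y = {b}" using meet[OF aV(1) xy(2) ay] card_1_singletonE by blast
    have bV: "b \<in> V" using b line_sub[OF aV(1)] by blast
    have "b \<noteq> y"
    proof
      assume "b = y"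
      then have "y \<in> pl a" using b by blast
      then show False using sym[OF xy(2) aV(1)] aV(2) by blast
    qed
    moreover have "a \<noteq> b" using b aV(2) by blast
    ultimately have "(a, b) \<in> paths x y"
      using a aV bV b xy sym[OF aV(1) xy(1)] sym[OF bV aV(1)] by (auto simp: paths_def EH_iff)
    then show "\<exists>p\<in>paths x y. fst p = a" by force
  qed (use finite_paths in auto)
  moreover have "card {x, z} \<le> 2" by (simp add: card_insert_if)
  moreover have "card (pl x) - card {x, z} \<le> card (pl x - {x, z})"
    by (rule diff_card_le_card_Diff) simp
  moreover have "pl x - {x} - {z} = pl x - {x, z}" by blast
  ultimately show "q \<le> card (paths x y) + 1" using card_line[OF xy(1)] by simp
qed

end

section \<open>4-cycles after edge changes\<close>

locale changed_polarity_graph = polar_incidence +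
  fixes D A :: "'a set set"
  assumes D_sub: "D \<subseteq> EH"
    and A_sub: "A \<subseteq> {e. e \<subseteq> V \<and> card e = 2} - EH"
    and card_A: "card A = card D + 1"
begin

definition G :: "'a ugraph" where "G = (V, (EH - D) \<union> A)"

text \<open>Quantifying over both endpoints makes the set independent of the order in which
  \<open>e\<close> is written.\<close>

definition paths_closed_by :: "'a set \<Rightarrow> 'a ugraph set" where
  "paths_closed_by e = {S. \<exists>x y a b. e = {x, y} \<and> (a, b) \<in> paths x y \<and> S = cyc x a b y}"

lemma finite_D: "finite D"
  using D_sub finite_edges[OF simple_EH] finite_subset by auto

lemma finite_A: "finite A"
  using card_A card_ge_0_finite[of A] by simp

lemma simple_G: "simple_graph G"
  using simple_EH A_sub by (auto simp: simple_graph_def G_def)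

lemma A_endpoints:
  assumes "e \<in> A"
  obtains x y where "e = {x, y}" "x \<in> V" "y \<in> V" "x \<noteq> y" "{x, y} \<notin> EH"
proof -
  have e: "card e = 2" "e \<subseteq> V" "e \<notin> EH" using assms A_sub by auto
  then obtain x y where "e = {x, y}" "x \<noteq> y" by (auto simp: card_2_iff)
  then show thesis using e by (intro that[of x y]) auto
qed

lemma paths_closed_by_eq:
  "paths_closed_by {x, y} = (\<lambda>(a, b). cyc x a b y) ` paths x y"
proof (intro equalityI subsetI)
  fix S assume "S \<in> paths_closed_by {x, y}"
  then obtain x' y' a b where S: "{x, y} = {x', y'}" "(a, b) \<in> paths x' y'" "S = cyc x' a b y'"
    by (auto simp: paths_closed_by_def)
  from S(1) consider "x' = x" "y' = y" | "x' = y" "y' = x" by (auto simp: doubleton_eq_iff)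
  then show "S \<in> (\<lambda>(a, b). cyc x a b y) ` paths x y"
  proof cases
    case 1
    then show ?thesis using S by force
  next
    case 2
    then have "(b, a) \<in> paths x y" using S(2) by (auto simp: paths_def insert_commute)
    moreover have "S = cyc x b a y" unfolding S(3) 2 by (auto simp: cyc_def insert_commute)
    ultimately show ?thesis by force
  qed
qed (auto simp: paths_closed_by_def)

lemma cyc_path_distinct:
  assumes "{x, y} \<notin> EH" "x \<noteq> y" "(a, b) \<in> paths x y"
  shows "distinct [x, a, b, y]"
  using pathsD[OF assms(3)] path_vertices[OF assms(1,3)] assms(2) by auto

text \<open>Distinctness of the vertices forces a shared edge into the same position, so the paths
  share an inner vertex and agree. A middle edge shared in opposite directions would have both ends
  on \<open>pl x\<close> and \<open>pl y\<close>.\<close>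

lemma cyc_path_inj:
  assumes xy: "x \<in> V" "y \<in> V" "x \<noteq> y" "{x, y} \<notin> EH"
    and ab: "(a, b) \<in> paths x y" "(a', b') \<in> paths x y"
    and h: "h \<in> EH" "h \<in> edges (cyc x a b y)" "h \<in> edges (cyc x a' b' y)"
  shows "(a, b) = (a', b')"
proof -
  have d: "distinct [x, a, b, y]" "distinct [x, a', b', y]"
    using cyc_path_distinct[OF xy(4,3)] ab by auto
  have hxy: "h \<noteq> {y, x}" using h(1) xy(4) by (auto simp: insert_commute)
  have "h = {x, a} \<or> h = {a, b} \<or> h = {b, y}" "h = {x, a'} \<or> h = {a', b'} \<or> h = {b', y}"
    using h(2,3) hxy by (simp_all add: edges_cyc)
  then have "(a = a' \<or> b = b') \<or> a = b' \<and> b = a'"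
    using d by (elim disjE) (simp_all add: doubleton_eq_iff, blast+)
  then consider "a = a' \<or> b = b'" | "a = b'" "b = a'" by blast
  then show ?thesis
  proof cases
    case 1
    then show ?thesis by (rule path_unique[OF xy(1,2,4) ab])
  next
    case 2
    then have "x = y"
      using same_pole[OF xy(1,2), of a b] pathsD[OF ab(1)] pathsD[OF ab(2)] by blast
    then show ?thesis using xy(3) by blast
  qed
qed

lemma edges_paths_closed_by:
  assumes "e \<in> A" "S \<in> paths_closed_by e"
  shows "edges S \<inter> A = {e}" "edges S - {e} \<subseteq> EH"
proof -
  obtain x y where xy: "e = {x, y}" using A_endpoints[OF assms(1)] by metis
  obtain a b where ab: "(a, b) \<in> paths x y" "S = cyc x a b y"
    using assms(2) unfolding xy paths_closed_by_eq by auto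
  have "edges S = {{x, a}, {a, b}, {b, y}, e}" by (auto simp: ab(2) edges_cyc xy insert_commute)
  moreover have "{{x, a}, {a, b}, {b, y}} \<subseteq> EH" using ab(1) by (auto simp: paths_def)
  ultimately show "edges S \<inter> A = {e}" "edges S - {e} \<subseteq> EH" using A_sub assms(1) by auto
qed

lemma card_paths_closed_by:
  assumes "e \<in> A"
  shows "q \<le> card (paths_closed_by e) + 1" "card (paths_closed_by e) \<le> q + 1" "finite (paths_closed_by e)"
proof -
  obtain x y where xy: "e = {x, y}" "x \<in> V" "y \<in> V" "x \<noteq> y" "{x, y} \<notin> EH"
    using A_endpoints[OF assms] by metis
  have "inj_on (\<lambda>(a, b). cyc x a b y) (paths x y)"
  proof (rule inj_onI, clarify)
    fix a b a' b' assume *: "(a, b) \<in> paths x y" "(a', b') \<in> paths x y" "cyc x a b y = cyc x a' b' y"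
    have "{x, a} \<in> EH" using *(1) by (auto simp: paths_def)
    moreover have "{x, a} \<in> edges (cyc x a b y)" by (simp add: edges_cyc)
    ultimately have "(a, b) = (a', b')" using cyc_path_inj[OF xy(2-5) *(1,2)] *(3) by metis
    then show "a = a' \<and> b = b'" by simp
  qed
  then have "card (paths_closed_by e) = card (paths x y)"
    unfolding xy(1) paths_closed_by_eq by (rule card_image)
  then show "q \<le> card (paths_closed_by e) + 1" "card (paths_closed_by e) \<le> q + 1"
    using card_paths[OF xy(2-5)] by simp_all
  show "finite (paths_closed_by e)" unfolding xy(1) paths_closed_by_eq using finite_paths by simp
qed

lemma card_with_deleted_le_1:
  assumes "e \<in> A" "h \<in> D"
  shows "card {S \<in> paths_closed_by e. h \<in> edges S} \<le> 1"
proof -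
  obtain x y where xy: "e = {x, y}" "x \<in> V" "y \<in> V" "x \<noteq> y" "{x, y} \<notin> EH"
    using A_endpoints[OF assms(1)] by metis
  have "S = S'" if S: "S \<in> paths_closed_by e" "S' \<in> paths_closed_by e" "h \<in> edges S" "h \<in> edges S'" for S S'
  proof -
    obtain a b a' b' where "(a, b) \<in> paths x y" "S = cyc x a b y" "(a', b') \<in> paths x y" "S' = cyc x a' b' y"
      using S(1,2) unfolding xy(1) paths_closed_by_eq by auto
    then show ?thesis using cyc_path_inj[OF xy(2-5), of a b a' b' h] S(3,4) assms(2) D_sub by auto
  qed
  then show ?thesis
    using card_le_Suc0_iff_eq[of "{S \<in> paths_closed_by e. h \<in> edges S}"] card_paths_closed_by(3)[OF assms(1)]
    by auto
qed

text \<open>Each added edge closes at least \<open>q - 1\<close> paths, and each of the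
  \<open>card A - 1\<close> deleted edges destroys at most one of them. The remaining cycles contain
  a single added edge, so those of different added edges are distinct.\<close>

lemma C4_lower: "int (card A) * int q - (int (card A))\<^sup>2 \<le> int (card (C4_copies G))"
proof -
  define L where "L e = {S \<in> paths_closed_by e. edges S \<inter> D = {}}" for e
  have finL: "finite (L e)" if "e \<in> A" for e
    using card_paths_closed_by(3)[OF that] by (simp add: L_def)
  have cL: "int q - int (card A) \<le> int (card (L e))" if e: "e \<in> A" for e
  proof -
    have "paths_closed_by e \<subseteq> L e \<union> (\<Union>h\<in>D. {S \<in> paths_closed_by e. h \<in> edges S})"
      by (auto simp: L_def)
    then have "card (paths_closed_by e) \<le> card (L e \<union> (\<Union>h\<in>D. {S \<in> paths_closed_by e. h \<in> edges S}))"
      using finL[OF e] finite_D card_paths_closed_by(3)[OF e] by (intro card_mono) auto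
    also have "\<dots> \<le> card (L e) + card (\<Union>h\<in>D. {S \<in> paths_closed_by e. h \<in> edges S})"
      by (rule card_Un_le)
    also have "card (\<Union>h\<in>D. {S \<in> paths_closed_by e. h \<in> edges S})
        \<le> (\<Sum>h\<in>D. card {S \<in> paths_closed_by e. h \<in> edges S})"
      by (rule card_UN_le[OF finite_D])
    also have "\<dots> \<le> (\<Sum>h\<in>D. 1)" using card_with_deleted_le_1[OF e] by (intro sum_mono) auto
    finally show ?thesis using card_paths_closed_by(1)[OF e] card_A by simp
  qed
  have "L e \<subseteq> C4_copies G" if e: "e \<in> A" for e
  proof
    fix S assume S: "S \<in> L e"
    then have S': "S \<in> paths_closed_by e" "edges S \<inter> D = {}" by (auto simp: L_def)
    obtain x y where xy: "e = {x, y}" "x \<in> V" "y \<in> V" "x \<noteq> y" "{x, y} \<notin> EH"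
      using A_endpoints[OF e] by metis
    obtain a b where ab: "(a, b) \<in> paths x y" "S = cyc x a b y"
      using S'(1) unfolding xy(1) paths_closed_by_eq by auto
    have "edges S \<subseteq> edges G"
      using edges_paths_closed_by[OF e S'(1)] S'(2) e by (auto simp: G_def)
    then show "S \<in> C4_copies G"
      unfolding C4_copies_cyc[OF simple_G] using ab(2) cyc_path_distinct[OF xy(5,4) ab(1)] by blast
  qed
  then have "card (\<Union>e\<in>A. L e) \<le> card (C4_copies G)"
    using finite_C4_copies[OF simple_G] by (intro card_mono) auto
  moreover have "card (\<Union>e\<in>A. L e) = (\<Sum>e\<in>A. card (L e))"
  proof (rule card_UN_disjoint)
    show "\<forall>e\<in>A. \<forall>e'\<in>A. e \<noteq> e' \<longrightarrow> L e \<inter> L e' = {}"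
    proof (intro ballI impI, rule ccontr)
      fix e e' assume *: "e \<in> A" "e' \<in> A" "e \<noteq> e'" "L e \<inter> L e' \<noteq> {}"
      then obtain S where "S \<in> paths_closed_by e" "S \<in> paths_closed_by e'" by (auto simp: L_def)
      then have "{e} = {e'}" using edges_paths_closed_by(1) *(1,2) by metis
      then show False using *(3) by simp
    qed
  qed (use finite_A finL in auto)
  ultimately have "(\<Sum>e\<in>A. int (card (L e))) \<le> int (card (C4_copies G))" by (simp flip: of_nat_sum)
  moreover have "(\<Sum>e\<in>A. int q - int (card A)) \<le> (\<Sum>e\<in>A. int (card (L e)))"
    using cL by (intro sum_mono) auto
  ultimately show ?thesis by (simp add: power2_eq_square right_diff_distrib)
qed

text \<open>A 4-cycle with at least two added edges either contains two opposite added edges, or its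
  added edges are two adjacent ones.\<close>

definition multi :: "'a set set \<Rightarrow> 'a ugraph set" where
  "multi X = {S \<in> C4_copies G. X \<subseteq> edges S \<and> (\<Inter>X = {} \<or> edges S - X \<subseteq> EH)}"

text \<open>No 4-cycle lies in \<open>EH\<close>, where two points have at most one common
  neighbour. If no two opposite edges are both added, each opposite pair contains at most one added
  edge, so there are at most two in all.\<close>

lemma C4_copy_cases:
  assumes "S \<in> C4_copies G"
  shows "S \<in> (\<Union>e\<in>A. paths_closed_by e) \<union> (\<Union>X\<in>{X. X \<subseteq> A \<and> card X = 2}. multi X)"
proof -
  obtain a b c d where S: "S = cyc a b c d" and dist: "distinct [a, b, c, d]" and E: "edges S \<subseteq> edges G"
    using assms C4_copies_cyc[OF simple_G] by blast
  have ES: "edges S - A \<subseteq> EH" using E by (auto simp: G_def)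
  have fin_int: "finite (edges S \<inter> A)" using finite_A by simp
  consider (none) "edges S \<inter> A = {}" | (one) e where "edges S \<inter> A = {e}" | (more) "2 \<le> card (edges S \<inter> A)"
  proof -
    have "card (edges S \<inter> A) = 0 \<or> card (edges S \<inter> A) = 1 \<or> 2 \<le> card (edges S \<inter> A)" by linarith
    then show thesis using that fin_int by (auto simp: card_1_singleton_iff)
  qed
  then show ?thesis
  proof cases
    case none
    then have "{a, b} \<in> EH" "{b, c} \<in> EH" "{c, d} \<in> EH" "{d, a} \<in> EH"
      using ES by (auto simp: S edges_cyc)
    then have "b \<in> pl a \<inter> pl c" "d \<in> pl a \<inter> pl c" "a \<in> V" "c \<in> V"
      using sym by (auto simp: EH_iff)
    then have "a = c" using same_pole[of a c b d] dist by auto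
    then show ?thesis using dist by simp
  next
    case one
    then have e: "e \<in> A" "e \<in> edges S" "edges S - {e} \<subseteq> EH" using ES by auto
    obtain x y where xy: "e = {x, y}" "{x, y} \<notin> EH" using A_endpoints[OF e(1)] by metis
    obtain u v where uv: "S = cyc y x u v" "distinct [y, x, u, v]"
      using C4_copy_with_edge[OF S dist, of y x] e(2) xy by (auto simp: insert_commute)
    have "{x, u} \<noteq> e" "{u, v} \<noteq> e" "{v, y} \<noteq> e"
      using uv(2) by (auto simp: xy(1) doubleton_eq_iff)
    moreover have "{{x, u}, {u, v}, {v, y}} \<subseteq> edges S" by (simp add: uv(1) edges_cyc)
    ultimately have "(u, v) \<in> paths x y" using e(3) by (auto simp: paths_def)
    moreover have "S = cyc x u v y" using uv(1) cyc_rotate[of x u v y] by simp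
    ultimately have "S \<in> paths_closed_by e" unfolding paths_closed_by_def xy(1) by blast
    then show ?thesis using e(1) by blast
  next
    case more
    have opp: "{a, b} \<inter> {c, d} = {}" "{b, c} \<inter> {d, a} = {}" using dist by auto
    have "\<exists>X. X \<subseteq> A \<and> card X = 2 \<and> S \<in> multi X"
    proof (cases "{a, b} \<in> A \<and> {c, d} \<in> A \<or> {b, c} \<in> A \<and> {d, a} \<in> A")
      case True
      then obtain e e' where "e \<in> A" "e' \<in> A" "e \<inter> e' = {}" "e \<in> edges S" "e' \<in> edges S" "e \<noteq> {}"
        using opp by (auto simp: S edges_cyc)
      then have "{e, e'} \<subseteq> A" "card {e, e'} = 2" "S \<in> multi {e, e'}"
        using assms by (auto simp: multi_def card_insert_if)
      then show ?thesis by blast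
    next
      case False
      have "card (edges S \<inter> A) \<le> 2"
      proof -
        have card_2_le: "card {u, v} \<le> 2" for u v :: "'a set"
          using card_length[of "[u, v]"] by simp
        have "edges S \<inter> A \<subseteq> {if {a, b} \<in> A then {a, b} else {c, d}, if {b, c} \<in> A then {b, c} else {d, a}}"
          using False by (auto simp: S edges_cyc)
        then have "card (edges S \<inter> A)
            \<le> card {if {a, b} \<in> A then {a, b} else {c, d}, if {b, c} \<in> A then {b, c} else {d, a}}"
          by (intro card_mono) auto
        also have "\<dots> \<le> 2" by (rule card_2_le)
        finally show ?thesis .
      qed
      then have "card (edges S \<inter> A) = 2" using more by simp
      moreover have "S \<in> multi (edges S \<inter> A)" using assms ES by (auto simp: multi_def)
      ultimately show ?thesis by blast
    qed
    then show ?thesis by blast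
  qed
qed

text \<open>Two disjoint edges can be completed to a 4-cycle in two ways. Two adjacent ones leave
  only the fourth vertex, the unique common neighbour in \<open>EH\<close> of their outer
  ends.\<close>

lemma card_multi_le:
  assumes X: "X \<subseteq> A" "card X = 2"
  shows "card (multi X) \<le> 2" "finite (multi X)"
proof -
  show "finite (multi X)"
    using finite_C4_copies[OF simple_G] by (simp add: multi_def)
  obtain e e' where ee': "X = {e, e'}" "e \<noteq> e'" using X(2) by (auto simp: card_2_iff)
  obtain a b where e: "e = {a, b}" "a \<noteq> b" using A_endpoints X(1) ee'(1) by (metis insert_subset)
  obtain c d where e': "e' = {c, d}" "c \<noteq> d" using A_endpoints X(1) ee'(1) by (metis insert_subset)
  have "\<exists>S1 S2. multi X \<subseteq> {S1, S2}"
  proof (cases "e \<inter> e' = {}")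
    case True
    have "multi X \<subseteq> {cyc a b c d, cyc a b d c}"
    proof
      fix S assume S: "S \<in> multi X"
      then obtain p r t u where "S = cyc p r t u" "distinct [p, r, t, u]"
        using C4_copies_cyc[OF simple_G] by (auto simp: multi_def)
      moreover have "{a, b} \<in> edges S" "{c, d} \<in> edges S"
        using S by (auto simp: multi_def ee'(1) e(1) e'(1))
      ultimately obtain v w where "S = cyc a b v w" "{c, d} \<in> edges S"
        using C4_copy_with_edge by metis
      then show "S \<in> {cyc a b c d, cyc a b d c}"
        using True by (auto simp: e(1) e'(1) edges_cyc doubleton_eq_iff)
    qed
    then show ?thesis by blast
  next
    case False
    then obtain x y z where xyz: "e = {x, y}" "e' = {y, z}" "x \<noteq> z" "x \<noteq> y" "y \<noteq> z"
      using e e' ee'(2) by (auto simp: insert_commute) 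
    have common: "\<exists>w. S = cyc x y z w \<and> w \<in> pl x \<inter> pl z \<and> x \<in> V \<and> z \<in> V" if S: "S \<in> multi X" for S
    proof -
      have "\<Inter>X \<noteq> {}" using xyz ee'(1) by auto
      then have SX: "{x, y} \<in> edges S" "{y, z} \<in> edges S" "edges S - X \<subseteq> EH"
        using S by (auto simp: multi_def ee'(1) xyz)
      obtain p r t u where "S = cyc p r t u" "distinct [p, r, t, u]"
        using C4_copies_cyc[OF simple_G] S by (auto simp: multi_def)
      then obtain v w where vw: "S = cyc x y v w" "distinct [x, y, v, w]"
        using C4_copy_with_edge SX(1) by metis
      then have vz: "v = z" using SX(2) xyz by (auto simp: edges_cyc doubleton_eq_iff)
      have "{z, w} \<notin> X" "{w, x} \<notin> X" using vw(2) vz by (auto simp: ee'(1) xyz doubleton_eq_iff)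
      then have "{z, w} \<in> EH" "{w, x} \<in> EH" using SX(3) vw(1) vz by (auto simp: edges_cyc)
      then show ?thesis using vw(1) vz sym by (auto simp: EH_iff)
    qed
    have "multi X \<subseteq> {S1, S1}" if S1: "S1 \<in> multi X" for S1
    proof
      fix S assume S: "S \<in> multi X"
      obtain w w' where "S = cyc x y z w" "S1 = cyc x y z w'" "w \<in> pl x \<inter> pl z" "w' \<in> pl x \<inter> pl z" "x \<in> V" "z \<in> V"
        using common[OF S] common[OF S1] by blast
      then show "S \<in> {S1, S1}" using same_pole[of x z w w'] xyz(3) by blast
    qed
    then show ?thesis by blast
  qed
  then obtain S1 S2 where "multi X \<subseteq> {S1, S2}" by blast
  then have "card (multi X) \<le> card {S1, S2}" by (intro card_mono) auto
  also have "\<dots> \<le> 2" using card_length[of "[S1, S2]"] by simp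
  finally show "card (multi X) \<le> 2" .
qed

text \<open>At most \<open>q + 1\<close> cycles for each added edge and 2 for each pair of added
  edges; with the binomial coefficient this is exactly the bound.\<close>

lemma C4_upper: "int (card (C4_copies G)) \<le> int (card A) * int q + (int (card A))\<^sup>2"
proof -
  let ?X = "{X. X \<subseteq> A \<and> card X = 2}"
  have finX: "finite ?X" using finite_A by simp
  have "C4_copies G \<subseteq> (\<Union>e\<in>A. paths_closed_by e) \<union> (\<Union>X\<in>?X. multi X)"
    using C4_copy_cases by blast
  then have "card (C4_copies G) \<le> card ((\<Union>e\<in>A. paths_closed_by e) \<union> (\<Union>X\<in>?X. multi X))"
    using finite_A finX card_paths_closed_by(3) card_multi_le(2) by (intro card_mono) auto
  also have "\<dots> \<le> card (\<Union>e\<in>A. paths_closed_by e) + card (\<Union>X\<in>?X. multi X)" by (rule card_Un_le)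
  also have "\<dots> \<le> (\<Sum>e\<in>A. card (paths_closed_by e)) + (\<Sum>X\<in>?X. card (multi X))"
    by (intro add_mono card_UN_le finite_A finX)
  also have "\<dots> \<le> (\<Sum>e\<in>A. q + 1) + (\<Sum>X\<in>?X. 2)"
    using card_paths_closed_by(2) card_multi_le(1) by (intro add_mono sum_mono) auto
  also have "\<dots> = card A * (q + 1) + (card A choose 2) * 2"
    using n_subsets[OF finite_A, of 2] by simp
  also have "(card A choose 2) * 2 = card A * (card A - 1)"
  proof -
    have "even (card A * (card A - 1))" by auto
    then show ?thesis by (simp add: choose_two)
  qed
  finally have "int (card (C4_copies G)) \<le> int (card A * (q + 1) + card A * (card A - 1))"
    by (simp only: of_nat_le_iff)
  also have "\<dots> = int (card A) * int q + (int (card A))\<^sup>2"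
    using card_A by (simp add: of_nat_diff power2_eq_square algebra_simps)
  finally show ?thesis .
qed

end

section \<open>Proof of the theorem\<close>

text \<open>The polar line map carries all the information. It is injective, because equal lines
  would share \<open>q + 1\<close> points, so the lines are its values and the poles are given by
  its inverse.\<close>

lemma orthogonal_polarity_graph_iff:
  assumes "1 \<le> q"
  shows "orthogonal_polarity_graph q H \<longleftrightarrow> (\<exists>pl. polar_incidence (verts H) q pl \<and>
    edges H = polar_incidence.EH (verts H) pl \<and> card (polar_incidence.absolute (verts H) pl) = q + 1)"
proof
  assume "orthogonal_polarity_graph q H"
  then obtain P \<L> \<pi> where pp: "projective_plane q P \<L>" and op: "orthogonal_polarity q P \<L> \<pi>"
    and H: "H = polarity_graph P \<pi>"
    by (auto simp: orthogonal_polarity_graph_def)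
  have pol: "bij_betw \<pi> (P <+> \<L>) (P <+> \<L>)" "\<forall>z \<in> P <+> \<L>. \<pi> (\<pi> z) = z"
    "\<pi> ` (Inl ` P) = Inr ` \<L>" "\<forall>x\<in>P. \<forall>L\<in>\<L>. x \<in> L \<longrightarrow> pole \<pi> L \<in> polar_line \<pi> x"
    using op by (auto simp: orthogonal_polarity_def polarity_def)
  define pl where "pl = polar_line \<pi>"
  have img: "pl x \<in> \<L> \<and> \<pi> (Inl x) = Inr (pl x)" if "x \<in> P" for x
  proof -
    have "\<pi> (Inl x) \<in> Inr ` \<L>" using that pol(3) by blast
    then show ?thesis by (auto simp: pl_def polar_line_def)
  qed
  have lines: "pl x \<subseteq> P" "card (pl x) = q + 1" if "x \<in> P" for x
    using img[OF that] pp by (auto simp: projective_plane_def)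
  have inj: "x = y" if "x \<in> P" "y \<in> P" "pl x = pl y" for x y
  proof -
    have "\<pi> (\<pi> (Inl x)) = Inl x" "\<pi> (\<pi> (Inl y)) = Inl y" using pol(2) that(1,2) by auto
    then show ?thesis using img[OF that(1)] img[OF that(2)] that(3) by simp
  qed
  have inc: "polar_incidence P q pl"
  proof
    show "finite P" "card P = q\<^sup>2 + q + 1" using pp by (auto simp: projective_plane_def)
    show "pl x \<subseteq> P" "card (pl x) = q + 1" if "x \<in> P" for x using lines[OF that] .
    show "card (pl x \<inter> pl y) = 1" if xy: "x \<in> P" "y \<in> P" "x \<noteq> y" for x y
    proof -
      have "pl x \<in> \<L>" "pl y \<in> \<L>" "pl x \<noteq> pl y" using img inj xy by blast+
      then have "\<exists>!z. z \<in> pl x \<inter> pl y" using pp by (auto simp: projective_plane_def)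
      then show ?thesis by (simp only: card_1_singleton_iff[unfolded One_nat_def[symmetric]]) blast
    qed
    show "y \<in> pl x" if xy: "x \<in> P" "y \<in> P" "x \<in> pl y" for x y
    proof -
      have "pole \<pi> (pl y) \<in> pl x" using pol(4) xy img[OF xy(2)] by (simp add: pl_def)
      moreover have "\<pi> (\<pi> (Inl y)) = Inl y" using pol(2) xy(2) by auto
      then have "pole \<pi> (pl y) = y" using img[OF xy(2)] by (simp add: pole_def)
      ultimately show ?thesis by simp
    qed
  qed
  have VH: "verts H = P" and EH: "edges H = polar_incidence.EH P pl"
    by (simp_all add: H polarity_graph_def polar_incidence.EH_def[OF inc, unfolded pl_def] pl_def)
  have "card (polar_incidence.absolute P pl) = q + 1"
    using op by (simp add: polar_incidence.absolute_def[OF inc, unfolded pl_def] orthogonal_polarity_def absolute_points_def pl_def)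
  then show "\<exists>pl. polar_incidence (verts H) q pl \<and>
    edges H = polar_incidence.EH (verts H) pl \<and> card (polar_incidence.absolute (verts H) pl) = q + 1"
    using inc VH EH by auto
next
  assume "\<exists>pl. polar_incidence (verts H) q pl \<and>
    edges H = polar_incidence.EH (verts H) pl \<and> card (polar_incidence.absolute (verts H) pl) = q + 1"
  then obtain pl where inc: "polar_incidence (verts H) q pl"
    and EH: "edges H = polar_incidence.EH (verts H) pl"
    and abs: "card (polar_incidence.absolute (verts H) pl) = q + 1" by blast
  interpret polar_incidence "verts H" q pl by (rule inc)
  define P where "P = verts H"
  define \<L> where "\<L> = pl ` P"
  define \<pi> where "\<pi> = case_sum (\<lambda>x. Inr (pl x)) (\<lambda>L. Inl (inv_into P pl L))"
  have inj: "inj_on pl P"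
  proof (rule inj_onI, rule ccontr)
    fix x y assume "x \<in> P" "y \<in> P" "pl x = pl y" "x \<noteq> y"
    then show False using meet[of x y] card_line[of x] assms by (simp add: P_def)
  qed
  have line_img: "L \<in> \<L> \<longleftrightarrow> (\<exists>x\<in>P. L = pl x)" for L by (auto simp: \<L>_def)
  have inv: "inv_into P pl (pl x) = x" if "x \<in> P" for x using inj that by (rule inv_into_f_f)
  have \<pi>: "\<pi> (Inl x) = Inr (pl x)" "\<pi> (Inr L) = Inl (inv_into P pl L)" for x L by (simp_all add: \<pi>_def)
  have plane: "projective_plane q P \<L>"
    unfolding projective_plane_def
  proof (intro conjI ballI impI)
    show "finite P" "card P = q\<^sup>2 + q + 1" using fin card_V by (simp_all add: P_def)
    show "L \<subseteq> P" "card L = q + 1" if "L \<in> \<L>" for L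
      using that line_sub card_line by (auto simp: line_img P_def)
    show "card {L \<in> \<L>. x \<in> L} = q + 1" if x: "x \<in> P" for x
    proof -
      have "{L \<in> \<L>. x \<in> L} = pl ` (pl x)"
        using x sym line_sub by (fastforce simp: \<L>_def P_def)
      moreover have "inj_on pl (pl x)"
        using inj line_sub x by (auto simp: P_def intro: inj_on_subset)
      ultimately show ?thesis using card_line x by (simp add: card_image P_def)
    qed
    show "\<exists>!x. x \<in> L \<inter> M" if LM: "L \<in> \<L>" "M \<in> \<L>" "L \<noteq> M" for L M
    proof -
      obtain x y where "x \<in> P" "y \<in> P" "L = pl x" "M = pl y" using LM(1,2) by (auto simp: \<L>_def)
      then have "card (L \<inter> M) = 1" using meet LM(3) by (auto simp: P_def)
      then obtain z where "L \<inter> M = {z}" by (rule card_1_singletonE)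
      then show ?thesis by auto
    qed
  qed
  have "\<pi> z \<in> P <+> \<L> \<and> \<pi> (\<pi> z) = z" if "z \<in> P <+> \<L>" for z
    using that inv by (auto simp: \<pi> \<L>_def)
  then have invol: "\<forall>z\<in>P <+> \<L>. \<pi> z \<in> P <+> \<L> \<and> \<pi> (\<pi> z) = z" by blast
  have "polarity P \<L> \<pi>"
    unfolding polarity_def
  proof (intro conjI ballI impI)
    show "bij_betw \<pi> (P <+> \<L>) (P <+> \<L>)"
      using invol by (intro bij_betw_byWitness[where f' = \<pi>]) blast+
    show "\<pi> (\<pi> z) = z" if "z \<in> P <+> \<L>" for z using that invol by blast
    show "\<pi> ` Inl ` P = Inr ` \<L>" by (simp add: \<pi> \<L>_def image_image)
    show "\<pi> ` Inr ` \<L> = Inl ` P" using inv by (simp add: \<pi> \<L>_def image_image cong: image_cong_simp)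
    show "pole \<pi> L \<in> polar_line \<pi> x" if "x \<in> P" "L \<in> \<L>" "x \<in> L" for x L
      using that inv sym by (auto simp: pole_def polar_line_def \<pi> line_img P_def)
  qed
  moreover have pl: "polar_line \<pi> x = pl x" for x by (simp add: polar_line_def \<pi>)
  moreover have "absolute_points P \<pi> = absolute"
    by (simp add: absolute_points_def absolute_def pl P_def)
  ultimately have "orthogonal_polarity q P \<L> \<pi>" using abs by (simp add: orthogonal_polarity_def)
  moreover have "H = polarity_graph P \<pi>"
    using EH by (intro prod_eqI) (simp_all add: polarity_graph_def EH_def pl P_def)
  ultimately show "orthogonal_polarity_graph q H"
    using plane unfolding orthogonal_polarity_graph_def by blast
qed

text \<open>Orthogonality fixes the edge count of \<open>H\<close>, which \<open>G\<close> exceeds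
  by one, so exactly \<open>s\<close> of the \<open>2 * s - 1\<close> changes are additions.\<close>

lemma (in polar_incidence) C4_bounds:
  assumes abs: "card absolute = q + 1"
    and changes: "obtained_by_edge_changes (V, EH) (2 * s - 1) G"
    and edges: "2 * card (edges G) = q * (q + 1)\<^sup>2 + 2" and s: "1 \<le> s"
  shows "int s * int q - (int s)\<^sup>2 \<le> int (card (C4_copies G))"
    and "int (card (C4_copies G)) \<le> int s * int q + (int s)\<^sup>2"
proof -
  obtain D A where DA: "D \<subseteq> EH" "finite A" "A \<subseteq> {e. e \<subseteq> V \<and> card e = 2} - EH"
    "card D + card A = 2 * s - 1" "G = (V, (EH - D) \<union> A)"
    using changes by (auto simp: obtained_by_edge_changes_def)
  have fE: "finite EH" using finite_edges[OF simple_EH] by simp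
  have "card ((EH - D) \<union> A) = card (EH - D) + card A"
    using DA fE by (intro card_Un_disjoint) auto
  moreover have "card (EH - D) + card D = card EH"
    using DA(1) fE by (metis card_Diff_subset card_mono finite_subset le_add_diff_inverse2)
  moreover have "2 * card EH = q * (q + 1)\<^sup>2"
    using card_EH abs by (simp add: power2_eq_square algebra_simps)
  ultimately have "card A = card D + 1" using edges DA(5) by simp
  then interpret changed_polarity_graph V q pl D A
    using DA(1,3) by unfold_locales
  have "card A = s" using card_A DA(4) s by simp
  moreover have "local.G = G" using DA(5) by (simp add: G_def)
  ultimately show "int s * int q - (int s)\<^sup>2 \<le> int (card (C4_copies G))"
    and "int (card (C4_copies G)) \<le> int s * int q + (int s)\<^sup>2"
    using C4_lower C4_upper by simp_all
qed

lemma near_polarity_graph: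
  fixes G :: "'a ugraph" and q l :: nat
  defines "K \<equiv> 4 * (int l + 1)"
  assumes G: "simple_graph G" and card_V: "card (verts G) = q\<^sup>2 + q + 1"
    and edges: "2 * card (edges G) = q * (q + 1)\<^sup>2 + 2" and even: "even q"
    and few: "int (card (C4_copies G)) < (int l + 1) * int q - (int l + 1)\<^sup>2"
    and large: "\<And>m. m \<in> thresholds K \<Longrightarrow> m \<le> int q" and q4: "4 \<le> q"
  obtains pl s where "polar_incidence (verts G) q pl"
    "card (polar_incidence.absolute (verts G) pl) = q + 1" "s \<in> {1..l}"
    "obtained_by_edge_changes (verts G, polar_incidence.EH (verts G) pl) (2 * s - 1) G"
proof -
  interpret fs: finite_symrel "verts G" "nbrs G"
    using G nbrs_in_verts[OF G]
    by unfold_locales (auto simp: simple_graph_def nbrs_def insert_commute)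
  interpret g: large_near_extremal "verts G" "nbrs G" "int q" K
  proof unfold_locales
    show "v \<notin> nbrs G v" if "v \<in> verts G" for v by (rule not_nbr_self[OF G])
    show "int (card (verts G)) = (int q)\<^sup>2 + int q + 1" using card_V by simp
    have "(\<Sum>v\<in>verts G. fs.d v) = int (\<Sum>v\<in>verts G. card (nbrs G v))"
      by (simp add: fs.d_def)
    also have "\<dots> = int (q * (q + 1)\<^sup>2 + 2)" using handshake[OF G] edges by simp
    finally show "(\<Sum>v\<in>verts G. fs.d v) = int q * (int q + 1)\<^sup>2 + 2" by simp
    show "even (int q)" using even by simp
    show "1 \<le> K" by (simp add: K_def)
    show "4 \<le> int q" using q4 by simp
    have "(\<Sum>v\<in>verts G. \<Sum>w\<in>verts G - {v}. max 0 (fs.cd v w - 1)) \<le> 4 * int (card (C4_copies G))"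
      using sum_codegree_excess_le[OF G] by (simp add: fs.cd_def)
    also have "\<dots> \<le> K * int q"
    proof -
      have "K * int q = 4 * ((int l + 1) * int q)" by (simp add: K_def)
      moreover have "0 \<le> (int l + 1)\<^sup>2" by simp
      ultimately show ?thesis using few by linarith
    qed
    finally show "(\<Sum>v\<in>verts G. \<Sum>w\<in>verts G - {v}. max 0 (fs.cd v w - 1)) \<le> K * int q" .
  qed (use large in auto)
  define \<sigma> where "\<sigma> = nat (core_bd K)"
  have \<sigma>: "int \<sigma> = core_bd K" using g.bds(16) by (simp add: \<sigma>_def)
  have core: "card g.core \<le> \<sigma>" using g.card_core \<sigma> by simp
  have "int (\<sigma>\<^sup>2 + 2 * \<sigma>) < int q" using g.q_bds(8) by (simp add: \<sigma>)
  then have \<sigma>_q: "\<sigma>\<^sup>2 + 2 * \<sigma> < q" by (simp only: of_nat_less_iff)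
  moreover have "(card g.core)\<^sup>2 \<le> \<sigma>\<^sup>2" using core by (intro power_mono) auto
  ultimately have core_q: "(card g.core)\<^sup>2 + 2 * card g.core < q" using core by linarith
  obtain pl where inc: "polar_incidence (verts G) q pl"
    and pl: "\<And>w. w \<in> verts G - g.core \<Longrightarrow> pl w = g.M w"
  proof (rule polar_extension[OF fs.fin card_V g.core_V core_q, of g.M])
    show "g.M w \<subseteq> verts G" if "w \<in> verts G - g.core" for w using g.M.sub that by blast
    show "card (g.M w) = q + 1" if "w \<in> verts G - g.core" for w
      using g.card_M_core[OF that] by linarith
    show "card (g.M w \<inter> g.M z) = 1" if "w \<in> verts G - g.core" "z \<in> verts G - g.core" "w \<noteq> z" for w z
      using g.card_M_Int_core[OF that] .
    show "z \<in> g.M w" if "w \<in> verts G - g.core" "z \<in> verts G - g.core" "w \<in> g.M z" for w z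
      using g.M.sym that by blast
  qed blast
  interpret polar_incidence "verts G" q pl by (rule inc)
  \<comment> \<open>Outside the core the polar lines are rows of \<open>M\<close>, so an absolute
    point there carries a loop.\<close>
  have "absolute \<subseteq> g.Abs \<union> g.core"
    using pl g.irrefl by (auto simp: absolute_def g.M_def split: if_splits)
  then have "card absolute \<le> card (g.Abs \<union> g.core)"
    using g.finite_Abs finite_subset[OF g.core_V fs.fin] by (intro card_mono) auto
  also have "\<dots> \<le> card g.Abs + card g.core" by (rule card_Un_le)
  finally have "int (card absolute) \<le> int q + (abs_hi K + core_bd K)"
    using g.card_Abs_le g.card_core by linarith
  moreover define c where "c = nat (abs_hi K + core_bd K)"
  have c: "int c = abs_hi K + core_bd K" using g.bds(10,16) by (simp add: c_def)
  ultimately have "card absolute \<le> q + c" by linarith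
  moreover have "int (c\<^sup>2) < int q" using g.q_bds(9) by (simp add: c)
  then have "c\<^sup>2 < q" by (simp only: of_nat_less_iff)
  ultimately have abs: "card absolute = q + 1" by (rule card_absolute[OF even])
  define D where "D = EH - edges G"
  define A where "A = edges G - EH"
  have G_eq: "G = (verts G, (EH - D) \<union> A)" by (intro prod_eqI) (auto simp: D_def A_def)
  \<comment> \<open>A pair with an end outside the core is decided by a row of \<open>M\<close>, so
    changes are confined to the core.\<close>
  have agree: "e \<in> edges G \<longleftrightarrow> e \<in> EH" if e: "e \<subseteq> verts G" "card e = 2" "\<not> e \<subseteq> g.core" for e
  proof -
    obtain x y where xy: "e = {x, y}" "x \<noteq> y" "x \<notin> g.core"
      using e(2,3) by (auto simp: card_2_iff insert_commute)
    then have V: "x \<in> verts G - g.core" "y \<in> verts G" using e(1) by auto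
    have "e \<in> edges G \<longleftrightarrow> y \<in> nbrs G x" by (simp add: xy(1) nbrs_def insert_commute)
    also have "\<dots> \<longleftrightarrow> y \<in> pl x" using pl[OF V(1)] xy(2) by (auto simp: g.M_def)
    also have "\<dots> \<longleftrightarrow> e \<in> EH" using V xy(1,2) sym by (auto simp: EH_iff)
    finally show ?thesis .
  qed
  have E2: "e \<subseteq> verts G \<and> card e = 2" if "e \<in> edges G \<or> e \<in> EH" for e
    using that G simple_EH by (auto simp: simple_graph_def)
  have fE: "finite EH" "finite (edges G)" using finite_edges[OF simple_EH] finite_edges[OF G] by auto
  have "A \<subseteq> (\<lambda>(x, y). {x, y}) ` (g.core \<times> g.core)"
  proof
    fix e assume "e \<in> A"
    then have "e \<subseteq> g.core" "card e = 2" using agree E2 by (auto simp: A_def)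
    then obtain x y where "e = {x, y}" "x \<in> g.core" "y \<in> g.core" by (auto simp: card_2_iff)
    then show "e \<in> (\<lambda>(x, y). {x, y}) ` (g.core \<times> g.core)" by force
  qed
  then have "card A \<le> card (g.core \<times> g.core)"
    using finite_subset[OF g.core_V fs.fin] by (intro surj_card_le) auto
  also have "\<dots> \<le> \<sigma> * \<sigma>" using core by (simp add: card_cartesian_product mult_mono)
  finally have cA: "card A \<le> \<sigma>\<^sup>2" by (simp add: power2_eq_square)
  have "card EH + card A = card (edges G) + card D"
    using card_Int_Diff[OF fE(1), of "edges G"] card_Int_Diff[OF fE(2), of EH]
    by (simp add: D_def A_def Int_commute)
  moreover have "2 * card EH = q * (q + 1)\<^sup>2"
    using card_EH abs by (simp add: power2_eq_square algebra_simps)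
  ultimately have cAD: "card A = card D + 1" using edges by simp
  then have "card D + card A = 2 * card A - 1" by simp
  then have changes: "obtained_by_edge_changes (verts G, EH) (2 * card A - 1) G"
    unfolding obtained_by_edge_changes_def
    using G_eq fE E2 by (intro exI[of _ D] exI[of _ A]) (auto simp: D_def A_def)
  \<comment> \<open>The value of \<open>a * q - a^2\<close> exceeds that at \<open>l + 1\<close> by
    \<open>(a - (l + 1)) * (q - a - (l + 1))\<close>, nonnegative in the permitted range; more than
    \<open>l\<close> additions would thus give too many 4-cycles.\<close>
  have "card A \<le> l"
  proof (rule ccontr)
    assume "\<not> card A \<le> l"
    define a where "a = int (card A)"
    have a: "int l + 1 \<le> a" using \<open>\<not> card A \<le> l\<close> by (simp add: a_def)
    have "4 * error_bd K \<ge> K" using g.bds(11,12) by (simp add: error_bd_def K_def)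
    then have "int l + 1 \<le> core_bd K" using g.bds(14) by (simp add: core_bd_def K_def)
    moreover have "a \<le> int (\<sigma>\<^sup>2)" using cA by (simp only: a_def of_nat_le_iff)
    ultimately have "a + (int l + 1) \<le> int q" using \<sigma>_q \<sigma> by linarith
    then have "0 \<le> (a - (int l + 1)) * (int q - a - (int l + 1))" using a by simp
    then have "(int l + 1) * int q - (int l + 1)\<^sup>2 \<le> a * int q - a\<^sup>2"
      by (simp add: power2_eq_square algebra_simps)
    also have "\<dots> \<le> int (card (C4_copies G))"
      using C4_bounds(1)[OF abs changes edges] cAD by (simp add: a_def)
    finally show False using few by simp
  qed
  then show thesis using that[OF inc abs _ changes] cAD by simp
qed

theorem theorem1p8:
  shows "\<forall>l::nat. l \<ge> 1 \<longrightarrow> (\<exists>q0::nat. \<forall>q::nat. even q \<and> q \<ge> q0 \<longrightarrow>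
    (\<forall>G :: 'a ugraph.
       simple_graph G \<and> card (verts G) = q\<^sup>2 + q + 1 \<and>
       real (card (edges G)) = 1/2 * real q * (real q + 1)\<^sup>2 + 1 \<longrightarrow>
       (int (card (C4_copies G)) \<ge> (int l + 1) * int q - (int l + 1)\<^sup>2 \<or>
        (\<exists>s\<in>{1..l}. \<exists>H. orthogonal_polarity_graph q H \<and> verts H = verts G \<and>
             obtained_by_edge_changes H (2 * s - 1) G)) \<and>
       (\<forall>s\<in>{1..l}. \<forall>H. orthogonal_polarity_graph q H \<and> verts H = verts G \<and>
             obtained_by_edge_changes H (2 * s - 1) G \<longrightarrow>
          int s * int q - (int s)\<^sup>2 \<le> int (card (C4_copies G)) \<and>
          int (card (C4_copies G)) \<le> int s * int q + (int s)\<^sup>2)))"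
proof (intro allI impI)
  fix l :: nat assume "l \<ge> 1"
  define K where "K = 4 * (int l + 1)"
  define q0 where "q0 = nat (Max (insert 4 (thresholds K)))"
  have large: "m \<le> int q" if "q0 \<le> q" "m \<in> insert 4 (thresholds K)" for q m
  proof -
    have "m \<le> Max (insert 4 (thresholds K))"
      using that(2) by (intro Max_ge) (auto simp: thresholds_def)
    then show ?thesis using that(1) by (simp add: q0_def)
  qed
  show "\<exists>q0::nat. \<forall>q::nat. even q \<and> q \<ge> q0 \<longrightarrow>
    (\<forall>G :: 'a ugraph.
       simple_graph G \<and> card (verts G) = q\<^sup>2 + q + 1 \<and>
       real (card (edges G)) = 1/2 * real q * (real q + 1)\<^sup>2 + 1 \<longrightarrow>
       (int (card (C4_copies G)) \<ge> (int l + 1) * int q - (int l + 1)\<^sup>2 \<or>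
        (\<exists>s\<in>{1..l}. \<exists>H. orthogonal_polarity_graph q H \<and> verts H = verts G \<and>
             obtained_by_edge_changes H (2 * s - 1) G)) \<and>
       (\<forall>s\<in>{1..l}. \<forall>H. orthogonal_polarity_graph q H \<and> verts H = verts G \<and>
             obtained_by_edge_changes H (2 * s - 1) G \<longrightarrow>
          int s * int q - (int s)\<^sup>2 \<le> int (card (C4_copies G)) \<and>
          int (card (C4_copies G)) \<le> int s * int q + (int s)\<^sup>2))"
  proof (rule exI[of _ q0], intro allI impI, elim conjE)
    fix q :: nat and G :: "'a ugraph"
    assume q: "even q" "q0 \<le> q" and G: "simple_graph G" "card (verts G) = q\<^sup>2 + q + 1"
      and E: "real (card (edges G)) = 1/2 * real q * (real q + 1)\<^sup>2 + 1"
    have q4: "4 \<le> q" using large[OF q(2), of 4] by simp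
    then have q1: "1 \<le> q" by simp
    have "real (2 * card (edges G)) = real (q * (q + 1)\<^sup>2 + 2)" using E by (simp add: algebra_simps)
    then have edges: "2 * card (edges G) = q * (q + 1)\<^sup>2 + 2" by (simp only: of_nat_eq_iff)
    have dichotomy: "int (card (C4_copies G)) \<ge> (int l + 1) * int q - (int l + 1)\<^sup>2 \<or>
        (\<exists>s\<in>{1..l}. \<exists>H. orthogonal_polarity_graph q H \<and> verts H = verts G \<and>
             obtained_by_edge_changes H (2 * s - 1) G)"
    proof (rule disjCI)
      assume no: "\<not> (\<exists>s\<in>{1..l}. \<exists>H. orthogonal_polarity_graph q H \<and> verts H = verts G \<and>
             obtained_by_edge_changes H (2 * s - 1) G)"
      show "int (card (C4_copies G)) \<ge> (int l + 1) * int q - (int l + 1)\<^sup>2"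
      proof (rule ccontr)
        assume "\<not> ?thesis"
        then have few: "int (card (C4_copies G)) < (int l + 1) * int q - (int l + 1)\<^sup>2" by simp
        obtain pl s where pl: "polar_incidence (verts G) q pl"
          "card (polar_incidence.absolute (verts G) pl) = q + 1" "s \<in> {1..l}"
          "obtained_by_edge_changes (verts G, polar_incidence.EH (verts G) pl) (2 * s - 1) G"
          using near_polarity_graph[OF G edges q(1) few _ q4] large[OF q(2)] unfolding K_def by blast
        then have "orthogonal_polarity_graph q (verts G, polar_incidence.EH (verts G) pl)"
          unfolding orthogonal_polarity_graph_iff[OF q1] by auto
        then show False using no pl(3,4) by auto
      qed
    qed
    have "int s * int q - (int s)\<^sup>2 \<le> int (card (C4_copies G)) \<and>
        int (card (C4_copies G)) \<le> int s * int q + (int s)\<^sup>2"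
      if s: "s \<in> {1..l}" and H: "orthogonal_polarity_graph q H" "verts H = verts G"
        "obtained_by_edge_changes H (2 * s - 1) G" for s H
    proof -
      obtain pl where pl: "polar_incidence (verts H) q pl"
        "edges H = polar_incidence.EH (verts H) pl" "card (polar_incidence.absolute (verts H) pl) = q + 1"
        using H(1) unfolding orthogonal_polarity_graph_iff[OF q1] by blast
      have "H = (verts H, polar_incidence.EH (verts H) pl)"
        using pl(2) by (intro prod_eqI) simp_all
      then show ?thesis
        using polar_incidence.C4_bounds[OF pl(1,3) _ edges, of s] H(3) s by auto
    qed
    then show "(int (card (C4_copies G)) \<ge> (int l + 1) * int q - (int l + 1)\<^sup>2 \<or>
        (\<exists>s\<in>{1..l}. \<exists>H. orthogonal_polarity_graph q H \<and> verts H = verts G \<and>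
             obtained_by_edge_changes H (2 * s - 1) G)) \<and>
       (\<forall>s\<in>{1..l}. \<forall>H. orthogonal_polarity_graph q H \<and> verts H = verts G \<and>
             obtained_by_edge_changes H (2 * s - 1) G \<longrightarrow>
          int s * int q - (int s)\<^sup>2 \<le> int (card (C4_copies G)) \<and>
          int (card (C4_copies G)) \<le> int s * int q + (int s)\<^sup>2)"
      using dichotomy by blast
  qed
qed

end
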